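(* Let $d\ge1$, $0<\alpha<1$, and let $u_0\in L^1(\mathbb R^d)\cap\mathcal C_b(\mathbb R^d)$ with $u_0\ge0$. For each $n\in\mathbb N$ let $u^{(n)}$ be a classical solution, with $\varepsilon=\frac1n$, of the problem $$\begin{cases}u_t=\nabla\cdot\bigl((\varepsilon+u_+)^\alpha\nabla v\bigr)+\varepsilon\Delta u&\text{in }(0,+\infty)\times\mathbb R^d,\\ -\Delta v=u&\text{in }(0,+\infty)\times\mathbb R^d,\\ u(t,x)\to0&\text{as }|x|\to+\infty,\ t>0,\\ u=u_0&\text{at }t=0,\end{cases}$$ where $v=\mathrm N(u)$ is the Newtonian potential of $u(t,\cdot)$. Then, for every $T>0$, with $Q_T=(0,T)\times\mathbb R^d$, there is a subsequence of $u^{(n)}$ converging weakly in $L^1_{loc}(Q_T)$ and weakly-$\star$ in $L^\infty(Q_T)$, and the limit is nonnegative and belongs to $L^1(Q_T)\cap L^\infty(Q_T)$.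
   Context: $u_+=\max(u,0)$; $\mathcal C_b$ denotes bounded continuous functions; weak convergence in $L^1_{loc}(Q_T)$ means weak convergence in $L^1(K)$ for every bounded measurable $K\subset Q_T$. $\mathrm N(u)$ is the Newtonian potential (inverse of $-\Delta$ on $\mathbb R^d$); only its gradient enters, and for $u(t,\cdot)\in L^1\cap L^\infty$ it is $\nabla\mathrm N(u)(t,x)=-\dfrac1{d\omega_d}\displaystyle\int_{\mathbb R^d}\frac{x-z}{|x-z|^d}\,u(t,z)\,dz$, with $\omega_d$ the volume of the unit ball of $\mathbb R^d$. A classical solution is a function $u$, continuous on $[0,\infty)\times\mathbb R^d$, bounded on $[0,T]\times\mathbb R^d$ for each $T$, with $u\in\mathcal C([0,\infty);L^1(\mathbb R^d))$, once continuously differentiable in $t$ and twice in $x$ for $t>0$, which satisfies the equation pointwise and takes the initial datum. *)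

theory Defs
  imports "HOL-Analysis.Analysis"
begin

text \<open>The space \<open>R\<^sup>d\<close> is an arbitrary type \<open>'a :: euclidean_space\<close> with \<open>d = DIM('a) \<ge> 1\<close>.\<close>

subsection \<open>Partial derivatives\<close>

text \<open>\<open>deriv\<close> is a total function, so existence of the derivatives is always required
  separately.\<close>

definition partial_exists :: "'a \<Rightarrow> ('a::euclidean_space \<Rightarrow> real) \<Rightarrow> 'a \<Rightarrow> bool" where
  "partial_exists i f x \<longleftrightarrow> (\<lambda>s::real. f (x + s *\<^sub>R i)) field_differentiable (at 0)"

definition partial :: "'a \<Rightarrow> ('a::euclidean_space \<Rightarrow> real) \<Rightarrow> 'a \<Rightarrow> real" where
  "partial i f x = deriv (\<lambda>s::real. f (x + s *\<^sub>R i)) 0"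

definition divergence_exists :: "('a::euclidean_space \<Rightarrow> 'a) \<Rightarrow> 'a \<Rightarrow> bool" where
  "divergence_exists F x \<longleftrightarrow> (\<forall>i\<in>Basis. partial_exists i (\<lambda>y. F y \<bullet> i) x)"

definition divergence :: "('a::euclidean_space \<Rightarrow> 'a) \<Rightarrow> 'a \<Rightarrow> real" where
  "divergence F x = (\<Sum>i\<in>Basis. partial i (\<lambda>y. F y \<bullet> i) x)"

definition laplacian :: "('a::euclidean_space \<Rightarrow> real) \<Rightarrow> 'a \<Rightarrow> real" where
  "laplacian f x = (\<Sum>i\<in>Basis. partial i (partial i f) x)"

definition C12 :: "(real \<Rightarrow> 'a::euclidean_space \<Rightarrow> real) \<Rightarrow> bool" where
  "C12 u \<longleftrightarrow>
     (\<forall>t>0. \<forall>x. (\<lambda>s. u s x) field_differentiable (at t)) \<and>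
     continuous_on ({0<..} \<times> UNIV) (\<lambda>(t, x). deriv (\<lambda>s. u s x) t) \<and>
     (\<forall>i\<in>Basis.
        (\<forall>t>0. \<forall>x. partial_exists i (u t) x) \<and>
        continuous_on ({0<..} \<times> UNIV) (\<lambda>(t, x). partial i (u t) x) \<and>
        (\<forall>j\<in>Basis.
           (\<forall>t>0. \<forall>x. partial_exists j (partial i (u t)) x) \<and>
           continuous_on ({0<..} \<times> UNIV) (\<lambda>(t, x). partial j (partial i (u t)) x)))"

subsection \<open>The regularised problem\<close>

text \<open>The gradient of the Newtonian potential of \<open>w \<in> L\<^sup>1 \<inter> L\<^sup>\<infinity>\<close>.\<close>

definition grad_newton :: "('a::euclidean_space \<Rightarrow> real) \<Rightarrow> 'a \<Rightarrow> 'a" where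
  "grad_newton w x =
     - (1 / (real DIM('a) * measure lborel (ball (0::'a) 1))) *\<^sub>R
       (LINT z|lborel. (w z / norm (x - z) ^ DIM('a)) *\<^sub>R (x - z))"

definition continuous_L1 :: "(real \<Rightarrow> 'a::euclidean_space \<Rightarrow> real) \<Rightarrow> bool" where
  "continuous_L1 u \<longleftrightarrow>
     (\<forall>t\<ge>0. integrable lborel (u t)) \<and>
     (\<forall>s\<ge>0. ((\<lambda>t. LINT x|lborel. \<bar>u t x - u s x\<bar>) \<longlongrightarrow> 0) (at s within {0..}))"

text \<open>The potential \<open>v = N(u)\<close> enters only through its gradient, so \<open>- \<Delta>v = u\<close> is written as
  \<open>- div (\<nabla>v) = u\<close>.\<close>

definition classical_solution ::
  "real \<Rightarrow> real \<Rightarrow> ('a::euclidean_space \<Rightarrow> real) \<Rightarrow> (real \<Rightarrow> 'a \<Rightarrow> real) \<Rightarrow> bool" where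
  "classical_solution \<alpha> \<epsilon> u0 u \<longleftrightarrow>
     continuous_on ({0..} \<times> UNIV) (\<lambda>(t, x). u t x) \<and>
     (\<forall>T. bounded ((\<lambda>(t, x). u t x) ` ({0..T} \<times> UNIV))) \<and>
     continuous_L1 u \<and>
     C12 u \<and>
     (\<forall>t>0. \<forall>x.
        let F = (\<lambda>y. ((\<epsilon> + max (u t y) 0) powr \<alpha>) *\<^sub>R grad_newton (u t) y)
        in divergence_exists F x \<and>
           deriv (\<lambda>s. u s x) t = divergence F x + \<epsilon> * laplacian (u t) x) \<and>
     (\<forall>t>0. \<forall>x.
        divergence_exists (grad_newton (u t)) x \<and>
        - divergence (grad_newton (u t)) x = u t x) \<and>
     (\<forall>t>0. (u t \<longlongrightarrow> 0) at_infinity) \<and>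
     (\<forall>x. u 0 x = u0 x)"

subsection \<open>Weak convergence\<close>

definition cylinder :: "real \<Rightarrow> (real \<times> 'a::euclidean_space) set" where
  "cylinder T = {0<..<T} \<times> UNIV"

definition ess_bounded :: "'b measure \<Rightarrow> ('b \<Rightarrow> real) \<Rightarrow> bool" where
  "ess_bounded M f \<longleftrightarrow> f \<in> borel_measurable M \<and> (\<exists>C. AE z in M. \<bar>f z\<bar> \<le> C)"

text \<open>Weak convergence in \<open>L\<^sup>1(M)\<close>, with the dual of \<open>L\<^sup>1(M)\<close> identified with
  \<open>L\<^sup>\<infinity>(M)\<close> (\<open>M\<close> is \<open>\<sigma>\<close>-finite in all uses).\<close>

definition weakly_converges_L1 ::
  "'b measure \<Rightarrow> (nat \<Rightarrow> 'b \<Rightarrow> real) \<Rightarrow> ('b \<Rightarrow> real) \<Rightarrow> bool" where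
  "weakly_converges_L1 M f g \<longleftrightarrow>
     (\<forall>k. integrable M (f k)) \<and> integrable M g \<and>
     (\<forall>\<phi>. ess_bounded M \<phi> \<longrightarrow>
        (\<lambda>k. LINT z|M. f k z * \<phi> z) \<longlonglongrightarrow> (LINT z|M. g z * \<phi> z))"

definition weakly_converges_L1_loc ::
  "'b::euclidean_space set \<Rightarrow> (nat \<Rightarrow> 'b \<Rightarrow> real) \<Rightarrow> ('b \<Rightarrow> real) \<Rightarrow> bool" where
  "weakly_converges_L1_loc Q f g \<longleftrightarrow>
     (\<forall>K. K \<in> sets lebesgue \<and> bounded K \<and> K \<subseteq> Q \<longrightarrow> weakly_converges_L1 (lebesgue_on K) f g)"

definition weakstar_converges_Linf ::
  "'b measure \<Rightarrow> (nat \<Rightarrow> 'b \<Rightarrow> real) \<Rightarrow> ('b \<Rightarrow> real) \<Rightarrow> bool" where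
  "weakstar_converges_Linf M f g \<longleftrightarrow>
     (\<forall>k. ess_bounded M (f k)) \<and> ess_bounded M g \<and>
     (\<forall>\<phi>. integrable M \<phi> \<longrightarrow>
        (\<lambda>k. LINT z|M. f k z * \<phi> z) \<longlonglongrightarrow> (LINT z|M. g z * \<phi> z))"

end

theory Submission
  imports Defs "HOL-Library.Diagonal_Subsequence"
begin

text \<open>Penalising with \<open>\<delta> |x|\<^sup>2\<close> gives a maximum principle on the whole space: at an extremum the
  term \<open>- (\<epsilon> + u\<^sub>+)\<^sup>\<alpha> u\<close> coming from \<open>- \<Delta>v = u\<close> wins against the bounded drift, so
  \<open>0 \<le> u \<le> sup u\<^sub>0\<close> for every \<open>\<epsilon>\<close>. Testing the equation with a cutoff, and the weak form of
  \<open>- \<Delta>v = u\<close> with the cutoff times \<open>(\<epsilon> + u)\<^sup>\<alpha> - \<epsilon>\<^sup>\<alpha>\<close>, shows that the mass does not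
  increase. Both bounds are uniform in \<open>\<epsilon>\<close>, and the claim follows from the weak-\<open>\<star>\<close> sequential
  compactness of bounded sets in \<open>L\<^sup>\<infinity>\<close>: a diagonal argument on a countable \<open>\<pi>\<close>-system, a
  Dynkin argument and the Radon-Nikodym theorem produce the limit.\<close>

subsection \<open>Weak-\<open>\<star>\<close> sequential compactness\<close>

text \<open>Little is known at infinity: no decay of derivatives, and u tends to 0 only for each
  fixed t, not uniformly in t. Hence extrema are not known to be attained and integrals of
  divergences over R^d cannot simply be discarded; penalty and cutoff repair this. Moreover
  \<open>grad_newton\<close> is only known to have partial derivatives point by point, not
  continuous ones, so the divergence theorem is not at hand for it. The weak Poisson equation is
  therefore obtained from the integral formula: Fubini reduces it to the identity div (x / |x|^d) =
  d \<omega>_d \<delta>_0 tested against a C^1 function. The bound on grad v, and every constant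
  built from it, may depend on \<epsilon>. This is harmless: for fixed \<epsilon> such constants
  only multiply quantities sent to zero, a power of the penalty parameter or 1/r for a cutoff radius
  r. What survives is sup u0 and the integral of u0. The sup bound alone yields a weak-\<star>
  limit, but on a cylinder of infinite measure not its integrability; that is what the mass bound is
  for.\<close>

lemma diagonal_convergent_subsequence:
  fixes a :: "nat \<Rightarrow> nat \<Rightarrow> real"
  assumes bdd: "\<And>i. bounded (range (a i))"
  obtains r :: "nat \<Rightarrow> nat" where "strict_mono r" "\<And>i. convergent (\<lambda>k. a i (r k))"
proof -
  interpret subseqs "\<lambda>i r. convergent (\<lambda>k. a i (r k))"
  proof
    fix n and s :: "nat \<Rightarrow> nat" assume "strict_mono s"
    have "bounded (range (\<lambda>k. a n (s k)))"
      by (rule bounded_subset[OF bdd[of n]]) auto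
    then obtain l r where "strict_mono r" "((\<lambda>k. a n (s k)) \<circ> r) \<longlonglongrightarrow> l"
      using bounded_imp_convergent_subsequence by blast
    then show "\<exists>r'. strict_mono r' \<and> convergent (\<lambda>k. a n ((s \<circ> r') k))"
      by (auto simp: o_def convergent_def)
  qed
  show thesis
  proof (rule that[OF subseq_diagseq])
    fix i
    have "convergent (\<lambda>k. a i ((diagseq \<circ> ((+) (Suc i))) k))"
    proof (rule diagseq_holds)
      fix r s :: "nat \<Rightarrow> nat" and n assume "strict_mono r" "convergent (\<lambda>k. a n (s k))"
      then show "convergent (\<lambda>k. a n ((s \<circ> r) k))"
        using convergent_subseq_convergent[of "\<lambda>k. a n (s k)" r] by (simp add: o_def)
    qed
    then show "convergent (\<lambda>k. a i (diagseq k))"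
      using convergent_ignore_initial_segment[of "\<lambda>k. a i (diagseq k)" "Suc i"]
      by (simp add: o_def add.commute)
  qed
qed

text \<open>Countability lets a diagonal argument reach every generator, stability under
  intersection lets a Dynkin argument pass from the generators to all Borel sets. Finite
  intersections of a countable base give both; the empty intersection contributes
  \<open>UNIV\<close>, which keeps \<open>G\<close> nonempty for
  \<open>from_nat_into\<close>.\<close>

lemma borel_countable_Int_stable_generator:
  obtains E :: "nat \<Rightarrow> 'b::second_countable_topology set"
  where "Int_stable (range E)" "sets borel = sigma_sets UNIV (range E)"
proof -
  obtain B :: "'b set set" where B: "countable B" "topological_basis B"
    using ex_countable_basis by blast
  define G where "G = Inter ` {F. finite F \<and> F \<subseteq> B}"
  have cG: "countable G"
    unfolding G_def using B(1) by (intro countable_image) (simp add: countable_Collect_finite_subset)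
  have UG: "UNIV \<in> G" unfolding G_def by (rule image_eqI[of _ _ "{}"]) auto
  have "range (from_nat_into G) = G" using cG UG by (intro range_from_nat_into) auto
  moreover have "Int_stable G"
  proof (rule Int_stableI)
    fix a b assume "a \<in> G" "b \<in> G"
    then obtain F F' where "finite F" "F \<subseteq> B" "a = \<Inter>F" "finite F'" "F' \<subseteq> B" "b = \<Inter>F'"
      unfolding G_def by auto
    then show "a \<inter> b \<in> G" unfolding G_def by (intro image_eqI[of _ _ "F \<union> F'"]) auto
  qed
  moreover have "sets borel = sigma_sets UNIV G"
  proof
    have "sets borel = sigma_sets UNIV B"
      using borel_eq_countable_basis[OF B] by (metis sets_measure_of top_greatest Pow_UNIV)
    moreover have "B \<subseteq> G"
    proof
      fix b assume "b \<in> B" then show "b \<in> G" unfolding G_def by (intro image_eqI[of _ _ "{b}"]) auto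
    qed
    ultimately show "sets borel \<subseteq> sigma_sets UNIV G" using sigma_sets_mono'[of B G] by simp
    have "open b" if "b \<in> G" for b
      using that topological_basis_open[OF B(2)] unfolding G_def by (auto intro!: open_Inter)
    then have "G \<subseteq> sets borel" by auto
    then show "sigma_sets UNIV G \<subseteq> sets borel"
      using sets.sigma_sets_subset[of G borel] by (simp add: space_borel)
  qed
  ultimately show thesis using that[of "from_nat_into G"] by simp
qed

text \<open>The sets over which the integrals converge along the diagonal subsequence form a Dynkin
  system, so convergence on the countably many \<open>E i\<close> spreads to all measurable sets.
  The limits define a measure dominated by C times \<open>M\<close>, and \<open>U\<close> is its
  density.\<close>

lemma (in finite_measure) setwise_limit:
  fixes f :: "nat \<Rightarrow> 'a \<Rightarrow> real" and E :: "nat \<Rightarrow> 'a set"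
  assumes f[measurable]: "\<And>k. f k \<in> borel_measurable M"
    and bdd: "\<And>k x. 0 \<le> f k x \<and> f k x \<le> C"
    and gen: "Int_stable (range E)" "sets M = sigma_sets (space M) (range E)"
  obtains r :: "nat \<Rightarrow> nat" and U
  where "strict_mono r" "U \<in> borel_measurable M" "\<And>x. 0 \<le> U x \<and> U x \<le> C"
    "\<And>A. A \<in> sets M \<Longrightarrow> (\<lambda>k. \<integral>x. f (r k) x * indicator A x \<partial>M) \<longlonglongrightarrow> (\<integral>x. U x * indicator A x \<partial>M)"
proof -
  have C0: "0 \<le> C" using bdd[of 0 undefined] by linarith
  have sE: "E i \<in> sets M" for i using gen(2) by auto
  have int: "integrable M (\<lambda>x. f k x * indicator A x)" if [measurable]: "A \<in> sets M" for k A
    by (rule integrable_const_bound[of _ C]) (use bdd C0 in \<open>auto simp: indicator_def abs_mult\<close>)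
  have bound: "0 \<le> (\<integral>x. f k x * indicator A x \<partial>M) \<and> (\<integral>x. f k x * indicator A x \<partial>M) \<le> C * measure M A"
    if [measurable]: "A \<in> sets M" for k A
  proof -
    have "(\<integral>x. f k x * indicator A x \<partial>M) \<le> (\<integral>x. C * indicator A x \<partial>M)"
    proof (rule integral_mono)
      show "integrable M (\<lambda>x. C * indicator A x)"
        by (rule integrable_const_bound[of _ C]) (use C0 in \<open>auto simp: indicator_def\<close>)
    qed (use bdd int[OF that, of k] C0 in \<open>auto simp: indicator_def\<close>)
    also have "\<dots> = C * measure M A" using that by simp
    finally show ?thesis using bdd by (auto intro!: integral_nonneg_AE)
  qed
  \<comment> \<open>The whole space joins the generators because the complement case of the Dynkin
    argument subtracts from \<open>I k (space M)\<close>, whose convergence must be known.\<close>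
  define F where "F n = (case n of 0 \<Rightarrow> space M | Suc i \<Rightarrow> E i)" for n
  have sF: "F i \<in> sets M" for i unfolding F_def using sE by (auto split: nat.split)
  obtain r :: "nat \<Rightarrow> nat" where r: "strict_mono r"
      "\<And>i. convergent (\<lambda>k. \<integral>x. f (r k) x * indicator (F i) x \<partial>M)"
  proof (rule diagonal_convergent_subsequence[of "\<lambda>i k. \<integral>x. f k x * indicator (F i) x \<partial>M"])
    fix i show "bounded (range (\<lambda>k. \<integral>x. f k x * indicator (F i) x \<partial>M))"
      unfolding bounded_iff using bound[OF sF[of i]] by (intro exI[of _ "C * measure M (F i)"]) auto
  qed blast
  define I where "I k A = (\<integral>x. f (r k) x * indicator A x \<partial>M)" for k A
  have I_bound: "0 \<le> I k A" "I k A \<le> C * measure M A" if "A \<in> sets M" for k A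
    using bound[OF that, of "r k"] by (auto simp: I_def)
  have I_union: "I k (\<Union>i. A i) = (\<Sum>i. I k (A i))" "summable (\<lambda>i. I k (A i))"
    if A: "range A \<subseteq> sets M" "disjoint_family A" for k and A :: "nat \<Rightarrow> 'a set"
  proof -
    have [measurable]: "A i \<in> sets M" for i using A by auto
    have "summable (\<lambda>i. C * measure M (A i))"
      using finite_measure_UNION[OF A] by (auto intro!: summable_mult simp: sums_iff)
    then show "summable (\<lambda>i. I k (A i))"
      by (rule summable_comparison_test[rotated]) (use I_bound in auto)
    have "set_lebesgue_integral M (\<Union>i. A i) (f (r k)) = (\<Sum>i. set_lebesgue_integral M (A i) (f (r k)))"
    proof (rule lebesgue_integral_countable_add)
      have "(\<Union>i. A i) \<in> sets M" by measurable
      from int[OF this, of "r k"] show "set_integrable M (\<Union> (range A)) (f (r k))"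
        unfolding set_integrable_def by (simp only: real_scaleR_def mult.commute)
      show "A i \<inter> A j = {}" if "i \<noteq> j" for i j
        using A(2) that by (auto simp: disjoint_family_on_def)
    qed measurable
    then show "I k (\<Union>i. A i) = (\<Sum>i. I k (A i))"
      by (simp add: I_def set_lebesgue_integral_def mult.commute)
  qed
  \<comment> \<open>The majorant \<open>C * measure M (A i)\<close> does not depend on
    \<open>k\<close> and is summable because the measure is finite, so limit and countable sum can
    be exchanged. This serves twice: for disjoint unions in the Dynkin argument and for the
    countable additivity of \<open>\<nu>\<close>.\<close>
  have tannery: "(\<lambda>k. I k (\<Union>i. A i)) \<longlonglongrightarrow> (\<Sum>i. l i)"  "summable l"
    if A: "range A \<subseteq> sets M" "disjoint_family A" and l: "\<And>i. (\<lambda>k. I k (A i)) \<longlonglongrightarrow> l i"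
    for A :: "nat \<Rightarrow> 'a set" and l
  proof -
    have s: "summable (\<lambda>i. C * measure M (A i))"
      using finite_measure_UNION[OF A] by (auto intro!: summable_mult simp: sums_iff)
    have ev: "eventually (\<lambda>(i,k). norm (I k (A i)) \<le> C * measure M (A i)) (at_top \<times>\<^sub>F at_top)"
      using I_bound A by (intro always_eventually) auto
    have *: "summable (\<lambda>i. norm (l i)) \<and>
       (\<lambda>k. \<Sum>i. I k (A i)) \<longlonglongrightarrow> (\<Sum>i. l i)"
      using tannerys_theorem[OF l ev s] by auto
    then show "(\<lambda>k. I k (\<Union>i. A i)) \<longlonglongrightarrow> (\<Sum>i. l i)" using I_union(1)[OF A] by simp
    show "summable l" using * summable_norm_cancel by blast
  qed
  have conv: "convergent (\<lambda>k. I k A)" if "A \<in> sets M" for A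
  proof -
    have *: "A \<in> sigma_sets (space M) (range E)" using that gen(2) by simp
    have "range E \<subseteq> Pow (space M)" using sE sets.sets_into_space by blast
    from gen(1) this * show ?thesis
    proof (induction rule: sigma_sets_induct_disjoint)
      case (basic A)
      then obtain i where "A = E i" by auto
      then show ?case using r(2)[of "Suc i"] by (simp add: F_def I_def)
    next
      case empty
      then show ?case by (simp add: I_def convergent_const)
    next
      case (compl A)
      then have A: "A \<in> sets M" using gen(2) by simp
      have "I k (space M - A) = I k (space M) - I k A" for k
      proof -
        have "I k (space M) - I k A = (\<integral>x. f (r k) x * indicator (space M) x - f (r k) x * indicator A x \<partial>M)"
          unfolding I_def using int A by (subst Bochner_Integration.integral_diff) auto
        also have "\<dots> = I k (space M - A)"
          unfolding I_def by (intro Bochner_Integration.integral_cong) (auto simp: indicator_def)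
        finally show ?thesis ..
      qed
      moreover have "convergent (\<lambda>k. I k (space M))" using r(2)[of 0] by (simp add: F_def I_def)
      ultimately show ?case using compl by (simp add: convergent_diff)
    next
      case (union A)
      then have "range A \<subseteq> sets M" using gen(2) by auto
      moreover have "\<And>i. (\<lambda>k. I k (A i)) \<longlonglongrightarrow> lim (\<lambda>k. I k (A i))"
        using union(3) unfolding convergent_LIMSEQ_iff .
      ultimately have "(\<lambda>k. I k (\<Union>i. A i)) \<longlonglongrightarrow> (\<Sum>i. lim (\<lambda>k. I k (A i)))"
        using tannery(1)[of A "\<lambda>i. lim (\<lambda>k. I k (A i))"] union(1) by blast
      then show ?case unfolding convergent_def by (rule exI)
    qed
  qed
  define \<nu> where "\<nu> A = lim (\<lambda>k. I k A)" for A
  have lim: "(\<lambda>k. I k A) \<longlonglongrightarrow> \<nu> A" if "A \<in> sets M" for A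
    using conv[OF that] by (simp add: \<nu>_def convergent_LIMSEQ_iff)
  have \<nu>_bound: "0 \<le> \<nu> A" "\<nu> A \<le> C * measure M A" if "A \<in> sets M" for A
    using LIMSEQ_le_const[OF lim[OF that]] LIMSEQ_le_const2[OF lim[OF that]] I_bound[OF that] by blast+
  define N where "N = measure_of (space M) (sets M) (\<lambda>A. ennreal (\<nu> A))"
  have sN[simp]: "sets N = sets M" "space N = space M"
    by (auto simp: N_def)
  have eN: "emeasure N A = ennreal (\<nu> A)" if "A \<in> sets M" for A
    unfolding N_def
  proof (rule emeasure_measure_of_sigma)
    show "sigma_algebra (space M) (sets M)" by (rule sets.sigma_algebra_axioms)
    show "positive (sets M) (\<lambda>A. ennreal (\<nu> A))"
      using \<nu>_bound[of "{}"] by (auto simp: positive_def)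
    show "countably_additive (sets M) (\<lambda>A. ennreal (\<nu> A))"
    proof (rule countably_additiveI)
      fix A :: "nat \<Rightarrow> 'a set" assume A: "range A \<subseteq> sets M" "disjoint_family A" "(\<Union>i. A i) \<in> sets M"
      have *: "(\<lambda>k. I k (A i)) \<longlonglongrightarrow> \<nu> (A i)" for i using lim A by auto
      have "\<nu> (\<Union>i. A i) = (\<Sum>i. \<nu> (A i))"
        using LIMSEQ_unique[OF tannery(1)[OF A(1,2) *] lim[OF A(3)]] by simp
      moreover have "summable (\<lambda>i. \<nu> (A i))" using tannery(2)[OF A(1,2) *] .
      ultimately show "(\<Sum>i. ennreal (\<nu> (A i))) = ennreal (\<nu> (\<Union>i. A i))"
        using \<nu>_bound A by (subst suminf_ennreal2) auto
    qed
  qed (use that in auto)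
  have "absolutely_continuous M N"
    unfolding absolutely_continuous_def
  proof
    fix A assume "A \<in> null_sets M"
    then have A: "A \<in> sets M" "measure M A = 0" by (auto simp: null_setsD2 measure_def)
    then show "A \<in> null_sets N" using \<nu>_bound[OF A(1)] eN[OF A(1)] by (intro null_setsI) auto
  qed
  then obtain W where W[measurable]: "W \<in> borel_measurable M" and dW: "density M W = N"
    using Radon_Nikodym[of N] by auto
  have nnW: "(\<integral>\<^sup>+x. W x * indicator A x \<partial>M) = ennreal (\<nu> A)" if "A \<in> sets M" for A
    using eN[OF that] that emeasure_density[OF W that] by (simp add: dW)
  have "AE x in M. W x < \<infinity>"
  proof -
    have "(\<integral>\<^sup>+x. W x \<partial>M) = (\<integral>\<^sup>+x. W x * indicator (space M) x \<partial>M)"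
      by (intro nn_integral_cong) auto
    then have "(\<integral>\<^sup>+x. W x \<partial>M) \<noteq> \<infinity>" using nnW[of "space M"] by simp
    then show ?thesis using nn_integral_noteq_infinite[OF W] by (simp add: less_top)
  qed
  define V where "V x = enn2real (W x)" for x
  have V[measurable]: "V \<in> borel_measurable M" unfolding V_def by measurable
  have nnV: "(\<integral>\<^sup>+x. ennreal (V x * indicator A x) \<partial>M) = ennreal (\<nu> A)" if "A \<in> sets M" for A
    unfolding nnW[OF that, symmetric] V_def
    by (rule nn_integral_cong_AE, use \<open>AE x in M. W x < \<infinity>\<close> in eventually_elim) (auto simp: indicator_def)
  have iV: "integrable M (\<lambda>x. V x * indicator A x)" if "A \<in> sets M" for A
    by (rule integrableI_bounded)
       (use nnV[OF that] that in \<open>auto simp: V_def abs_mult\<close>)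
  have lV: "(\<integral>x. V x * indicator A x \<partial>M) = \<nu> A" if "A \<in> sets M" for A
    using nnV[OF that] iV[OF that] \<nu>_bound[OF that]
    by (subst integral_eq_nn_integral) (auto simp: V_def)
  \<comment> \<open>Every average of \<open>V\<close> over a set of positive measure lies in
    \<open>{0..C}\<close>, hence so does \<open>V\<close> almost everywhere. Clipping
    \<open>V\<close> to \<open>U\<close> then makes the bounds hold at every point without changing
    any integral.\<close>
  have AEV: "AE x in M. V x \<in> {0..C}"
  proof (rule averaging_theorem)
    have "integrable M (\<lambda>x. V x * indicator (space M) x)" by (rule iV) auto
    also have "?this \<longleftrightarrow> integrable M V"
      by (rule Bochner_Integration.integrable_cong) auto
    finally show "integrable M V" .
    fix A assume A: "A \<in> sets M" "0 < measure M A"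
    have "set_lebesgue_integral M A V = \<nu> A"
      using lV[OF A(1)] by (simp add: set_lebesgue_integral_def mult.commute)
    then show "(1 / measure M A) *\<^sub>R set_lebesgue_integral M A V \<in> {0..C}"
      using \<nu>_bound[OF A(1)] A(2) by (auto simp: field_simps)
  qed auto
  define U where "U x = max 0 (min C (V x))" for x
  have U[measurable]: "U \<in> borel_measurable M" unfolding U_def by measurable
  show thesis
  proof (rule that[of r U])
    show "0 \<le> U x \<and> U x \<le> C" for x using C0 by (auto simp: U_def)
    fix A assume A: "A \<in> sets M"
    have "(\<integral>x. U x * indicator A x \<partial>M) = (\<integral>x. V x * indicator A x \<partial>M)"
    proof (rule integral_cong_AE)
      from AEV show "AE x in M. U x * indicator A x = V x * indicator A x"
        by eventually_elim (auto simp: U_def)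
    qed (use A in measurable)
    then show "(\<lambda>k. \<integral>x. f (r k) x * indicator A x \<partial>M) \<longlonglongrightarrow> (\<integral>x. U x * indicator A x \<partial>M)"
      using lim[OF A] lV[OF A] by (simp add: I_def)
  qed (use r in auto)
qed

text \<open>The common bound \<open>C\<close> makes the integrals Lipschitz in \<phi> for the L^1
  norm, uniformly in \<open>k\<close>. Simple functions are settled by linearity, and approximation
  by them costs a third of the error in each of three terms.\<close>

lemma tendsto_integral_mult_of_indicator:
  fixes f :: "nat \<Rightarrow> 'a \<Rightarrow> real" and U \<phi> :: "'a \<Rightarrow> real"
  assumes f[measurable]: "\<And>k. f k \<in> borel_measurable M" and U[measurable]: "U \<in> borel_measurable M"
    and f_bdd: "\<And>k x. \<bar>f k x\<bar> \<le> C" and U_bdd: "\<And>x. \<bar>U x\<bar> \<le> C"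
    and ind: "\<And>A. A \<in> sets M \<Longrightarrow> emeasure M A < \<infinity> \<Longrightarrow>
      (\<lambda>k. \<integral>x. f k x * indicator A x \<partial>M) \<longlonglongrightarrow> (\<integral>x. U x * indicator A x \<partial>M)"
    and \<phi>: "integrable M \<phi>"
  shows "(\<lambda>k. \<integral>x. f k x * \<phi> x \<partial>M) \<longlonglongrightarrow> (\<integral>x. U x * \<phi> x \<partial>M)"
proof -
  have int: "integrable M (\<lambda>x. g x * \<psi> x)"
    if \<psi>: "integrable M \<psi>" and g: "g \<in> borel_measurable M" "\<And>x. \<bar>g x\<bar> \<le> C" for g \<psi> :: "'a \<Rightarrow> real"
  proof (rule Bochner_Integration.integrable_bound[of _ "\<lambda>x. C * \<bar>\<psi> x\<bar>"])
    show "AE x in M. norm (g x * \<psi> x) \<le> norm (C * \<bar>\<psi> x\<bar>)"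
      using g(2) by (intro AE_I2) (auto simp: abs_mult intro!: mult_right_mono order_trans[OF g(2)])
  qed (use \<psi> g in auto)
  show ?thesis
    using \<phi>
  proof (induction rule: integrable_induct)
    case (base A c)
    have "(\<lambda>k. (\<integral>x. f k x * indicator A x \<partial>M) * c) \<longlonglongrightarrow> (\<integral>x. U x * indicator A x \<partial>M) * c"
      using base by (intro tendsto_intros ind) auto
    then show ?case by (simp flip: integral_mult_left_zero add: mult.assoc)
  next
    case (add \<psi>1 \<psi>2)
    then show ?case using int[OF add(1)] int[OF add(2)] f_bdd U_bdd
      by (auto simp: distrib_left intro!: tendsto_add)
  next
    case (lim \<psi> s)
    have C0: "0 \<le> C" using U_bdd[of undefined] by linarith
    have close: "\<bar>(\<integral>x. g x * \<psi> x \<partial>M) - (\<integral>x. g x * s i x \<partial>M)\<bar> \<le> C * (\<integral>x. \<bar>\<psi> x - s i x\<bar> \<partial>M)"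
      if g: "g \<in> borel_measurable M" "\<And>x. \<bar>g x\<bar> \<le> C" for g i
    proof -
      have "(\<integral>x. g x * \<psi> x \<partial>M) - (\<integral>x. g x * s i x \<partial>M) = (\<integral>x. g x * (\<psi> x - s i x) \<partial>M)"
        using int[OF lim(4) g] int[OF lim(1) g] by (simp add: right_diff_distrib)
      also have "\<bar>\<dots>\<bar> \<le> (\<integral>x. \<bar>g x * (\<psi> x - s i x)\<bar> \<partial>M)" by (rule integral_abs_bound)
      also have "\<dots> \<le> (\<integral>x. C * \<bar>\<psi> x - s i x\<bar> \<partial>M)"
      proof (rule integral_mono)
        show "integrable M (\<lambda>x. \<bar>g x * (\<psi> x - s i x)\<bar>)"
          using lim int[of "\<lambda>x. \<psi> x - s i x" g] g by (intro integrable_abs) auto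
      qed (use lim g in \<open>auto simp: abs_mult intro!: mult_right_mono\<close>)
      finally show ?thesis by simp
    qed
    have "(\<lambda>i. \<integral>x. \<bar>\<psi> x - s i x\<bar> \<partial>M) \<longlonglongrightarrow> (\<integral>x. 0 \<partial>M)"
    \<comment> \<open>The induction supplies approximants with |s i x| \<le> 2 |\<psi> x|, whence
      the factor 3 for the difference.\<close>
    proof (rule integral_dominated_convergence[where w="\<lambda>x. 3 * \<bar>\<psi> x\<bar>"])
      show "AE x in M. (\<lambda>i. \<bar>\<psi> x - s i x\<bar>) \<longlonglongrightarrow> 0"
      proof (rule AE_I2)
        fix x assume "x \<in> space M"
        then have "(\<lambda>i. s i x) \<longlonglongrightarrow> \<psi> x" using lim by auto
        then have "(\<lambda>i. \<bar>\<psi> x - s i x\<bar>) \<longlonglongrightarrow> \<bar>\<psi> x - \<psi> x\<bar>" by (intro tendsto_intros)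
        then show "(\<lambda>i. \<bar>\<psi> x - s i x\<bar>) \<longlonglongrightarrow> 0" by simp
      qed
      show "AE x in M. norm \<bar>\<psi> x - s i x\<bar> \<le> 3 * \<bar>\<psi> x\<bar>" for i
      proof (rule AE_I2)
        fix x assume "x \<in> space M"
        then show "norm \<bar>\<psi> x - s i x\<bar> \<le> 3 * \<bar>\<psi> x\<bar>" using lim(3)[of x i] by simp
      qed
    qed (use lim in auto)
    then have s0: "(\<lambda>i. \<integral>x. \<bar>\<psi> x - s i x\<bar> \<partial>M) \<longlonglongrightarrow> 0" by simp
    show ?case
    proof (rule LIMSEQ_I)
      fix e :: real assume "0 < e"
      then have "0 < e / (3 * (C + 1))" using C0 by simp
      from LIMSEQ_D[OF s0 this] obtain i where i: "\<bar>\<integral>x. \<bar>\<psi> x - s i x\<bar> \<partial>M\<bar> < e / (3 * (C + 1))"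
        by (auto simp: dest: spec)
      have "C * (\<integral>x. \<bar>\<psi> x - s i x\<bar> \<partial>M) \<le> (C + 1) * (\<integral>x. \<bar>\<psi> x - s i x\<bar> \<partial>M)"
        by (intro mult_right_mono) auto
      also have "\<dots> \<le> (C + 1) * (e / (3 * (C + 1)))"
        using i C0 by (intro mult_left_mono) auto
      also have "\<dots> = e / 3" using C0 by (simp add: field_simps)
      finally have small: "C * (\<integral>x. \<bar>\<psi> x - s i x\<bar> \<partial>M) \<le> e / 3" .
      have "0 < e / 3" using \<open>0 < e\<close> by simp
      from LIMSEQ_D[OF lim(5)[of i] this] obtain k0 where k0:
        "\<And>k. k0 \<le> k \<Longrightarrow> \<bar>(\<integral>x. f k x * s i x \<partial>M) - (\<integral>x. U x * s i x \<partial>M)\<bar> < e / 3" by auto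
      show "\<exists>k0. \<forall>k\<ge>k0. norm ((\<integral>x. f k x * \<psi> x \<partial>M) - (\<integral>x. U x * \<psi> x \<partial>M)) < e"
      proof (intro exI allI impI)
        fix k assume "k0 \<le> k"
        then show "norm ((\<integral>x. f k x * \<psi> x \<partial>M) - (\<integral>x. U x * \<psi> x \<partial>M)) < e"
          using k0[of k] close[OF f f_bdd, of k i] close[OF U U_bdd, of i] small
          unfolding real_norm_def by linarith
      qed
    qed
  qed
qed

text \<open>A change of weight reduces the \<sigma>-finite case to a finite measure: a strictly
  positive integrable \<open>h\<close> turns \<open>M\<close> into the finite measure
  \<open>P\<close> with density \<open>w\<close>, and testing with \<phi> against \<open>M\<close>
  is the same as testing with \<phi> / w against \<open>P\<close>. Since w > 0, every integrable
  \<phi> is reached.\<close>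

proposition weakstar_sequentially_compact:
  fixes f :: "nat \<Rightarrow> 'b::second_countable_topology \<Rightarrow> real"
  assumes "sigma_finite_measure M" and sM: "sets M = sets borel"
    and f[measurable]: "\<And>k. f k \<in> borel_measurable M"
    and bdd: "\<And>k x. 0 \<le> f k x \<and> f k x \<le> C"
  obtains r :: "nat \<Rightarrow> nat" and U
  where "strict_mono r" "U \<in> borel_measurable M" "\<And>x. 0 \<le> U x \<and> U x \<le> C"
    "\<And>\<phi>. integrable M \<phi> \<Longrightarrow> (\<lambda>k. \<integral>x. f (r k) x * \<phi> x \<partial>M) \<longlonglongrightarrow> (\<integral>x. U x * \<phi> x \<partial>M)"
proof -
  interpret sigma_finite_measure M by fact
  obtain h where h[measurable]: "h \<in> borel_measurable M" and hfin: "integral\<^sup>N M h \<noteq> \<infinity>"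
    and hpos: "\<And>x. x \<in> space M \<Longrightarrow> 0 < h x \<and> h x < \<infinity>"
    using Ex_finite_integrable_function by auto
  define w where "w x = enn2real (h x)" for x
  have w[measurable]: "w \<in> borel_measurable M" unfolding w_def by measurable
  have wpos: "0 < w x" if "x \<in> space M" for x
    using hpos[OF that] by (auto simp: w_def enn2real_positive_iff)
  have wh: "ennreal (w x) = h x" if "x \<in> space M" for x
    using hpos[OF that] by (auto simp: w_def)
  define P where "P = density M (\<lambda>x. ennreal (w x))"
  have sP: "sets P = sets M" "space P = space M" by (auto simp: P_def)
  interpret P: finite_measure P
  proof
    have "emeasure P (space P) = (\<integral>\<^sup>+x. h x * indicator (space M) x \<partial>M)"
      unfolding P_def by (simp add: emeasure_density wh cong: nn_integral_cong)
    also have "\<dots> = integral\<^sup>N M h" by (intro nn_integral_cong) auto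
    finally show "emeasure P (space P) \<noteq> \<infinity>" using hfin by simp
  qed
  have spM: "space M = UNIV" using sets_eq_imp_space_eq[OF sM] by simp
  obtain E :: "nat \<Rightarrow> 'b set" where E: "Int_stable (range E)" "sets borel = sigma_sets UNIV (range E)"
    by (rule borel_countable_Int_stable_generator)
  obtain r U where r: "strict_mono r" and U: "U \<in> borel_measurable P" "\<And>x. 0 \<le> U x \<and> U x \<le> C"
    and lim: "\<And>A. A \<in> sets P \<Longrightarrow>
      (\<lambda>k. \<integral>x. f (r k) x * indicator A x \<partial>P) \<longlonglongrightarrow> (\<integral>x. U x * indicator A x \<partial>P)"
  proof (rule P.setwise_limit[of f C E])
    show "f k \<in> borel_measurable P" for k using f sP measurable_cong_sets[OF sP(1) refl] by auto
    show "sets P = sigma_sets (space P) (range E)" using E sP sM spM by simp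
  qed (use bdd E in auto)
  have U'[measurable]: "U \<in> borel_measurable M" using U(1) measurable_cong_sets[OF sP(1) refl] by auto
  show thesis
  proof (rule that[OF r U' U(2)])
    fix \<phi> :: "'b \<Rightarrow> real" assume \<phi>: "integrable M \<phi>"
    then have [measurable]: "\<phi> \<in> borel_measurable M" by auto
    have cancel: "w x * (g * (\<phi> x / w x)) = g * \<phi> x" if "x \<in> space M" for g x
      using wpos[OF that] by simp
    have transf: "(\<integral>x. g x * (\<phi> x / w x) \<partial>P) = (\<integral>x. g x * \<phi> x \<partial>M)" if "g \<in> borel_measurable M" for g
    proof -
      have [measurable]: "g \<in> borel_measurable M" by fact
      have "(\<integral>x. g x * (\<phi> x / w x) \<partial>P) = (\<integral>x. w x *\<^sub>R (g x * (\<phi> x / w x)) \<partial>M)"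
        unfolding P_def by (rule integral_density) (auto intro!: AE_I2 less_imp_le wpos)
      also have "\<dots> = (\<integral>x. g x * \<phi> x \<partial>M)"
        using cancel by (intro Bochner_Integration.integral_cong) auto
      finally show ?thesis .
    qed
    have "integrable P (\<lambda>x. \<phi> x / w x) \<longleftrightarrow> integrable M (\<lambda>x. w x *\<^sub>R (\<phi> x / w x))"
      unfolding P_def by (rule integrable_density) (auto intro!: AE_I2 less_imp_le wpos)
    also have "\<dots> \<longleftrightarrow> integrable M \<phi>"
      using cancel[where g=1] by (intro Bochner_Integration.integrable_cong) auto
    finally have int: "integrable P (\<lambda>x. \<phi> x / w x)" using \<phi> by simp
    have "f k \<in> borel_measurable P" for k using f[of k] by (simp add: P_def)
    then have "(\<lambda>k. \<integral>x. f (r k) x * (\<phi> x / w x) \<partial>P) \<longlonglongrightarrow> (\<integral>x. U x * (\<phi> x / w x) \<partial>P)"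
    proof (intro tendsto_integral_mult_of_indicator[where C=C, OF _ U(1) _ _ lim int])
      show "\<bar>f (r k) x\<bar> \<le> C" for k x using bdd[where x=x and k="r k"] by simp
      show "\<bar>U x\<bar> \<le> C" for x using U(2)[of x] by simp
    qed auto
    then show "(\<lambda>k. \<integral>x. f (r k) x * \<phi> x \<partial>M) \<longlonglongrightarrow> (\<integral>x. U x * \<phi> x \<partial>M)"
      by (simp only: transf[OF f] transf[OF U'])
  qed
qed

subsection \<open>The Newtonian kernel in polar form\<close>

lemma nn_integral_lborel_scaleR:
  fixes g :: "'a::euclidean_space \<Rightarrow> ennreal"
  assumes [measurable]: "g \<in> borel_measurable borel" and s: "0 < s"
  shows "(\<integral>\<^sup>+x. g x \<partial>lborel) = ennreal (s ^ DIM('a)) * (\<integral>\<^sup>+x. g (s *\<^sub>R x) \<partial>lborel)"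
proof -
  have "(\<integral>\<^sup>+x. g x \<partial>lborel) =
    (\<integral>\<^sup>+x. g x \<partial>(density (distr lborel borel (\<lambda>x. 0 + s *\<^sub>R x)) (\<lambda>_. ennreal (\<bar>s\<bar> ^ DIM('a)))))"
    using lborel_affine[of s "0::'a"] s by simp
  also have "\<dots> = (\<integral>\<^sup>+x. ennreal (s ^ DIM('a)) * g (s *\<^sub>R x) \<partial>lborel)"
    using s by (subst nn_integral_density) (auto simp: nn_integral_distr)
  also have "\<dots> = ennreal (s ^ DIM('a)) * (\<integral>\<^sup>+x. g (s *\<^sub>R x) \<partial>lborel)"
    by (rule nn_integral_cmult) measurable
  finally show ?thesis .
qed

lemma nn_integral_inverse_power_tail:
  assumes "0 < a" "0 < n"
  shows "(\<integral>\<^sup>+s. ennreal (1 / s ^ Suc n) * indicator {a..} s \<partial>lborel) = ennreal (1 / (real n * a ^ n))"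
proof -
  have "(\<integral>\<^sup>+s. ennreal (1 / s ^ Suc n) * indicator {a..} s \<partial>lborel) = ennreal (0 - (- 1 / (real n * a ^ n)))"
  proof (rule nn_integral_FTC_atLeast)
    show "DERIV (\<lambda>s. - 1 / (real n * s ^ n)) s :> 1 / s ^ Suc n" if "a \<le> s" for s
    proof -
      have "0 < s" using that assms by simp
      then have "DERIV (\<lambda>s. - 1 / (real n * s ^ n)) s :> real n * (real n * s ^ (n - 1)) / ((real n * s ^ n) * (real n * s ^ n))"
        using assms by (auto intro!: derivative_eq_intros)
      also have "real n * (real n * s ^ (n - 1)) / ((real n * s ^ n) * (real n * s ^ n)) = 1 / s ^ Suc n"
        using assms \<open>0 < s\<close> by (subst (2 3) power_minus_mult[symmetric]) (auto simp: divide_simps power_eq_if[of s n])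
      finally show ?thesis .
    qed
    have "((\<lambda>s. - (1 / real n) * (1 / s) ^ n) \<longlongrightarrow> - (1 / real n) * 0 ^ n) at_top"
      by (intro tendsto_intros tendsto_divide_0[OF tendsto_const] filterlim_ident
            filterlim_at_top_imp_at_infinity)
    then show "((\<lambda>s. - 1 / (real n * s ^ n)) \<longlongrightarrow> 0) at_top"
      using assms by (simp add: power_one_over field_simps zero_power)
  qed (use assms in auto)
  then show ?thesis by simp
qed

text \<open>Integration in polar form without a surface measure: \<open>|x|\<^sup>-\<^sup>d\<close> is \<open>d\<close> times the integral of
  \<open>s\<^sup>-\<^sup>d\<^sup>-\<^sup>1\<close> over \<open>s \<ge> |x|\<close>, and then \<open>x = s y\<close> is substituted.\<close>

lemma nn_integral_radial:
  fixes f :: "'a::euclidean_space \<Rightarrow> ennreal"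
  assumes [measurable]: "f \<in> borel_measurable borel"
  shows "(\<integral>\<^sup>+x. f x * ennreal (1 / norm x ^ DIM('a)) \<partial>lborel) =
    of_nat DIM('a) * (\<integral>\<^sup>+(s, y). indicator {0<..} s * indicator (cball 0 1) y * ennreal (1 / s) * f (s *\<^sub>R y)
      \<partial>(lborel \<Otimes>\<^sub>M (lborel :: 'a measure)))"
proof -
  let ?d = "DIM('a)"
  have [measurable]: "cball (0::'a) 1 \<in> sets borel" by auto
  define G where "G s x = f x * (if 0 < s \<and> norm x \<le> s then ennreal (1 / s ^ Suc ?d) else 0)" for s :: real and x :: 'a
  have G[measurable]: "(\<lambda>(s, x). G s x) \<in> borel_measurable (lborel \<Otimes>\<^sub>M lborel)"
    unfolding G_def by measurable
  have "(\<integral>\<^sup>+x. f x * ennreal (1 / norm x ^ ?d) \<partial>lborel) = (\<integral>\<^sup>+x. of_nat ?d * (\<integral>\<^sup>+s. G s x \<partial>lborel) \<partial>lborel)"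
  proof (rule nn_integral_cong_AE)
    have "AE x in lborel. x \<noteq> (0::'a)" by (rule AE_lborel_singleton)
    then show "AE x in lborel. f x * ennreal (1 / norm x ^ ?d) = of_nat ?d * (\<integral>\<^sup>+s. G s x \<partial>lborel)"
    proof eventually_elim
      case (elim x)
      have "(\<integral>\<^sup>+s. G s x \<partial>lborel) = (\<integral>\<^sup>+s. f x * (ennreal (1 / s ^ Suc ?d) * indicator {norm x..} s) \<partial>lborel)"
        using elim by (intro nn_integral_cong) (auto simp: G_def indicator_def intro: less_le_trans[of 0 "norm x"])
      also have "\<dots> = f x * ennreal (1 / (real ?d * norm x ^ ?d))"
        using elim by (subst nn_integral_cmult) (auto simp: nn_integral_inverse_power_tail simp del: power_Suc)
      also have "of_nat ?d * \<dots> = f x * (ennreal (real ?d) * ennreal (1 / (real ?d * norm x ^ ?d)))"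
        by (simp add: ac_simps ennreal_of_nat_eq_real_of_nat)
      also have "ennreal (real ?d) * ennreal (1 / (real ?d * norm x ^ ?d)) = ennreal (1 / norm x ^ ?d)"
        by (subst ennreal_mult[symmetric]) auto
      finally show ?case by simp
    qed
  qed
  also have "\<dots> = of_nat ?d * (\<integral>\<^sup>+x. \<integral>\<^sup>+s. G s x \<partial>lborel \<partial>lborel)"
    by (rule nn_integral_cmult) measurable
  also have "(\<integral>\<^sup>+x. \<integral>\<^sup>+s. G s x \<partial>lborel \<partial>lborel) = (\<integral>\<^sup>+s. \<integral>\<^sup>+x. G s x \<partial>lborel \<partial>lborel)"
    by (rule lborel_pair.Fubini') measurable
  also have "\<dots> = (\<integral>\<^sup>+s. \<integral>\<^sup>+y. indicator {0<..} s * indicator (cball 0 1) y * ennreal (1 / s) * f (s *\<^sub>R y) \<partial>lborel \<partial>lborel)"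
  proof (rule nn_integral_cong)
    fix s :: real
    show "(\<integral>\<^sup>+x. G s x \<partial>lborel) = (\<integral>\<^sup>+y. indicator {0<..} s * indicator (cball 0 1) y * ennreal (1 / s) * f (s *\<^sub>R y) \<partial>lborel)"
    proof (cases "0 < s")
      case True
      have "(\<integral>\<^sup>+x. G s x \<partial>lborel) = (\<integral>\<^sup>+y. ennreal (s ^ ?d) * G s (s *\<^sub>R y) \<partial>lborel)"
        using nn_integral_lborel_scaleR[of "G s" s] True by (simp add: nn_integral_cmult)
      also have "\<dots> = (\<integral>\<^sup>+y. indicator {0<..} s * indicator (cball 0 1) y * ennreal (1 / s) * f (s *\<^sub>R y) \<partial>lborel)"
      proof (rule nn_integral_cong)
        fix y :: 'a
        have "ennreal (s ^ ?d) * ennreal (1 / s ^ Suc ?d) = ennreal (1 / s)"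
          using True by (subst ennreal_mult[symmetric]) (auto simp: field_simps)
        then show "ennreal (s ^ ?d) * G s (s *\<^sub>R y) = indicator {0<..} s * indicator (cball 0 1) y * ennreal (1 / s) * f (s *\<^sub>R y)"
          using True by (auto simp: G_def indicator_def ac_simps simp del: power_Suc)
      qed
      finally show ?thesis .
    qed (simp add: G_def)
  qed
  also have "\<dots> = (\<integral>\<^sup>+(s, y). indicator {0<..} s * indicator (cball 0 1) y * ennreal (1 / s) * f (s *\<^sub>R y)
      \<partial>(lborel \<Otimes>\<^sub>M lborel))"
    by (subst lborel.nn_integral_fst[symmetric]) auto
  finally show ?thesis .
qed

text \<open>The nonnegative polar formula is applied to the positive and the negative part;
  finiteness of both carries integrability over to \<open>H\<close>. The factor 1/s is kept next to
  g (s y), because for g x = x . grad \<phi>(x) it cancels the factor s and leaves the derivative of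
  \<phi> along the ray.\<close>

lemma integral_radial:
  fixes g :: "'a::euclidean_space \<Rightarrow> real"
  assumes [measurable]: "g \<in> borel_measurable borel"
    and int: "integrable lborel (\<lambda>x. g x / norm x ^ DIM('a))"
  defines "H \<equiv> \<lambda>(s, y::'a). indicator {0<..} s * indicator (cball 0 1) y * (g (s *\<^sub>R y) / s)"
  shows "integrable (lborel \<Otimes>\<^sub>M lborel) H"
    and "(\<integral>x. g x / norm x ^ DIM('a) \<partial>lborel) = real DIM('a) * integral\<^sup>L (lborel \<Otimes>\<^sub>M lborel) H"
proof -
  have [measurable]: "cball (0::'a) 1 \<in> sets borel" by auto
  have H[measurable]: "H \<in> borel_measurable (lborel \<Otimes>\<^sub>M lborel)" unfolding H_def by measurable
  \<comment> \<open>\<open>k\<close> stands for the identity and for the negation, which produce the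
    two parts; all that matters is that both fix 0 and commute with division by a positive
    number.\<close>
  have rad: "(\<integral>\<^sup>+x. ennreal (k (g x) / norm x ^ DIM('a)) \<partial>lborel) =
      of_nat DIM('a) * (\<integral>\<^sup>+p. ennreal (k (H p)) \<partial>(lborel \<Otimes>\<^sub>M lborel))"
    if [measurable]: "k \<in> borel_measurable borel" and k0: "k 0 = 0" and k: "\<And>a b. 0 < a \<Longrightarrow> k (b / a) = k b / a"
    for k :: "real \<Rightarrow> real"
  proof -
    have "(\<integral>\<^sup>+x. ennreal (k (g x) / norm x ^ DIM('a)) \<partial>lborel) =
      (\<integral>\<^sup>+x. ennreal (k (g x)) * ennreal (1 / norm x ^ DIM('a)) \<partial>lborel)"
      by (intro nn_integral_cong) (simp add: ennreal_mult'' [symmetric])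
    also have "\<dots> = of_nat DIM('a) * (\<integral>\<^sup>+(s, y). indicator {0<..} s * indicator (cball 0 1) y * ennreal (1 / s) * ennreal (k (g (s *\<^sub>R y)))
      \<partial>(lborel \<Otimes>\<^sub>M (lborel :: 'a measure)))"
      by (rule nn_integral_radial) measurable
    also have "(\<integral>\<^sup>+(s, y). indicator {0<..} s * indicator (cball 0 1) y * ennreal (1 / s) * ennreal (k (g (s *\<^sub>R y)))
      \<partial>(lborel \<Otimes>\<^sub>M (lborel :: 'a measure))) = (\<integral>\<^sup>+p. ennreal (k (H p)) \<partial>(lborel \<Otimes>\<^sub>M lborel))"
      by (intro nn_integral_cong)
         (auto simp: H_def indicator_def k0 k ennreal_mult'[symmetric] ac_simps split: prod.split)
    finally show ?thesis .
  qed
  have r1: "(\<integral>\<^sup>+x. ennreal (g x / norm x ^ DIM('a)) \<partial>lborel) = of_nat DIM('a) * (\<integral>\<^sup>+p. ennreal (H p) \<partial>(lborel \<Otimes>\<^sub>M lborel))"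
    using rad[of "\<lambda>x. x"] by simp
  have r2: "(\<integral>\<^sup>+x. ennreal (- (g x / norm x ^ DIM('a))) \<partial>lborel) = of_nat DIM('a) * (\<integral>\<^sup>+p. ennreal (- H p) \<partial>(lborel \<Otimes>\<^sub>M lborel))"
    using rad[of "\<lambda>x. - x"] by simp
  have i: "(\<integral>\<^sup>+x. ennreal (g x / norm x ^ DIM('a)) \<partial>lborel) \<noteq> \<infinity>"
      "(\<integral>\<^sup>+x. ennreal (- (g x / norm x ^ DIM('a))) \<partial>lborel) \<noteq> \<infinity>"
    using int unfolding real_integrable_def by auto
  have H1: "(\<integral>\<^sup>+p. ennreal (H p) \<partial>(lborel \<Otimes>\<^sub>M lborel)) \<noteq> \<infinity>"
    "(\<integral>\<^sup>+p. ennreal (- H p) \<partial>(lborel \<Otimes>\<^sub>M lborel)) \<noteq> \<infinity>"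
    using i unfolding r1 r2 by (auto simp: ennreal_mult_eq_top_iff)
  then show "integrable (lborel \<Otimes>\<^sub>M lborel) H" by (auto simp: real_integrable_def)
  then show "(\<integral>x. g x / norm x ^ DIM('a) \<partial>lborel) = real DIM('a) * integral\<^sup>L (lborel \<Otimes>\<^sub>M lborel) H"
    unfolding real_lebesgue_integral_def[OF int] r1 r2
    by (subst real_lebesgue_integral_def) (auto simp: enn2real_mult right_diff_distrib)
qed

text \<open>The norm |x|^(1-d) of the field x / |x|^d. Kept as a quotient, it agrees with that norm
  at x = 0 as well, where both are 0, with no case distinction on d.\<close>

definition newton_kernel :: "'a::euclidean_space \<Rightarrow> real" where
  "newton_kernel x = norm x / norm x ^ DIM('a)"

lemma newton_kernel_nonneg: "0 \<le> newton_kernel x"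
  by (simp add: newton_kernel_def)

lemma measurable_newton_kernel[measurable]: "newton_kernel \<in> borel_measurable borel"
  unfolding newton_kernel_def by measurable

lemma newton_kernel_le_1: "1 \<le> norm x \<Longrightarrow> newton_kernel (x :: 'a::euclidean_space) \<le> 1"
  using self_le_power[of "norm x" "DIM('a)"] by (simp add: newton_kernel_def divide_le_eq)

text \<open>In polar form the integrand along the ray through \<open>y\<close> is the constant |y|
  on 0 < s < R / |y|, so every ray contributes R. Integrating over the unit ball of \<open>y\<close>
  gives its volume times R, and the polar formula adds the factor d.\<close>

lemma nn_integral_newton_kernel_ball:
  assumes "0 \<le> R"
  shows "(\<integral>\<^sup>+x. indicator (ball 0 R) x * ennreal (newton_kernel (x :: 'a::euclidean_space)) \<partial>lborel)
    \<le> ennreal (real DIM('a) * measure lborel (ball (0::'a) 1) * R)"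
proof -
  have [measurable]: "cball (0::'a) 1 \<in> sets borel" "ball (0::'a) R \<in> sets borel" by auto
  have m: "emeasure lborel (cball (0::'a) 1) = ennreal (measure lborel (ball (0::'a) 1))"
    by (simp add: emeasure_cball content_ball)
  have "(\<integral>\<^sup>+x. indicator (ball 0 R) x * ennreal (newton_kernel (x :: 'a)) \<partial>lborel) =
    (\<integral>\<^sup>+x. (indicator (ball (0::'a) R) x * ennreal (norm x)) * ennreal (1 / norm x ^ DIM('a)) \<partial>lborel)"
    by (intro nn_integral_cong) (auto simp: newton_kernel_def ennreal_mult[symmetric] mult.assoc)
  also have "\<dots> = of_nat DIM('a) * (\<integral>\<^sup>+(s, y). indicator {0<..} s * indicator (cball 0 1) y * ennreal (1 / s) *
      (indicator (ball 0 R) (s *\<^sub>R y) * ennreal (norm (s *\<^sub>R y)))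
      \<partial>(lborel \<Otimes>\<^sub>M (lborel :: 'a measure)))"
    by (rule nn_integral_radial) measurable
  also have "(\<integral>\<^sup>+(s, y). indicator {0<..} s * indicator (cball 0 1) y * ennreal (1 / s) *
      (indicator (ball 0 R) (s *\<^sub>R y) * ennreal (norm (s *\<^sub>R y)))
      \<partial>(lborel \<Otimes>\<^sub>M (lborel :: 'a measure))) =
     (\<integral>\<^sup>+y. \<integral>\<^sup>+s. indicator {0<..} s * indicator (cball (0::'a) 1) y * ennreal (1 / s) *
      (indicator (ball 0 R) (s *\<^sub>R y) * ennreal (norm (s *\<^sub>R y))) \<partial>lborel \<partial>lborel)"
    by (subst lborel_pair.nn_integral_snd[symmetric]) (auto simp: split_beta')
  also have "\<dots> \<le> (\<integral>\<^sup>+y. ennreal R * indicator (cball (0::'a) 1) y \<partial>lborel)"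
  proof (rule nn_integral_mono_AE)
    have "AE y in lborel. y \<noteq> (0::'a)" by (rule AE_lborel_singleton)
    then show "AE y in lborel. (\<integral>\<^sup>+s. indicator {0<..} s * indicator (cball 0 1) y * ennreal (1 / s) *
      (indicator (ball 0 R) (s *\<^sub>R y) * ennreal (norm (s *\<^sub>R y))) \<partial>lborel) \<le> ennreal R * indicator (cball (0::'a) 1) y"
    proof eventually_elim
      case (elim y)
      have "(\<integral>\<^sup>+s. indicator {0<..} s * indicator (cball 0 1) y * ennreal (1 / s) *
      (indicator (ball 0 R) (s *\<^sub>R y) * ennreal (norm (s *\<^sub>R y))) \<partial>lborel) \<le>
        (\<integral>\<^sup>+s. (indicator (cball 0 1) y * ennreal (norm y)) * indicator {0..R / norm y} s \<partial>lborel)"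
      proof (rule nn_integral_mono)
        fix s :: real
        show "indicator {0<..} s * indicator (cball 0 1) y * ennreal (1 / s) *
      (indicator (ball 0 R) (s *\<^sub>R y) * ennreal (norm (s *\<^sub>R y))) \<le> (indicator (cball 0 1) y * ennreal (norm y)) * indicator {0..R / norm y} s"
          using elim by (auto simp: indicator_def ennreal_mult[symmetric] field_simps)
      qed
      also have "\<dots> = indicator (cball 0 1) y * (ennreal (norm y) * ennreal (R / norm y))"
        using assms by (subst nn_integral_cmult) (auto simp: mult.assoc)
      also have "\<dots> = ennreal R * indicator (cball 0 1) y"
        using elim assms by (subst ennreal_mult[symmetric]) (auto simp: mult.commute)
      finally show ?case .
    qed
  qed
  also have "\<dots> = ennreal R * ennreal (measure lborel (ball (0::'a) 1))"
    by (subst nn_integral_cmult_indicator) (auto simp: m)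
  finally have "(\<integral>\<^sup>+x. indicator (ball 0 R) x * ennreal (newton_kernel (x :: 'a)) \<partial>lborel)
     \<le> of_nat DIM('a) * (ennreal R * ennreal (measure lborel (ball (0::'a) 1)))"
    by (meson mult_left_mono order_trans zero_le)
  also have "\<dots> = ennreal (real DIM('a) * measure lborel (ball (0::'a) 1) * R)"
    using assms by (simp add: ennreal_of_nat_eq_real_of_nat ennreal_mult[symmetric] ac_simps)
  finally show ?thesis .
qed

subsection \<open>Functions with continuous partial derivatives\<close>

text \<open>The value of the total function \<open>partial\<close> says nothing about existence.
  This relation records both, and opens the calculus of \<open>has_real_derivative\<close> along a
  coordinate line.\<close>

definition has_partial :: "'a \<Rightarrow> ('a::euclidean_space \<Rightarrow> real) \<Rightarrow> 'a \<Rightarrow> real \<Rightarrow> bool" where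
  "has_partial i f x D \<longleftrightarrow> ((\<lambda>s. f (x + s *\<^sub>R i)) has_real_derivative D) (at 0)"

lemma has_partial_iff: "has_partial i f x D \<longleftrightarrow> partial_exists i f x \<and> partial i f x = D"
  unfolding has_partial_def partial_exists_def partial_def
  using DERIV_imp_deriv DERIV_deriv_iff_field_differentiable field_differentiable_def by blast

lemma has_partial_line:
  assumes "has_partial i f (x + s *\<^sub>R i) D"
  shows "((\<lambda>s. f (x + s *\<^sub>R i)) has_real_derivative D) (at s)"
proof -
  have "((\<lambda>r. f (x + (r + s) *\<^sub>R i)) has_real_derivative D) (at 0)"
    using assms by (simp add: has_partial_def scaleR_add_left add_ac)
  then show ?thesis
    using DERIV_shift[of "\<lambda>s. f (x + s *\<^sub>R i)" D 0 s] by simp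
qed

lemma has_partial_mult:
  "has_partial i f x D \<Longrightarrow> has_partial i g x E \<Longrightarrow> has_partial i (\<lambda>y. f y * g y) x (D * g x + f x * E)"
  unfolding has_partial_def by (auto intro!: derivative_eq_intros)

lemma has_partial_diff:
  "has_partial i f x D \<Longrightarrow> has_partial i g x E \<Longrightarrow> has_partial i (\<lambda>y. f y - g y) x (D - E)"
  unfolding has_partial_def by (rule DERIV_diff)

lemma has_partial_chain:
  "has_partial i f x D \<Longrightarrow> (g has_real_derivative E) (at (f x)) \<Longrightarrow> has_partial i (\<lambda>y. g (f y)) x (E * D)"
  unfolding has_partial_def using DERIV_chain2[of g E "\<lambda>s. f (x + s *\<^sub>R i)" 0 D UNIV] by simp

lemma has_partial_translate: "has_partial i (\<lambda>y. f (y + z)) x D \<longleftrightarrow> has_partial i f (x + z) D"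
  unfolding has_partial_def by (simp add: add_ac)

text \<open>The increment is split into d coordinate moves, each treated by the mean value theorem;
  continuity of the partials keeps the intermediate slopes close to those at \<open>x\<close>. Full
  differentiability is needed later for the chain rule along rays.\<close>

lemma has_derivative_of_continuous_partials:
  fixes f :: "'a::euclidean_space \<Rightarrow> real"
  assumes part: "\<And>i x. i \<in> Basis \<Longrightarrow> has_partial i f x (D i x)"
    and cont: "\<And>i. i \<in> Basis \<Longrightarrow> continuous_on UNIV (D i)"
  shows "(f has_derivative (\<lambda>h. \<Sum>i\<in>Basis. (h \<bullet> i) * D i x)) (at x)"
  unfolding has_derivative_at_alt
proof (intro conjI allI impI)
  show "bounded_linear (\<lambda>h. \<Sum>i\<in>Basis. (h \<bullet> i) * D i x)"
    by (intro bounded_linear_sum bounded_linear_mult_const bounded_linear_inner_left)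
  fix e :: real assume "0 < e"
  \<comment> \<open>Each of the d coordinate moves may spend the error e' |h|, which adds up to e
    |h|.\<close>
  define e' where "e' = e / real DIM('a)"
  have e': "0 < e'" using \<open>0 < e\<close> by (simp add: e'_def)
  have "continuous_on UNIV (\<lambda>y. \<Sum>i\<in>Basis. \<bar>D i y - D i x\<bar>)"
    by (intro continuous_intros cont)
  then have "isCont (\<lambda>y. \<Sum>i\<in>Basis. \<bar>D i y - D i x\<bar>) x" by (simp add: continuous_on_eq_continuous_at)
  then obtain \<delta> where \<delta>: "0 < \<delta>"
    and "\<And>y. dist y x < \<delta> \<Longrightarrow> dist (\<Sum>i\<in>Basis. \<bar>D i y - D i x\<bar>) (\<Sum>i\<in>Basis. \<bar>D i x - D i x\<bar>) < e'"
    using e' unfolding continuous_at_eps_delta by blast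
  then have sum_small: "(\<Sum>i\<in>Basis. \<bar>D i y - D i x\<bar>) < e'" if "dist y x < \<delta>" for y
    using that by force
  have small: "\<bar>D i y - D i x\<bar> < e'" if "dist y x < \<delta>" "i \<in> Basis" for i y
    using member_le_sum[of i Basis "\<lambda>i. \<bar>D i y - D i x\<bar>"] sum_small[OF that(1)] that(2) by auto
  show "\<exists>d>0. \<forall>y. norm (y - x) < d \<longrightarrow>
    norm (f y - f x - (\<Sum>i\<in>Basis. ((y - x) \<bullet> i) * D i x)) \<le> e * norm (y - x)"
  proof (intro exI conjI allI impI)
    fix y assume y: "norm (y - x) < \<delta>"
    define h where "h = y - x"
    \<comment> \<open>\<open>B\<close> is the set of coordinates already moved;
      \<open>B = Basis\<close> is the claim.\<close>
    have "\<bar>f (x + (\<Sum>i\<in>B. (h \<bullet> i) *\<^sub>R i)) - f x - (\<Sum>i\<in>B. (h \<bullet> i) * D i x)\<bar> \<le> real (card B) * (e' * norm h)"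
      if "B \<subseteq> Basis" for B
      using finite_subset[OF that finite_Basis] that
    proof (induction B rule: finite_induct)
      case (insert j B)
      define p where "p = x + (\<Sum>i\<in>B. (h \<bullet> i) *\<^sub>R i)"
      have j: "j \<in> Basis" "j \<notin> B" "B \<subseteq> Basis" using insert by auto
      have "\<exists>s>0. s < 1 \<and> f (p + (1 * (h \<bullet> j)) *\<^sub>R j) - f (p + (0 * (h \<bullet> j)) *\<^sub>R j)
          = (1 - 0) * ((h \<bullet> j) * D j (p + (s * (h \<bullet> j)) *\<^sub>R j))"
      proof (rule MVT2)
        fix s :: real
        show "((\<lambda>s. f (p + (s * (h \<bullet> j)) *\<^sub>R j)) has_real_derivative (h \<bullet> j) * D j (p + (s * (h \<bullet> j)) *\<^sub>R j)) (at s)"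
        proof -
          have lin: "((\<lambda>s. s * (h \<bullet> j)) has_real_derivative (h \<bullet> j)) (at s)"
            by (auto intro!: derivative_eq_intros)
          show ?thesis
            using DERIV_chain2[OF has_partial_line[OF part[OF j(1)]] lin, where x1=p]
            by (simp add: mult.commute)
        qed
      qed simp
      then obtain s where s: "0 < s" "s < 1"
        and mvt: "f (p + (h \<bullet> j) *\<^sub>R j) - f p = (h \<bullet> j) * D j (p + (s * (h \<bullet> j)) *\<^sub>R j)"
        by auto
      \<comment> \<open>Relative to \<open>x\<close>, each coordinate of the intermediate point is
        all, a fraction or nothing of the corresponding component of \<open>h\<close>, so the point
        is no farther from \<open>x\<close> than \<open>y\<close> is.\<close>
      have "norm ((p - x) + (s * (h \<bullet> j)) *\<^sub>R j) \<le> norm h"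
      proof (rule norm_le_componentwise)
        fix b :: 'a assume b: "b \<in> Basis"
        have "((p - x) + (s * (h \<bullet> j)) *\<^sub>R j) \<bullet> b = (\<Sum>i\<in>B. if i = b then h \<bullet> b else 0) + (if b = j then s * (h \<bullet> j) else 0)"
          using b j by (auto simp: p_def inner_add_left inner_sum_left inner_Basis intro!: sum.cong)
        also have "\<dots> = (if b \<in> B then h \<bullet> b else if b = j then s * (h \<bullet> b) else 0)"
          using insert(1) j by (auto simp: sum.delta')
        finally have eq: "((p - x) + (s * (h \<bullet> j)) *\<^sub>R j) \<bullet> b = (if b \<in> B then h \<bullet> b else if b = j then s * (h \<bullet> b) else 0)" .
        show "\<bar>((p - x) + (s * (h \<bullet> j)) *\<^sub>R j) \<bullet> b\<bar> \<le> \<bar>h \<bullet> b\<bar>"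
          unfolding eq using s by (auto simp: abs_mult intro: mult_left_le_one_le)
      qed
      then have "dist (p + (s * (h \<bullet> j)) *\<^sub>R j) x < \<delta>"
        using y by (simp add: h_def dist_norm algebra_simps)
      from small[OF this j(1)] have "\<bar>h \<bullet> j\<bar> * \<bar>D j (p + (s * (h \<bullet> j)) *\<^sub>R j) - D j x\<bar> \<le> norm h * e'"
        using Basis_le_norm[OF j(1)] by (intro mult_mono) auto
      then have *: "\<bar>f (p + (h \<bullet> j) *\<^sub>R j) - f p - (h \<bullet> j) * D j x\<bar> \<le> norm h * e'"
        unfolding mvt by (simp add: abs_mult right_diff_distrib[symmetric])
      have **: "\<bar>f p - f x - (\<Sum>i\<in>B. (h \<bullet> i) * D i x)\<bar> \<le> real (card B) * (e' * norm h)"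
        using insert by (simp add: p_def)
      have eq: "x + (\<Sum>i\<in>insert j B. (h \<bullet> i) *\<^sub>R i) = p + (h \<bullet> j) *\<^sub>R j"
        using insert by (simp add: p_def)
      have "\<bar>f (p + (h \<bullet> j) *\<^sub>R j) - f x - ((h \<bullet> j) * D j x + (\<Sum>i\<in>B. (h \<bullet> i) * D i x))\<bar>
          \<le> norm h * e' + real (card B) * (e' * norm h)"
        using * ** by linarith
      then show ?case
        unfolding eq using insert by (simp add: algebra_simps)
    qed simp
    from this[of Basis] show "norm (f y - f x - (\<Sum>i\<in>Basis. ((y - x) \<bullet> i) * D i x)) \<le> e * norm (y - x)"
      by (simp add: h_def euclidean_representation e'_def)
  qed fact
qed

section \<open>Translation invariance and compactly supported test functions\<close>

lemma integral_lborel_translate: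
  fixes f :: "'a::euclidean_space \<Rightarrow> real"
  assumes [measurable]: "f \<in> borel_measurable borel"
  shows "(\<integral>x. f (x + c) \<partial>lborel) = (\<integral>x. f x \<partial>lborel)"
proof -
  have "(\<integral>x. f x \<partial>lborel) = (\<integral>x. f x \<partial>(distr lborel borel ((+) c)))" by (simp add: lborel_distr_plus)
  also have "\<dots> = (\<integral>x. f (x + c) \<partial>lborel)" by (subst integral_distr) (auto simp: add.commute)
  finally show ?thesis by simp
qed

lemma integrable_lborel_translate:
  fixes f :: "'a::euclidean_space \<Rightarrow> real"
  assumes f: "integrable lborel f"
  shows "integrable lborel (\<lambda>x. f (x + c))"
proof -
  have "integrable (distr lborel borel ((+) c)) f" using f by (simp add: lborel_distr_plus)
  then have "integrable lborel (\<lambda>x. f (c + x))" by (subst (asm) integrable_distr_eq) (use f in auto)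
  then show ?thesis by (simp add: add.commute)
qed

lemma integrable_continuous_compact_support:
  fixes f :: "'a::euclidean_space \<Rightarrow> real"
  assumes "continuous_on UNIV f" "\<And>x. R < norm x \<Longrightarrow> f x = 0"
  shows "integrable lborel f"
proof -
  have "integrable lborel (\<lambda>x. indicator (cball 0 R) x *\<^sub>R f x)"
    using assms(1) by (intro borel_integrable_compact) (auto intro: continuous_on_subset)
  also have "(\<lambda>x. indicator (cball 0 R) x *\<^sub>R f x) = f"
    using assms(2) by (auto simp: fun_eq_iff indicator_def not_le)
  finally show ?thesis .
qed

text \<open>The partials are carried as an explicit family \<open>D\<close>, since the test
  functions in use are products whose derivatives come from the product rule. Only C^1 is required
  because one of them contains a first derivative of u.\<close>

locale test_function =
  fixes \<phi> :: "'a::euclidean_space \<Rightarrow> real" and D :: "'a \<Rightarrow> 'a \<Rightarrow> real" and R :: real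
  assumes partial: "i \<in> Basis \<Longrightarrow> has_partial i \<phi> x (D i x)"
    and cont_D: "i \<in> Basis \<Longrightarrow> continuous_on UNIV (D i)"
    and support: "R \<le> norm x \<Longrightarrow> \<phi> x = 0"
    and R_pos: "0 < R"
begin

lemma has_derivative: "(\<phi> has_derivative (\<lambda>h. \<Sum>i\<in>Basis. (h \<bullet> i) * D i x)) (at x)"
  by (rule has_derivative_of_continuous_partials[OF partial cont_D])

lemma continuous: "continuous_on UNIV \<phi>"
  using has_derivative_continuous[OF has_derivative] by (simp add: continuous_on_eq_continuous_at)

lemma D_support:
  assumes "i \<in> Basis" "R < norm x"
  shows "D i x = 0"
proof -
  have "eventually (\<lambda>s. R < norm (x + s *\<^sub>R i)) (at (0::real))"
  proof (rule order_tendstoD)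
    have "((\<lambda>s::real. norm (x + s *\<^sub>R i)) \<longlongrightarrow> norm (x + 0 *\<^sub>R i)) (at 0)" by (intro tendsto_intros)
    then show "((\<lambda>s::real. norm (x + s *\<^sub>R i)) \<longlongrightarrow> norm x) (at 0)" by simp
  qed fact
  then have "eventually (\<lambda>s. \<phi> (x + s *\<^sub>R i) = 0) (nhds (0::real))"
    using assms(2) by (auto simp: eventually_at_filter elim!: eventually_mono intro!: support)
  moreover have "((\<lambda>s. \<phi> (x + s *\<^sub>R i)) has_real_derivative D i x) (at 0)"
    using partial[OF assms(1)] by (simp add: has_partial_def)
  ultimately have "((\<lambda>s. 0) has_real_derivative D i x) (at (0::real))"
    using DERIV_cong_ev[of 0 0 "\<lambda>s. \<phi> (x + s *\<^sub>R i)" "\<lambda>s. 0" "D i x" "D i x"] by simp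
  then show ?thesis using DERIV_unique[OF _ DERIV_const] by blast
qed

lemma D_bounded: obtains B where "0 \<le> B" "\<And>i x. i \<in> Basis \<Longrightarrow> \<bar>D i x\<bar> \<le> B"
proof -
  have "continuous_on (cball 0 R) (\<lambda>x. \<Sum>i\<in>Basis. \<bar>D i x\<bar>)"
    by (intro continuous_intros continuous_on_subset[OF cont_D]) auto
  then have "bounded ((\<lambda>x. \<Sum>i\<in>Basis. \<bar>D i x\<bar>) ` cball 0 R)"
    by (intro compact_imp_bounded compact_continuous_image) auto
  then obtain B where B: "0 < B" "\<And>x. norm x \<le> R \<Longrightarrow> (\<Sum>i\<in>Basis. \<bar>D i x\<bar>) \<le> B"
    unfolding bounded_pos by force
  show thesis
  proof (rule that[of B])
    fix i x assume i: "i \<in> (Basis :: 'a set)"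
    show "\<bar>D i x\<bar> \<le> B"
    proof (cases "norm x \<le> R")
      case True
      then show ?thesis using B(2)[OF True] member_le_sum[of i Basis "\<lambda>i. \<bar>D i x\<bar>"] i by force
    qed (use D_support[OF i, of x] B in auto)
  qed (use B in auto)
qed

lemma integrable: "integrable lborel \<phi>"
  by (rule integrable_continuous_compact_support[OF continuous, of R]) (simp add: support)

lemma measurable_\<phi>[measurable]: "\<phi> \<in> borel_measurable borel"
  using continuous by (rule borel_measurable_continuous_onI)

lemma measurable_D: "i \<in> Basis \<Longrightarrow> D i \<in> borel_measurable borel"
  using cont_D by (rule borel_measurable_continuous_onI)

text \<open>The difference quotients have integral zero by translation invariance, so no Fubini is
  needed.\<close>

lemma integral_D:
  assumes i: "i \<in> Basis"
  shows "(\<integral>x. D i x \<partial>lborel) = 0"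
proof -
  obtain B where B: "0 \<le> B" "\<And>x. \<bar>D i x\<bar> \<le> B" using D_bounded i by metis
  \<comment> \<open>Steps of size at most 1 keep all difference quotients supported in the ball of
    radius R + 1, which gives one integrable majorant.\<close>
  define h where "h n = 1 / real (Suc n)" for n
  have h: "0 < h n" "h n \<le> 1" for n by (auto simp: h_def)
  define q where "q n x = (\<phi> (x + h n *\<^sub>R i) - \<phi> x) / h n" for n x
  have lim: "(\<lambda>n. q n x) \<longlonglongrightarrow> D i x" for x
  proof -
    have "((\<lambda>s. (\<phi> (x + s *\<^sub>R i) - \<phi> x) / s) \<longlongrightarrow> D i x) (at 0)"
      using partial[OF i, of x] by (simp add: has_partial_def has_field_derivative_iff)
    moreover have "filterlim h (at 0) sequentially"
      unfolding filterlim_at h_def using LIMSEQ_inverse_real_of_nat by (auto simp: inverse_eq_divide)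
    ultimately show ?thesis unfolding q_def by (rule filterlim_compose)
  qed
  have bound: "\<bar>q n x\<bar> \<le> B * indicator (cball 0 (R + 1)) x" for n x
  proof -
    have "\<exists>s>0. s < h n \<and> \<phi> (x + h n *\<^sub>R i) - \<phi> (x + 0 *\<^sub>R i) = (h n - 0) * D i (x + s *\<^sub>R i)"
      by (rule MVT2) (use h in \<open>auto intro!: has_partial_line partial i\<close>)
    then obtain s where s: "0 < s" "s < h n" "q n x = D i (x + s *\<^sub>R i)"
      using h[of n] by (auto simp: q_def field_simps)
    show ?thesis
    proof (cases "norm x \<le> R + 1")
      case False
      have "norm x \<le> norm (x + s *\<^sub>R i) + norm (s *\<^sub>R i)"
        using norm_triangle_ineq4[of "x + s *\<^sub>R i" "s *\<^sub>R i"] by simp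
      then have "R < norm (x + s *\<^sub>R i)" using False s h[of n] i by simp
      then show ?thesis using s D_support[OF i] B(1) by simp
    qed (use s B in auto)
  qed
  have int: "integrable lborel (\<lambda>x. B * indicator (cball (0::'a) (R + 1)) x)"
    using borel_integrable_compact[of "cball (0::'a) (R + 1)" "\<lambda>_. B"] by (simp add: mult.commute)
  have "(\<lambda>n. \<integral>x. q n x \<partial>lborel) \<longlonglongrightarrow> (\<integral>x. D i x \<partial>lborel)"
  proof (rule integral_dominated_convergence[OF _ _ int])
    show "D i \<in> borel_measurable lborel" using measurable_D[OF i] by simp
    show "q n \<in> borel_measurable lborel" for n unfolding q_def by measurable
  qed (use lim bound in auto)
  moreover have "(\<integral>x. q n x \<partial>lborel) = 0" for n
    using integrable integrable_lborel_translate[OF integrable, of "h n *\<^sub>R i"]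
    by (simp add: q_def integral_lborel_translate)
  ultimately have "(\<lambda>n::nat. 0) \<longlonglongrightarrow> (\<integral>x. D i x \<partial>lborel)" by simp
  then show ?thesis by (simp add: LIMSEQ_const_iff)
qed

text \<open>The integrand is the derivative of s -> \<phi>(s y), which starts at \<phi>(0) and has
  reached 0 once the ray has left the support.\<close>

lemma ray_integral:
  assumes "y \<noteq> 0"
  shows "(\<integral>s. indicator {0<..} s * (\<Sum>i\<in>Basis. D i (s *\<^sub>R y) * (y \<bullet> i)) \<partial>lborel) = - \<phi> 0"
proof -
  define f where "f s = (\<Sum>i\<in>Basis. (y \<bullet> i) * D i (s *\<^sub>R y))" for s :: real
  define S where "S = (R + 1) / norm y"
  have S: "0 \<le> S" "norm (S *\<^sub>R y) = R + 1" using assms R_pos by (auto simp: S_def)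
  have d: "((\<lambda>s. \<phi> (s *\<^sub>R y)) has_vector_derivative f s) (at s within T)" for s T
  proof -
    have "((\<lambda>s. \<phi> (s *\<^sub>R y)) has_derivative (\<lambda>r. \<Sum>i\<in>Basis. ((r *\<^sub>R y) \<bullet> i) * D i (s *\<^sub>R y))) (at s within T)"
      by (rule has_derivative_compose[OF _ has_derivative]) (auto intro!: derivative_eq_intros)
    then show ?thesis
      by (simp add: has_vector_derivative_def f_def sum_distrib_left mult_ac)
  qed
  have "continuous_on {0..S} f"
    unfolding f_def
    by (intro continuous_intros continuous_on_compose2[OF cont_D, of _ _ "\<lambda>s. s *\<^sub>R y"]) auto
  then have "has_bochner_integral lborel (\<lambda>s. indicator {0..S} s *\<^sub>R f s) (\<phi> (S *\<^sub>R y) - \<phi> (0 *\<^sub>R y))"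
    using S(1) d by (intro has_bochner_integral_FTC_Icc) auto
  then have "(\<integral>s. indicator {0..S} s *\<^sub>R f s \<partial>lborel) = - \<phi> 0"
    using S support[of "S *\<^sub>R y"] by (simp add: has_bochner_integral_iff)
  moreover have "(\<integral>s. indicator {0<..} s * (\<Sum>i\<in>Basis. D i (s *\<^sub>R y) * (y \<bullet> i)) \<partial>lborel) = (\<integral>s. indicator {0..S} s *\<^sub>R f s \<partial>lborel)"
  proof (rule integral_cong_AE)
    have m: "f \<in> borel_measurable borel" unfolding f_def
      by (intro borel_measurable_sum borel_measurable_times measurable_const
         measurable_compose[OF _ measurable_D]) auto
    then show "(\<lambda>s. indicator {0..S} s *\<^sub>R f s) \<in> borel_measurable lborel" by measurable
    have "(\<lambda>s. indicator {0<..} s * f s) \<in> borel_measurable lborel" using m by measurable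
    then show "(\<lambda>s. indicator {0<..} s * (\<Sum>i\<in>Basis. D i (s *\<^sub>R y) * (y \<bullet> i))) \<in> borel_measurable lborel"
      by (simp add: f_def mult.commute)
    have "AE s in lborel. s \<noteq> (0::real)" by (rule AE_lborel_singleton)
    then show "AE s in lborel. indicator {0<..} s * (\<Sum>i\<in>Basis. D i (s *\<^sub>R y) * (y \<bullet> i)) = indicator {0..S} s *\<^sub>R f s"
    proof eventually_elim
      case (elim s)
      have "f s = 0" if "S < s"
      proof -
        have "norm (S *\<^sub>R y) < norm (s *\<^sub>R y)" using that assms S(1) by simp
        then show ?thesis using S(2) R_pos by (simp add: f_def D_support)
      qed
      then show ?case using elim by (auto simp: indicator_def f_def mult.commute not_le)
    qed
  qed
  ultimately show ?thesis by simp
qed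

lemma integrable_kernel_at_0:
  "integrable lborel (\<lambda>x. (\<Sum>i\<in>Basis. D i x * (x \<bullet> i)) / norm x ^ DIM('a))"
proof (rule integrableI_bounded)
  obtain B where B: "0 \<le> B" "\<And>i x. i \<in> Basis \<Longrightarrow> \<bar>D i x\<bar> \<le> B" using D_bounded by blast
  have [measurable]: "ball (0::'a) (R + 1) \<in> sets borel" by auto
  show "(\<lambda>x. (\<Sum>i\<in>Basis. D i x * (x \<bullet> i)) / norm x ^ DIM('a)) \<in> borel_measurable lborel"
    using measurable_D by measurable
  have "(\<integral>\<^sup>+x. ennreal (norm ((\<Sum>i\<in>Basis. D i x * (x \<bullet> i)) / norm x ^ DIM('a))) \<partial>lborel) \<le>
    (\<integral>\<^sup>+x. ennreal (real DIM('a) * B) * (indicator (ball (0::'a) (R + 1)) x * ennreal (newton_kernel x)) \<partial>lborel)"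
  proof (rule nn_integral_mono)
    fix x :: 'a
    show "ennreal (norm ((\<Sum>i\<in>Basis. D i x * (x \<bullet> i)) / norm x ^ DIM('a)))
       \<le> ennreal (real DIM('a) * B) * (indicator (ball 0 (R + 1)) x * ennreal (newton_kernel x))"
    proof (cases "norm x < R + 1")
      case True
      have "\<bar>\<Sum>i\<in>Basis. D i x * (x \<bullet> i)\<bar> \<le> (\<Sum>i\<in>(Basis::'a set). B * norm x)"
        using B Basis_le_norm by (intro order_trans[OF sum_abs] sum_mono) (auto simp: abs_mult intro!: mult_mono)
      then have "\<bar>\<Sum>i\<in>Basis. D i x * (x \<bullet> i)\<bar> / norm x ^ DIM('a) \<le> real DIM('a) * B * newton_kernel x"
        by (simp add: newton_kernel_def divide_right_mono mult.assoc)
      then show ?thesis using True B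
        by (simp add: abs_divide ennreal_mult[symmetric] newton_kernel_nonneg ennreal_leI)
    qed (simp add: D_support)
  qed
  also have "\<dots> = ennreal (real DIM('a) * B) * (\<integral>\<^sup>+x. indicator (ball 0 (R + 1)) x * ennreal (newton_kernel (x::'a)) \<partial>lborel)"
    by (rule nn_integral_cmult) measurable
  also have "\<dots> < \<infinity>"
  proof -
    have "(\<integral>\<^sup>+x. indicator (ball 0 (R + 1)) x * ennreal (newton_kernel (x::'a)) \<partial>lborel) < \<infinity>"
      by (rule le_less_trans[OF nn_integral_newton_kernel_ball]) (use R_pos in auto)
    then show ?thesis by (simp add: ennreal_mult_less_top)
  qed
  finally show "(\<integral>\<^sup>+x. ennreal (norm ((\<Sum>i\<in>Basis. D i x * (x \<bullet> i)) / norm x ^ DIM('a))) \<partial>lborel) < \<infinity>" .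
qed

text \<open>This is div (x / |x|^d) = d \<omega>_d \<delta>_0 in weak form. In polar coordinates the
  singular weight disappears: each ray contributes -\<phi>(0), the \<open>y\<close> range over the
  unit ball, and the factor d comes from the polar formula. No small ball has to be removed and no
  surface integral appears.\<close>

lemma integral_kernel_at_0:
  "(\<integral>x. (\<Sum>i\<in>Basis. D i x * (x \<bullet> i)) / norm x ^ DIM('a) \<partial>lborel)
    = - (real DIM('a) * measure lborel (ball (0::'a) 1)) * \<phi> 0"
proof -
  let ?g = "\<lambda>x. \<Sum>i\<in>Basis. D i x * (x \<bullet> i)"
  let ?H = "\<lambda>(s, y::'a). indicator {0<..} s * indicator (cball 0 1) y * (?g (s *\<^sub>R y) / s)"
  have [measurable]: "cball (0::'a) 1 \<in> sets borel" by auto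
  have g: "?g \<in> borel_measurable borel" using measurable_D by measurable
  have H: "integrable (lborel \<Otimes>\<^sub>M lborel) ?H"
    and eq: "(\<integral>x. ?g x / norm x ^ DIM('a) \<partial>lborel) = real DIM('a) * integral\<^sup>L (lborel \<Otimes>\<^sub>M lborel) ?H"
    using integral_radial[OF g integrable_kernel_at_0] by auto
  have "integral\<^sup>L (lborel \<Otimes>\<^sub>M lborel) ?H = (\<integral>y. \<integral>s. ?H (s, y) \<partial>lborel \<partial>lborel)"
    using lborel_pair.integral_snd[of "\<lambda>s y. ?H (s, y)"] H by simp
  also have "\<dots> = (\<integral>y. - \<phi> 0 * indicator (cball 0 1) (y::'a) \<partial>lborel)"
  proof (rule integral_cong_AE)
    have "AE y in lborel. y \<noteq> (0::'a)" by (rule AE_lborel_singleton)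
    then show "AE y in lborel. (\<integral>s. ?H (s, y) \<partial>lborel) = - \<phi> 0 * indicator (cball 0 1) (y::'a)"
    proof eventually_elim
      case (elim y)
      have "(\<integral>s. ?H (s, y) \<partial>lborel) = (\<integral>s. indicator (cball 0 1) y * (indicator {0<..} s * (\<Sum>i\<in>Basis. D i (s *\<^sub>R y) * (y \<bullet> i))) \<partial>lborel)"
        by (intro Bochner_Integration.integral_cong) (auto simp: indicator_def sum_divide_distrib intro!: sum.cong)
      then show ?case using ray_integral[OF elim] by simp
    qed
    show "(\<lambda>y. \<integral>s. ?H (s, y) \<partial>lborel) \<in> borel_measurable lborel"
      using lborel_pair.integrable_snd[of "\<lambda>s y. ?H (s, y)"] H by auto
  qed auto
  also have "\<dots> = - \<phi> 0 * measure lborel (cball (0::'a) 1)" by simp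
  also have "measure lborel (cball (0::'a) 1) = measure lborel (ball (0::'a) 1)"
    by (simp add: content_cball content_ball)
  finally show ?thesis using eq by simp
qed

lemma translate: "test_function (\<lambda>x. \<phi> (x + z)) (\<lambda>i x. D i (x + z)) (R + norm z)"
proof
  show "continuous_on UNIV (\<lambda>x. D i (x + z))" if "i \<in> Basis" for i
    by (rule continuous_on_compose2[OF cont_D[OF that]]) (auto intro!: continuous_intros)
  show "\<phi> (x + z) = 0" if "R + norm z \<le> norm x" for x
  proof (rule support)
    show "R \<le> norm (x + z)" using that norm_triangle_ineq4[of "x + z" z] by simp
  qed
qed (use R_pos partial in \<open>auto simp: has_partial_translate add_pos_nonneg\<close>)

lemma integral_kernel:
  "(\<integral>x. (\<Sum>i\<in>Basis. D i x * ((x - z) \<bullet> i)) / norm (x - z) ^ DIM('a) \<partial>lborel)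
    = - (real DIM('a) * measure lborel (ball (0::'a) 1)) * \<phi> z"
proof -
  interpret tr: test_function "\<lambda>x. \<phi> (x + z)" "\<lambda>i x. D i (x + z)" "R + norm z" by (rule translate)
  have "(\<lambda>x. (\<Sum>i\<in>Basis. D i x * ((x - z) \<bullet> i)) / norm (x - z) ^ DIM('a)) \<in> borel_measurable borel"
    using measurable_D by measurable
  from integral_lborel_translate[OF this, of z] show ?thesis
    using tr.integral_kernel_at_0 by simp
qed

end

subsection \<open>The weak Poisson equation\<close>

lemma nn_integral_lborel_translate:
  fixes f :: "'a::euclidean_space \<Rightarrow> ennreal"
  assumes [measurable]: "f \<in> borel_measurable borel"
  shows "(\<integral>\<^sup>+x. f (x + c) \<partial>lborel) = (\<integral>\<^sup>+x. f x \<partial>lborel)"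
proof -
  have "(\<integral>\<^sup>+x. f x \<partial>lborel) = (\<integral>\<^sup>+x. f x \<partial>(distr lborel borel ((+) c)))" by (simp add: lborel_distr_plus)
  also have "\<dots> = (\<integral>\<^sup>+x. f (x + c) \<partial>lborel)" by (subst nn_integral_distr) (auto simp: add.commute)
  finally show ?thesis by simp
qed

locale bounded_density =
  fixes w :: "'a::euclidean_space \<Rightarrow> real" and A :: real
  assumes integrable_w: "integrable lborel w"
    and bound_w: "\<And>x. \<bar>w x\<bar> \<le> A"
begin

text \<open>The surface area of the unit sphere, which normalises the Newtonian gradient.\<close>

definition "c_d = real DIM('a) * measure lborel (ball (0::'a) 1)"

lemma c_d_pos: "0 < c_d"
proof -
  have "measure lborel (ball (0::'a) 1) = unit_ball_vol (real DIM('a))" by (simp add: content_ball)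
  then show ?thesis by (simp add: c_d_def unit_ball_vol_pos)
qed

definition "V = A * c_d + (\<integral>x. \<bar>w x\<bar> \<partial>lborel)"

lemma A_nonneg: "0 \<le> A" using bound_w[of undefined] by linarith

lemma V_nonneg: "0 \<le> V" unfolding V_def using A_nonneg c_d_pos by (auto intro!: add_nonneg_nonneg)

lemma measurable_w[measurable]: "w \<in> borel_measurable borel" using integrable_w by auto

text \<open>Split at |x - z| = 1: inside, |w| is at most \<open>A\<close> and the kernel has
  integral at most \<open>c_d\<close>; outside, the kernel is at most 1, in dimension one too, and
  the L^1 norm of \<open>w\<close> takes over. The two contributions form \<open>V\<close>, which is
  independent of \<open>x\<close>.\<close>

lemma nn_integral_conv_le: "(\<integral>\<^sup>+z. ennreal (\<bar>w z\<bar> * newton_kernel (x - z)) \<partial>lborel) \<le> ennreal V"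
proof -
  have [measurable]: "ball (0::'a) 1 \<in> sets borel" by auto
  have "(\<integral>\<^sup>+z. ennreal (\<bar>w z\<bar> * newton_kernel (x - z)) \<partial>lborel) \<le>
    (\<integral>\<^sup>+z. ennreal A * (indicator (ball 0 1) (z + - x) * ennreal (newton_kernel (z + - x))) + ennreal \<bar>w z\<bar> \<partial>lborel)"
  proof (rule nn_integral_mono)
    fix z
    have sym: "newton_kernel (x - z) = newton_kernel (z + - x)"
      by (simp add: newton_kernel_def norm_minus_commute)
    show "ennreal (\<bar>w z\<bar> * newton_kernel (x - z)) \<le> ennreal A * (indicator (ball 0 1) (z + - x) * ennreal (newton_kernel (z + - x))) + ennreal \<bar>w z\<bar>"
    proof (cases "norm (z + - x) < 1")
      case True
      have "\<bar>w z\<bar> * newton_kernel (x - z) \<le> A * newton_kernel (z + - x)"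
        unfolding sym by (intro mult_right_mono bound_w newton_kernel_nonneg)
      then have "ennreal (\<bar>w z\<bar> * newton_kernel (x - z)) \<le> ennreal (A * newton_kernel (z + - x))"
        by (rule ennreal_leI)
      then show ?thesis using True A_nonneg
        by (simp add: ennreal_mult newton_kernel_nonneg add_increasing2)
    next
      case False
      have "\<bar>w z\<bar> * newton_kernel (z + - x) \<le> \<bar>w z\<bar> * 1"
        using newton_kernel_le_1[of "z + - x"] False by (intro mult_left_mono) auto
      then show ?thesis unfolding sym using False by (simp add: ennreal_leI)
    qed
  qed
  also have "\<dots> = ennreal A * (\<integral>\<^sup>+z. indicator (ball 0 1) (z + - x) * ennreal (newton_kernel (z + - x)) \<partial>lborel)
      + (\<integral>\<^sup>+z. ennreal \<bar>w z\<bar> \<partial>lborel)"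
    by (subst nn_integral_add) (auto simp: nn_integral_cmult)
  also have "(\<integral>\<^sup>+z. indicator (ball 0 1) (z + - x) * ennreal (newton_kernel (z + - x)) \<partial>lborel)
     = (\<integral>\<^sup>+z. indicator (ball (0::'a) 1) z * ennreal (newton_kernel z) \<partial>lborel)"
    by (rule nn_integral_lborel_translate) measurable
  also have "ennreal A * (\<integral>\<^sup>+z. indicator (ball (0::'a) 1) z * ennreal (newton_kernel z) \<partial>lborel)
      + (\<integral>\<^sup>+z. ennreal \<bar>w z\<bar> \<partial>lborel) \<le> ennreal A * ennreal c_d + ennreal (\<integral>z. \<bar>w z\<bar> \<partial>lborel)"
    using nn_integral_newton_kernel_ball[of 1, where 'a='a] integrable_w
    by (intro add_mono mult_left_mono) (auto simp: c_d_def nn_integral_eq_integral)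
  also have "\<dots> = ennreal V"
    unfolding V_def using A_nonneg c_d_pos by (simp add: ennreal_mult ennreal_plus)
  finally show ?thesis .
qed

lemma norm_kernel: "norm ((w z / norm (x - z) ^ DIM('a)) *\<^sub>R (x - z)) = \<bar>w z\<bar> * newton_kernel (x - z)"
  by (simp add: newton_kernel_def)

lemma integrable_kernel: "integrable lborel (\<lambda>z. (w z / norm (x - z) ^ DIM('a)) *\<^sub>R (x - z))"
proof (rule integrableI_bounded)
  show "(\<integral>\<^sup>+z. ennreal (norm ((w z / norm (x - z) ^ DIM('a)) *\<^sub>R (x - z))) \<partial>lborel) < \<infinity>"
    unfolding norm_kernel by (rule le_less_trans[OF nn_integral_conv_le]) simp
qed measurable

lemma norm_grad_newton_le: "norm (grad_newton w x) \<le> V / c_d"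
proof -
  have "ennreal (norm (\<integral>z. (w z / norm (x - z) ^ DIM('a)) *\<^sub>R (x - z) \<partial>lborel)) \<le> ennreal V"
    using integral_norm_bound_ennreal[OF integrable_kernel] nn_integral_conv_le[of x]
    unfolding norm_kernel by (rule order_trans)
  then have "norm (\<integral>z. (w z / norm (x - z) ^ DIM('a)) *\<^sub>R (x - z) \<partial>lborel) \<le> V"
    using V_nonneg by simp
  then show ?thesis
    using c_d_pos unfolding grad_newton_def c_d_def[symmetric] by (simp add: divide_right_mono)
qed

lemma measurable_grad_newton[measurable]: "grad_newton w \<in> borel_measurable borel"
  unfolding grad_newton_def by measurable

lemma integrable_mult_grad_newton:
  assumes "integrable lborel g" "i \<in> Basis"
  shows "integrable lborel (\<lambda>x. g x * (grad_newton w x \<bullet> i))"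
proof (rule Bochner_Integration.integrable_bound)
  show "integrable lborel (\<lambda>x. (V / c_d) * \<bar>g x\<bar>)" using assms by simp
  show "AE x in lborel. norm (g x * (grad_newton w x \<bullet> i)) \<le> norm ((V / c_d) * \<bar>g x\<bar>)"
  proof (rule AE_I2)
    fix x
    have "\<bar>grad_newton w x \<bullet> i\<bar> \<le> V / c_d"
      using Basis_le_norm[OF assms(2)] norm_grad_newton_le by (rule order_trans)
    then have "\<bar>g x\<bar> * \<bar>grad_newton w x \<bullet> i\<bar> \<le> \<bar>g x\<bar> * (V / c_d)" by (intro mult_left_mono) auto
    then show "norm (g x * (grad_newton w x \<bullet> i)) \<le> norm ((V / c_d) * \<bar>g x\<bar>)"
      using V_nonneg c_d_pos by (simp add: abs_mult mult.commute)
  qed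
qed (use assms in measurable)

text \<open>Inserting the integral formula for the gradient and exchanging the integrals leaves, for
  each fixed z, the kernel identity centred at z, whose constant cancels the normalisation. No
  differentiability of \<open>grad_newton\<close> enters.\<close>

proposition weak_poisson:
  assumes "test_function \<phi> D R"
  shows "(\<integral>x. (\<Sum>i\<in>Basis. D i x * (grad_newton w x \<bullet> i)) \<partial>lborel) = (\<integral>x. \<phi> x * w x \<partial>lborel)"
proof -
  interpret test_function \<phi> D R by fact
  obtain B where B: "0 \<le> B" "\<And>i x. i \<in> Basis \<Longrightarrow> \<bar>D i x\<bar> \<le> B" using D_bounded by blast
  define P where "P x z = (\<Sum>i\<in>Basis. D i x * ((x - z) \<bullet> i))" for x z
  define H where "H x z = w z * (P x z / norm (x - z) ^ DIM('a))" for x z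
  have [measurable]: "(\<lambda>(x, z). P x z) \<in> borel_measurable (borel \<Otimes>\<^sub>M borel)"
    unfolding P_def using measurable_D by measurable
  have H_meas[measurable]: "(\<lambda>(x, z). H x z) \<in> borel_measurable (borel \<Otimes>\<^sub>M borel)"
    unfolding H_def by measurable
  have [measurable]: "cball (0::'a) R \<in> sets borel" by auto
  have P_le: "\<bar>P x z\<bar> \<le> real DIM('a) * B * indicator (cball 0 R) x * norm (x - z)" for x z
  proof (cases "norm x \<le> R")
    case True
    have "\<bar>P x z\<bar> \<le> (\<Sum>i\<in>(Basis::'a set). B * norm (x - z))"
      unfolding P_def using B Basis_le_norm
      by (intro order_trans[OF sum_abs] sum_mono) (auto simp: abs_mult intro!: mult_mono)
    then show ?thesis using True by (simp add: mult.assoc)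
  qed (simp add: P_def D_support)
  have H_le: "\<bar>H x z\<bar> \<le> real DIM('a) * B * indicator (cball 0 R) x * (\<bar>w z\<bar> * newton_kernel (x - z))" for x z
  proof -
    have "\<bar>H x z\<bar> = \<bar>w z\<bar> * (\<bar>P x z\<bar> / norm (x - z) ^ DIM('a))" by (simp add: H_def abs_mult)
    also have "\<dots> \<le> \<bar>w z\<bar> * (real DIM('a) * B * indicator (cball 0 R) x * norm (x - z) / norm (x - z) ^ DIM('a))"
      using P_le by (intro mult_left_mono divide_right_mono) auto
    finally show ?thesis by (simp add: newton_kernel_def mult_ac)
  qed
  \<comment> \<open>\<open>D\<close> vanishes outside the ball of radius \<open>R\<close>, and the
    inner integral over z is at most \<open>V\<close> whatever x is, so the double integral is at
    most d B V times the volume of that ball. This is what licenses Fubini.\<close>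
  have int_H: "integrable (lborel \<Otimes>\<^sub>M lborel) (\<lambda>(x, z). H x z)"
  proof (rule integrableI_bounded)
    have "(\<integral>\<^sup>+p. ennreal (norm (case p of (x, z) \<Rightarrow> H x z)) \<partial>(lborel \<Otimes>\<^sub>M lborel)) =
      (\<integral>\<^sup>+x. \<integral>\<^sup>+z. ennreal \<bar>H x z\<bar> \<partial>lborel \<partial>lborel)"
      by (subst lborel.nn_integral_fst[symmetric]) auto
    also have "\<dots> \<le> (\<integral>\<^sup>+x. ennreal (real DIM('a) * B * V) * indicator (cball (0::'a) R) x \<partial>lborel)"
    proof (rule nn_integral_mono)
      fix x :: 'a
      have "(\<integral>\<^sup>+z. ennreal \<bar>H x z\<bar> \<partial>lborel) \<le>
        (\<integral>\<^sup>+z. ennreal (real DIM('a) * B * indicator (cball 0 R) x) * ennreal (\<bar>w z\<bar> * newton_kernel (x - z)) \<partial>lborel)"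
      proof (rule nn_integral_mono)
        fix z
        show "ennreal \<bar>H x z\<bar> \<le> ennreal (real DIM('a) * B * indicator (cball 0 R) x) * ennreal (\<bar>w z\<bar> * newton_kernel (x - z))"
          using H_le[of x z] B by (subst ennreal_mult[symmetric]) (auto intro!: ennreal_leI mult_nonneg_nonneg newton_kernel_nonneg)
      qed
      also have "\<dots> = ennreal (real DIM('a) * B * indicator (cball 0 R) x) * (\<integral>\<^sup>+z. ennreal (\<bar>w z\<bar> * newton_kernel (x - z)) \<partial>lborel)"
        by (rule nn_integral_cmult) measurable
      also have "\<dots> \<le> ennreal (real DIM('a) * B * indicator (cball 0 R) x) * ennreal V"
        by (intro mult_left_mono nn_integral_conv_le) auto
      also have "\<dots> = ennreal (real DIM('a) * B * V) * indicator (cball 0 R) x"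
        using B V_nonneg by (subst ennreal_mult[symmetric]) (auto simp: indicator_def)
      finally show "(\<integral>\<^sup>+z. ennreal \<bar>H x z\<bar> \<partial>lborel) \<le> ennreal (real DIM('a) * B * V) * indicator (cball 0 R) x" .
    qed
    also have "\<dots> = ennreal (real DIM('a) * B * V) * emeasure lborel (cball (0::'a) R)"
      by (rule nn_integral_cmult_indicator) auto
    also have "\<dots> < \<infinity>"
      using emeasure_compact_finite[of "cball (0::'a) R"] by (simp add: ennreal_mult_less_top)
    finally show "(\<integral>\<^sup>+p. ennreal (norm (case p of (x, z) \<Rightarrow> H x z)) \<partial>(lborel \<Otimes>\<^sub>M lborel)) < \<infinity>" .
  qed measurable
  have "(\<Sum>i\<in>Basis. D i x * (grad_newton w x \<bullet> i)) = - (1 / c_d) * (\<integral>z. H x z \<partial>lborel)" for x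
  proof -
    have "(\<Sum>i\<in>Basis. D i x * ((\<integral>z. (w z / norm (x - z) ^ DIM('a)) *\<^sub>R (x - z) \<partial>lborel) \<bullet> i))
      = (\<Sum>i\<in>Basis. \<integral>z. D i x * (((w z / norm (x - z) ^ DIM('a)) *\<^sub>R (x - z)) \<bullet> i) \<partial>lborel)"
      using integrable_kernel by (intro sum.cong refl) (simp del: inner_scaleR_left)
    also have "\<dots> = (\<integral>z. (\<Sum>i\<in>Basis. D i x * (((w z / norm (x - z) ^ DIM('a)) *\<^sub>R (x - z)) \<bullet> i)) \<partial>lborel)"
      using integrable_kernel
      by (intro Bochner_Integration.integral_sum[symmetric] integrable_mult_right integrable_inner_left) auto
    also have "\<dots> = (\<integral>z. H x z \<partial>lborel)"
      by (intro Bochner_Integration.integral_cong)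
         (auto simp: H_def P_def sum_distrib_left sum_divide_distrib mult_ac intro!: sum.cong)
    finally show ?thesis
      by (simp add: grad_newton_def c_d_def sum_distrib_left[symmetric] sum_negf sum_divide_distrib[symmetric])
  qed
  then have "(\<integral>x. (\<Sum>i\<in>Basis. D i x * (grad_newton w x \<bullet> i)) \<partial>lborel) = - (1 / c_d) * (\<integral>x. \<integral>z. H x z \<partial>lborel \<partial>lborel)"
    by simp
  also have "(\<integral>x. \<integral>z. H x z \<partial>lborel \<partial>lborel) = (\<integral>z. \<integral>x. H x z \<partial>lborel \<partial>lborel)"
    using lborel_pair.Fubini_integral[OF int_H] by simp
  also have "\<dots> = (\<integral>z. - c_d * (\<phi> z * w z) \<partial>lborel)"
  proof (intro Bochner_Integration.integral_cong refl)
    fix z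
    have "(\<integral>x. H x z \<partial>lborel) = w z * (\<integral>x. P x z / norm (x - z) ^ DIM('a) \<partial>lborel)"
      unfolding H_def by (rule integral_mult_right_zero)
    also have "\<dots> = - c_d * (\<phi> z * w z)" unfolding P_def integral_kernel c_d_def by simp
    finally show "(\<integral>x. H x z \<partial>lborel) = - c_d * (\<phi> z * w z)" .
  qed
  finally show ?thesis using c_d_pos by simp
qed

end

subsection \<open>Maximum principle\<close>

text \<open>The parabola k s + \<delta> s^2 is the change of the penalty \<delta> |x|^2 along a
  coordinate line. After subtracting it, 0 is a maximum point; a positive second derivative there
  would make the difference increase just to the right of 0.\<close>

lemma second_derivative_test:
  fixes f f' :: "real \<Rightarrow> real"
  assumes f: "\<And>s. (f has_real_derivative f' s) (at s)"
    and f': "(f' has_real_derivative f'') (at 0)"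
    and max: "\<And>s. f s - (k * s + \<delta> * s\<^sup>2) \<le> f 0"
  shows "f' 0 = k" and "f'' \<le> 2 * \<delta>"
proof -
  define g where "g s = f s - (k * s + \<delta> * s\<^sup>2)" for s
  define g' where "g' s = f' s - (k + 2 * \<delta> * s)" for s
  have g: "(g has_real_derivative g' s) (at s)" for s
    unfolding g_def g'_def by (rule derivative_eq_intros f refl | simp)+
  have g': "(g' has_real_derivative f'' - 2 * \<delta>) (at 0)"
    unfolding g'_def by (rule derivative_eq_intros f' refl | simp)+
  have "g' 0 = 0"
    by (rule DERIV_local_max[OF g, of 1]) (use max in \<open>auto simp: g_def\<close>)
  then show "f' 0 = k" by (simp add: g'_def)
  show "f'' \<le> 2 * \<delta>"
  proof (rule ccontr)
    assume "\<not> f'' \<le> 2 * \<delta>"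
    then have "0 < f'' - 2 * \<delta>" by simp
    from DERIV_pos_inc_right[OF g' this] obtain d where d: "0 < d" "\<And>h. 0 < h \<Longrightarrow> h < d \<Longrightarrow> 0 < g' h"
      using \<open>g' 0 = 0\<close> by auto
    have "\<exists>z>0. z < d / 2 \<and> g (d / 2) - g 0 = (d / 2 - 0) * g' z"
      by (rule MVT2) (use d g in auto)
    then obtain z where "0 < z" "z < d / 2" "g (d / 2) - g 0 = d / 2 * g' z" by auto
    moreover from this have "0 < d / 2 * g' z" using d by (intro mult_pos_pos) auto
    ultimately show False using max[of "d / 2"] by (simp add: g_def)
  qed
qed

text \<open>Outside a large ball the penalised function lies below its value at the origin, so
  compactness applies. Comparison with the origin also gives the last conclusion, which limits how
  far out the maximum can sit.\<close>

lemma penalised_maximum: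
  fixes w :: "real \<Rightarrow> 'a::euclidean_space \<Rightarrow> real"
  assumes cont: "continuous_on ({0..T} \<times> UNIV) (\<lambda>(t, x). w t x)"
    and bdd: "\<And>t x. t \<in> {0..T} \<Longrightarrow> \<bar>w t x\<bar> \<le> A"
    and "0 \<le> T" "0 < \<delta>"
  obtains t0 x0 where "t0 \<in> {0..T}"
    "\<And>t x. t \<in> {0..T} \<Longrightarrow> w t x - \<delta> * (x \<bullet> x) \<le> w t0 x0 - \<delta> * (x0 \<bullet> x0)"
    "\<delta> * (x0 \<bullet> x0) \<le> 2 * A"
proof -
  have "\<bar>w 0 0\<bar> \<le> A" by (rule bdd) (use assms in auto)
  then have A: "0 \<le> A" by linarith
  \<comment> \<open>With \<rho> \<ge> 1, a point with |x| > \<rho> has |x|^2 \<ge> \<rho>, hence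
    \<delta> |x|^2 \<ge> 2 A and a penalised value of at most -A.\<close>
  define \<rho> where "\<rho> = 1 + 2 * A / \<delta>"
  have \<rho>: "1 \<le> \<rho>" using A assms by (simp add: \<rho>_def)
  let ?S = "{0..T} \<times> cball (0::'a) \<rho>"
  let ?f = "\<lambda>p. (case p of (t, x) \<Rightarrow> w t x) - \<delta> * (snd p \<bullet> snd p)"
  have "compact ?S" by (intro compact_Times) auto
  moreover have "?S \<noteq> {}" using assms \<rho> by auto
  moreover have "continuous_on ?S ?f"
    by (intro continuous_intros continuous_on_subset[OF cont]) auto
  ultimately obtain p where p: "p \<in> ?S" "\<forall>q\<in>?S. ?f q \<le> ?f p"
    using continuous_attains_sup by blast
  obtain t0 x0 where p_eq: "p = (t0, x0)" by (cases p)
  have in_S: "w t x - \<delta> * (x \<bullet> x) \<le> w t0 x0 - \<delta> * (x0 \<bullet> x0)" if "t \<in> {0..T}" "norm x \<le> \<rho>" for t x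
    using p(2) that by (auto simp: p_eq)
  have t0: "t0 \<in> {0..T}" using p by (auto simp: p_eq)
  have mx: "w t x - \<delta> * (x \<bullet> x) \<le> w t0 x0 - \<delta> * (x0 \<bullet> x0)" if t: "t \<in> {0..T}" for t x
  proof (cases "norm x \<le> \<rho>")
    case False
    have "2 * A \<le> \<delta> * \<rho>" using assms by (simp add: \<rho>_def field_simps)
    also have "\<delta> * \<rho> \<le> \<delta> * (x \<bullet> x)"
    proof -
      have "\<rho> * 1 \<le> norm x * norm x" using False \<rho> by (intro mult_mono) auto
      then show ?thesis using assms by (simp add: power2_norm_eq_inner[symmetric] power2_eq_square)
    qed
    finally have "w t x - \<delta> * (x \<bullet> x) \<le> - A" using bdd[OF t, of x] by linarith
    also have "\<dots> \<le> w t 0 - \<delta> * ((0::'a) \<bullet> 0)" using bdd[OF t, of 0] by (simp add: abs_le_iff)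
    also have "\<dots> \<le> w t0 x0 - \<delta> * (x0 \<bullet> x0)" using in_S[OF t, of 0] \<rho> by simp
    finally show ?thesis .
  qed (rule in_S[OF t])
  show thesis
  proof (rule that[OF t0 mx])
    show "\<delta> * (x0 \<bullet> x0) \<le> 2 * A"
      using mx[OF t0, of 0] bdd[OF t0, of x0] bdd[OF t0, of 0] by (simp add: abs_le_iff)
  qed
qed

text \<open>One parameter for two demands: the strict one produces the contradiction at the
  extremum, the other limits the penalty at the point where the bound is assumed to fail. Dividing
  by K + 1 and L + 1 covers zero constants and yields strictness.\<close>

lemma ex_small_scale:
  fixes K L e1 e2 :: real
  assumes "0 \<le> K" "0 \<le> L" "0 < e1" "0 < e2"
  obtains \<tau> where "0 < \<tau>" "\<tau> \<le> 1" "\<tau> * K < e1" "\<tau> * L \<le> e2"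
proof
  define \<tau> where "\<tau> = min 1 (min (e1 / (K + 1)) (e2 / (L + 1)))"
  show "0 < \<tau>" "\<tau> \<le> 1" using assms by (auto simp: \<tau>_def)
  have "\<tau> * (K + 1) \<le> e1" using assms by (simp add: \<tau>_def pos_le_divide_eq[symmetric])
  then show "\<tau> * K < e1" using \<open>0 < \<tau>\<close> by (simp add: algebra_simps)
  have "\<tau> * (L + 1) \<le> e2" using assms by (simp add: \<tau>_def pos_le_divide_eq[symmetric])
  then show "\<tau> * L \<le> e2" using \<open>0 < \<tau>\<close> by (simp add: algebra_simps)
qed

section \<open>Regularity, continuity of integrals and pointwise bounds for one regularised
  solution\<close>

locale regularised_solution =
  fixes \<alpha> \<epsilon> M :: real and u0 :: "'a::euclidean_space \<Rightarrow> real" and u :: "real \<Rightarrow> 'a \<Rightarrow> real"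
  assumes alpha: "0 < \<alpha>" "\<alpha> < 1" and eps: "0 < \<epsilon>"
    and u0: "\<And>x. 0 \<le> u0 x" "\<And>x. u0 x \<le> M" "integrable lborel u0"
    and solution: "classical_solution \<alpha> \<epsilon> u0 u"
begin

lemma cont_u: "continuous_on ({0..} \<times> UNIV) (\<lambda>(t, x). u t x)"
  and bdd_u: "bounded ((\<lambda>(t, x). u t x) ` ({0..T} \<times> UNIV))"
  and L1_u: "continuous_L1 u"
  and C12_u: "C12 u"
  and init: "u 0 x = u0 x"
  using solution by (simp_all add: classical_solution_def)

abbreviation u_t :: "real \<Rightarrow> 'a \<Rightarrow> real" where "u_t t x \<equiv> deriv (\<lambda>s. u s x) t"

definition mobility :: "real \<Rightarrow> 'a \<Rightarrow> real" where
  "mobility t x = (\<epsilon> + max (u t x) 0) powr \<alpha>"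

lemma equation:
  assumes "0 < t"
  shows "divergence_exists (\<lambda>y. mobility t y *\<^sub>R grad_newton (u t) y) x"
    "u_t t x = divergence (\<lambda>y. mobility t y *\<^sub>R grad_newton (u t) y) x + \<epsilon> * laplacian (u t) x"
  using solution assms unfolding classical_solution_def Let_def mobility_def by blast+

lemma poisson:
  assumes "0 < t"
  shows "divergence_exists (grad_newton (u t)) x" "divergence (grad_newton (u t)) x = - u t x"
proof -
  have "divergence_exists (grad_newton (u t)) x" "- divergence (grad_newton (u t)) x = u t x"
    using solution assms unfolding classical_solution_def by blast+
  then show "divergence_exists (grad_newton (u t)) x" "divergence (grad_newton (u t)) x = - u t x" by auto
qed

lemma time_derivative: "0 < t \<Longrightarrow> ((\<lambda>s. u s x) has_real_derivative u_t t x) (at t)"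
  using C12_u unfolding C12_def by (simp add: DERIV_deriv_iff_field_differentiable)

lemma has_partial_u: "0 < t \<Longrightarrow> i \<in> Basis \<Longrightarrow> has_partial i (u t) x (partial i (u t) x)"
  using C12_u unfolding C12_def by (simp add: has_partial_iff)

lemma has_partial2_u:
  "0 < t \<Longrightarrow> i \<in> Basis \<Longrightarrow> j \<in> Basis \<Longrightarrow> has_partial j (partial i (u t)) x (partial j (partial i (u t)) x)"
  using C12_u unfolding C12_def by (simp add: has_partial_iff)

lemma cont_u_t: "continuous_on ({0<..} \<times> UNIV) (\<lambda>(t, x). u_t t x)"
  using C12_u unfolding C12_def by simp

lemma continuous_slice:
  assumes "continuous_on (T \<times> UNIV) (\<lambda>(t, x). f t x)" "t \<in> T"
  shows "continuous_on UNIV (f t :: 'a \<Rightarrow> real)"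
proof -
  have "continuous_on UNIV (\<lambda>x::'a. (t, x))" by (intro continuous_intros)
  from continuous_on_compose2[OF assms(1) this] show ?thesis using assms(2) by auto
qed

lemma cont_slice: "0 \<le> t \<Longrightarrow> continuous_on UNIV (u t)"
  by (rule continuous_slice[OF cont_u]) simp

lemma cont_u_t_slice: "0 < t \<Longrightarrow> continuous_on UNIV (u_t t)"
  by (rule continuous_slice[OF cont_u_t]) simp

lemma cont_partial: "0 < t \<Longrightarrow> i \<in> Basis \<Longrightarrow> continuous_on UNIV (partial i (u t))"
  using C12_u unfolding C12_def by (intro continuous_slice[of "{0<..}" "\<lambda>t. partial i (u t)"]) auto

lemma cont_partial2:
  "0 < t \<Longrightarrow> i \<in> Basis \<Longrightarrow> j \<in> Basis \<Longrightarrow> continuous_on UNIV (partial j (partial i (u t)))"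
  using C12_u unfolding C12_def
  by (intro continuous_slice[of "{0<..}" "\<lambda>t. partial j (partial i (u t))"]) auto

lemma sup_bound: obtains A where "0 \<le> A" "\<And>t x. t \<in> {0..T} \<Longrightarrow> \<bar>u t x\<bar> \<le> A"
proof -
  obtain A where A: "0 < A" "\<forall>v\<in>(\<lambda>(t, x). u t x) ` ({0..T} \<times> UNIV). norm v \<le> A"
    using bdd_u[of T] unfolding bounded_pos by auto
  show thesis
  proof (rule that[of A])
    fix t x assume "t \<in> {0..T}"
    then have "u t x \<in> (\<lambda>(t, x). u t x) ` ({0..T} \<times> UNIV)" by force
    then show "\<bar>u t x\<bar> \<le> A" using A(2) by fastforce
  qed (use A in auto)
qed

lemma integrable_u: "0 \<le> t \<Longrightarrow> integrable lborel (u t)"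
  using L1_u by (simp add: continuous_L1_def)

lemma L1_tendsto: "0 \<le> s \<Longrightarrow> ((\<lambda>t. \<integral>x. \<bar>u t x - u s x\<bar> \<partial>lborel) \<longlongrightarrow> 0) (at s within {0..})"
  using L1_u by (simp add: continuous_L1_def)

text \<open>A weight of size at most 1 and a 1-Lipschitz \<open>F\<close> make the integrals differ
  by no more than the L^1 distance. It is used with \<open>F\<close> the absolute value for the mass
  bound on [0, T], and with \<open>F\<close> the identity for the cut mass, including continuity at
  t = 0.\<close>

lemma continuous_on_weighted_mass:
  assumes z: "\<And>x. \<bar>\<zeta> x\<bar> \<le> 1" and meas[measurable]: "\<zeta> \<in> borel_measurable borel"
    and F: "\<And>a b. \<bar>F a - F b\<bar> \<le> \<bar>a - b\<bar>" "F 0 = (0::real)"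
  shows "continuous_on {0..} (\<lambda>t. \<integral>x. \<zeta> x * F (u t x) \<partial>lborel)"
  unfolding continuous_on_def
proof
  fix s :: real assume s: "s \<in> {0..}"
  have "\<bar>F a - F b\<bar> \<le> \<bar>a - b\<bar>" for a b by (rule F)
  then have "continuous_on UNIV F"
    unfolding continuous_on_iff dist_real_def by (meson le_less_trans)
  then have [measurable]: "F \<in> borel_measurable borel" by (rule borel_measurable_continuous_onI)
  have int: "integrable lborel (\<lambda>x. \<zeta> x * F (u t x))" if "0 \<le> t" for t
  proof (rule Bochner_Integration.integrable_bound[OF integrable_u[OF that]])
    have [measurable]: "u t \<in> borel_measurable borel" using integrable_u[OF that] by auto
    show "(\<lambda>x. \<zeta> x * F (u t x)) \<in> borel_measurable lborel" by measurable
    have "\<bar>\<zeta> x\<bar> * \<bar>F (u t x)\<bar> \<le> 1 * \<bar>u t x\<bar>" for x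
      using z F(1)[of "u t x" 0] F(2) by (intro mult_mono) auto
    then show "AE x in lborel. norm (\<zeta> x * F (u t x)) \<le> norm (u t x)"
      by (simp add: abs_mult)
  qed
  have "((\<lambda>t. (\<integral>x. \<zeta> x * F (u t x) \<partial>lborel) - (\<integral>x. \<zeta> x * F (u s x) \<partial>lborel)) \<longlongrightarrow> 0) (at s within {0..})"
  proof (rule Lim_null_comparison[OF _ L1_tendsto])
    show "\<forall>\<^sub>F t in at s within {0..}. norm ((\<integral>x. \<zeta> x * F (u t x) \<partial>lborel) - (\<integral>x. \<zeta> x * F (u s x) \<partial>lborel))
      \<le> (\<integral>x. \<bar>u t x - u s x\<bar> \<partial>lborel)"
      unfolding eventually_at_filter
    proof (intro always_eventually allI impI)
      fix t :: real assume t: "t \<in> {0..}"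
      have "(\<integral>x. \<zeta> x * F (u t x) \<partial>lborel) - (\<integral>x. \<zeta> x * F (u s x) \<partial>lborel)
        = (\<integral>x. \<zeta> x * F (u t x) - \<zeta> x * F (u s x) \<partial>lborel)"
        using int s t by simp
      also have "norm \<dots> \<le> (\<integral>x. norm (\<zeta> x * F (u t x) - \<zeta> x * F (u s x)) \<partial>lborel)"
        by (rule integral_norm_bound)
      also have "\<dots> \<le> (\<integral>x. \<bar>u t x - u s x\<bar> \<partial>lborel)"
      proof (rule integral_mono)
        show "integrable lborel (\<lambda>x. norm (\<zeta> x * F (u t x) - \<zeta> x * F (u s x)))"
          using int[of t] int[of s] s t by auto
        show "integrable lborel (\<lambda>x. \<bar>u t x - u s x\<bar>)"
          using integrable_u[of t] integrable_u[of s] s t by auto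
        fix x
        have "\<bar>\<zeta> x\<bar> * \<bar>F (u t x) - F (u s x)\<bar> \<le> 1 * \<bar>u t x - u s x\<bar>"
          using z F(1) by (intro mult_mono) auto
        then show "norm (\<zeta> x * F (u t x) - \<zeta> x * F (u s x)) \<le> \<bar>u t x - u s x\<bar>"
          by (simp add: abs_mult[symmetric] right_diff_distrib)
      qed
      finally show "norm ((\<integral>x. \<zeta> x * F (u t x) \<partial>lborel) - (\<integral>x. \<zeta> x * F (u s x) \<partial>lborel))
        \<le> (\<integral>x. \<bar>u t x - u s x\<bar> \<partial>lborel)" .
    qed
  qed (use s in auto)
  then show "((\<lambda>t. \<integral>x. \<zeta> x * F (u t x) \<partial>lborel) \<longlongrightarrow> (\<integral>x. \<zeta> x * F (u s x) \<partial>lborel)) (at s within {0..})"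
    using LIM_zero_iff by blast
qed

lemma mass_bound: obtains B where "0 \<le> B" "\<And>t. t \<in> {0..T} \<Longrightarrow> (\<integral>x. \<bar>u t x\<bar> \<partial>lborel) \<le> B"
proof -
  have "continuous_on {0..} (\<lambda>t. \<integral>x. 1 * \<bar>u t x\<bar> \<partial>lborel)"
    by (rule continuous_on_weighted_mass) auto
  then have "continuous_on {0..T} (\<lambda>t. \<integral>x. \<bar>u t x\<bar> \<partial>lborel)"
    using continuous_on_subset[of "{0..}" _ "{0..T}"] by simp
  then have "bounded ((\<lambda>t. \<integral>x. \<bar>u t x\<bar> \<partial>lborel) ` {0..T})"
    by (intro compact_imp_bounded compact_continuous_image) auto
  then obtain B where "0 < B" "\<forall>t\<in>{0..T}. norm (\<integral>x. \<bar>u t x\<bar> \<partial>lborel) \<le> B"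
    unfolding bounded_pos by auto
  then show thesis by (intro that[of B]) auto
qed

text \<open>Sup norm and L^1 norm are both bounded on [0, T], and together they control the gradient
  uniformly in time. The bound may depend on the solution, hence on \<epsilon>; it only ever
  multiplies terms that are sent to zero.\<close>

lemma gradient_bound:
  obtains G where "0 \<le> G" "\<And>t x. t \<in> {0..T} \<Longrightarrow> norm (grad_newton (u t) x) \<le> G"
proof -
  obtain A where A: "0 \<le> A" "\<And>t x. t \<in> {0..T} \<Longrightarrow> \<bar>u t x\<bar> \<le> A" using sup_bound[of T] by blast
  obtain B where B: "0 \<le> B" "\<And>t. t \<in> {0..T} \<Longrightarrow> (\<integral>x. \<bar>u t x\<bar> \<partial>lborel) \<le> B" using mass_bound[of T] by blast
  define c where "c = real DIM('a) * measure lborel (ball (0::'a) 1)"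
  have "0 < measure lborel (ball (0::'a) 1)"
    using unit_ball_vol_pos[of "real DIM('a)"] by (simp add: content_ball)
  then have c: "0 < c" by (simp add: c_def)
  show thesis
  proof (rule that[of "(A * c + B) / c"])
    fix t x assume t: "t \<in> {0..T}"
    interpret bounded_density "u t" A
      by unfold_locales (use t A integrable_u in auto)
    have "norm (grad_newton (u t) x) \<le> V / c_d" by (rule norm_grad_newton_le)
    also have "\<dots> \<le> (A * c + B) / c"
      unfolding V_def c_d_def c_def[symmetric] using B(2)[OF t] c by (intro divide_right_mono) auto
    finally show "norm (grad_newton (u t) x) \<le> (A * c + B) / c" .
  qed (use A B c in auto)
qed

text \<open>The partials \<open>E\<close> of the mobility are a parameter because the positive part
  has a kink at u = 0 and the sign of u is not yet known. The formula is used first with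
  \<open>E\<close> equal to 0 where u < 0, and after nonnegativity with the derivative of the
  power.\<close>

lemma divergence_flux:
  assumes t: "0 < t" and E: "\<And>i. i \<in> Basis \<Longrightarrow> has_partial i (mobility t) x (E i)"
  shows "divergence (\<lambda>y. mobility t y *\<^sub>R grad_newton (u t) y) x =
    (\<Sum>i\<in>Basis. E i * (grad_newton (u t) x \<bullet> i)) - mobility t x * u t x"
proof -
  have "partial i (\<lambda>y. (mobility t y *\<^sub>R grad_newton (u t) y) \<bullet> i) x =
     E i * (grad_newton (u t) x \<bullet> i) + mobility t x * partial i (\<lambda>y. grad_newton (u t) y \<bullet> i) x"
    if i: "i \<in> Basis" for i
  proof -
    have "has_partial i (\<lambda>y. grad_newton (u t) y \<bullet> i) x (partial i (\<lambda>y. grad_newton (u t) y \<bullet> i) x)"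
      using poisson(1)[OF t, of x] i by (simp add: divergence_exists_def has_partial_iff)
    from has_partial_mult[OF E[OF i] this] show ?thesis
      by (simp add: has_partial_iff)
  qed
  then have "divergence (\<lambda>y. mobility t y *\<^sub>R grad_newton (u t) y) x =
    (\<Sum>i\<in>Basis. E i * (grad_newton (u t) x \<bullet> i)) + mobility t x * divergence (grad_newton (u t)) x"
    by (simp add: divergence_def sum.distrib sum_distrib_left)
  then show ?thesis using poisson(2)[OF t] by simp
qed

text \<open>The sign \<sigma> treats maxima and minima together. Since t0 may be the final time,
  only earlier times are compared, so the time derivative gets a sign instead of vanishing; in space
  the penalty contributes its own gradient and second derivatives.\<close>

lemma maximum_conditions:
  assumes \<sigma>: "\<sigma> = 1 \<or> \<sigma> = (-1::real)" and t0: "0 < t0" "t0 \<le> T"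
    and max: "\<And>t x. t \<in> {0..T} \<Longrightarrow> \<sigma> * u t x - \<delta> * (x \<bullet> x) \<le> \<sigma> * u t0 x0 - \<delta> * (x0 \<bullet> x0)"
  shows "0 \<le> \<sigma> * u_t t0 x0"
    and "i \<in> Basis \<Longrightarrow> \<sigma> * partial i (u t0) x0 = 2 * \<delta> * (x0 \<bullet> i)"
    and "\<sigma> * laplacian (u t0) x0 \<le> 2 * real DIM('a) * \<delta>"
proof -
  show "0 \<le> \<sigma> * u_t t0 x0"
  proof (rule ccontr)
    assume "\<not> 0 \<le> \<sigma> * u_t t0 x0"
    moreover have "((\<lambda>s. \<sigma> * u s x0) has_real_derivative \<sigma> * u_t t0 x0) (at t0)"
      using DERIV_cmult[OF time_derivative[OF t0(1)]] by simp
    ultimately obtain d where d: "0 < d" "\<And>h. 0 < h \<Longrightarrow> h < d \<Longrightarrow> \<sigma> * u t0 x0 < \<sigma> * u (t0 - h) x0"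
      using DERIV_neg_dec_left[of "\<lambda>s. \<sigma> * u s x0"] by (metis not_le)
    \<comment> \<open>The cap \<open>t0\<close> keeps the earlier time \<open>t0 - h\<close> inside
      the interval.\<close>
    define h where "h = min (d / 2) t0"
    have "0 < h" "h < d" "h \<le> t0" using d t0 by (auto simp: h_def min_def)
    then show False using d(2)[of h] max[of "t0 - h" x0] t0 by auto
  qed
  have dir: "\<sigma> * partial i (u t0) x0 = 2 * \<delta> * (x0 \<bullet> i) \<and> \<sigma> * partial i (partial i (u t0)) x0 \<le> 2 * \<delta>"
    if i: "i \<in> Basis" for i
  proof -
    have d1: "((\<lambda>s. \<sigma> * u t0 (x0 + s *\<^sub>R i)) has_real_derivative \<sigma> * partial i (u t0) (x0 + s *\<^sub>R i)) (at s)" for s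
      using DERIV_cmult[OF has_partial_line[OF has_partial_u[OF t0(1) i]]] .
    have d2: "((\<lambda>s. \<sigma> * partial i (u t0) (x0 + s *\<^sub>R i)) has_real_derivative \<sigma> * partial i (partial i (u t0)) x0) (at 0)"
      using DERIV_cmult[OF has_partial2_u[OF t0(1) i i, of x0, unfolded has_partial_def]] .
    have mx: "\<sigma> * u t0 (x0 + s *\<^sub>R i) - (2 * \<delta> * (x0 \<bullet> i) * s + \<delta> * s\<^sup>2) \<le> \<sigma> * u t0 (x0 + 0 *\<^sub>R i)" for s
    proof -
      have "(x0 + s *\<^sub>R i) \<bullet> (x0 + s *\<^sub>R i) = x0 \<bullet> x0 + 2 * (x0 \<bullet> i) * s + s\<^sup>2"
        using i by (simp add: inner_add_left inner_add_right inner_commute power2_eq_square)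
      then have "\<delta> * ((x0 + s *\<^sub>R i) \<bullet> (x0 + s *\<^sub>R i)) = \<delta> * (x0 \<bullet> x0) + (2 * \<delta> * (x0 \<bullet> i) * s + \<delta> * s\<^sup>2)"
        by (simp add: algebra_simps)
      then show ?thesis using max[of t0 "x0 + s *\<^sub>R i"] t0 by simp
    qed
    show ?thesis using second_derivative_test[OF d1 d2 mx] by simp
  qed
  then show "i \<in> Basis \<Longrightarrow> \<sigma> * partial i (u t0) x0 = 2 * \<delta> * (x0 \<bullet> i)" by simp
  have "\<sigma> * laplacian (u t0) x0 = (\<Sum>i\<in>Basis. \<sigma> * partial i (partial i (u t0)) x0)"
    by (simp add: laplacian_def sum_distrib_left)
  also have "\<dots> \<le> (\<Sum>i\<in>(Basis::'a set). 2 * \<delta>)" using dir by (intro sum_mono) auto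
  finally show "\<sigma> * laplacian (u t0) x0 \<le> 2 * real DIM('a) * \<delta>" by simp
qed

text \<open>Where \<open>u < 0\<close> the mobility is locally constant, so the drift disappears and the
  zeroth order term pushes \<open>u\<close> up.\<close>

lemma nonneg:
  assumes "0 \<le> t1"
  shows "0 \<le> u t1 x1"
proof (rule ccontr)
  assume neg: "\<not> 0 \<le> u t1 x1"
  \<comment> \<open>Half of the depth: the penalty at (t1, x1) may use up one \<eta>, and the other
    one remains at the penalised minimum.\<close>
  define \<eta> where "\<eta> = - u t1 x1 / 2"
  have \<eta>: "0 < \<eta>" using neg by (simp add: \<eta>_def)
  obtain A where A: "0 \<le> A" "\<And>t x. t \<in> {0..t1} \<Longrightarrow> \<bar>u t x\<bar> \<le> A" using sup_bound[of t1] by blast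
  have "0 < \<epsilon> powr \<alpha> * \<eta>" using eps \<eta> by simp
  \<comment> \<open>The first smallness condition lets the zeroth order term beat \<epsilon> times
    the Laplacian of the penalty; the second keeps the penalty at \<open>x1\<close> below
    \<eta>.\<close>
  with \<eta> eps obtain \<delta> where \<delta>: "0 < \<delta>" "\<delta> * (2 * real DIM('a) * \<epsilon>) < \<epsilon> powr \<alpha> * \<eta>" "\<delta> * (x1 \<bullet> x1) \<le> \<eta>"
    using ex_small_scale[of "2 * real DIM('a) * \<epsilon>" "x1 \<bullet> x1" "\<epsilon> powr \<alpha> * \<eta>" \<eta>] by auto
  obtain t0 x0 where t0: "t0 \<in> {0..t1}"
    and max: "\<And>t x. t \<in> {0..t1} \<Longrightarrow> - 1 * u t x - \<delta> * (x \<bullet> x) \<le> - 1 * u t0 x0 - \<delta> * (x0 \<bullet> x0)"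
  proof (rule penalised_maximum[of t1 "\<lambda>t x. - 1 * u t x" A \<delta>])
    have "continuous_on ({0..t1} \<times> UNIV) (\<lambda>p. - (case p of (t, x) \<Rightarrow> u t x))"
      by (intro continuous_intros continuous_on_subset[OF cont_u]) auto
    then show "continuous_on ({0..t1} \<times> UNIV) (\<lambda>(t, x). - 1 * u t x)" by (simp add: split_beta')
  qed (use A assms \<delta> in auto)
  have "- u t0 x0 \<ge> \<eta> + \<delta> * (x0 \<bullet> x0)"
    using max[of t1 x1] assms \<delta>(3) by (simp add: \<eta>_def)
  then have u_neg: "u t0 x0 \<le> - \<eta>" using \<delta>(1) by (smt (verit) inner_ge_zero mult_nonneg_nonneg)
  \<comment> \<open>The equation is available only for positive times; the initial datum excludes t0
    = 0.\<close>
  have "t0 \<noteq> 0" using u_neg \<eta> init[of x0] u0(1)[of x0] by auto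
  then have t0': "0 < t0" "t0 \<le> t1" using t0 by auto
  have "has_partial i (mobility t0) x0 0" if i: "i \<in> Basis" for i
  proof -
    have "((\<lambda>v. (\<epsilon> + max v 0) powr \<alpha>) has_real_derivative 0) (at (u t0 x0))"
      by (rule has_field_derivative_transform_within_open[of "\<lambda>_. \<epsilon> powr \<alpha>" _ _ "{..<0}"])
         (use \<eta> u_neg in auto)
    from has_partial_chain[OF has_partial_u[OF t0'(1) i] this] show ?thesis
      by (simp add: mobility_def[abs_def])
  qed
  from divergence_flux[OF t0'(1) this]
  have "u_t t0 x0 = - (\<epsilon> powr \<alpha> * u t0 x0) + \<epsilon> * laplacian (u t0) x0"
    using equation(2)[OF t0'(1), of x0] u_neg \<eta> by (simp add: mobility_def)
  moreover have "0 \<le> - 1 * u_t t0 x0" "- 1 * laplacian (u t0) x0 \<le> 2 * real DIM('a) * \<delta>"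
    using maximum_conditions[OF _ t0' max] by auto
  moreover from this have "\<epsilon> * (- 1 * laplacian (u t0) x0) \<le> \<epsilon> * (2 * real DIM('a) * \<delta>)"
    using eps by (intro mult_left_mono) auto
  moreover have "\<epsilon> powr \<alpha> * \<eta> \<le> \<epsilon> powr \<alpha> * (- u t0 x0)" using u_neg by (intro mult_left_mono) auto
  ultimately show False using \<delta>(2) by (simp add: mult_ac)
qed

lemma mobility_eq: "0 \<le> t \<Longrightarrow> mobility t = (\<lambda>x. (\<epsilon> + u t x) powr \<alpha>)"
  using nonneg by (simp add: mobility_def fun_eq_iff)

lemma has_partial_mobility:
  assumes "0 < t" "i \<in> Basis"
  shows "has_partial i (mobility t) x (\<alpha> * (\<epsilon> + u t x) powr (\<alpha> - 1) * partial i (u t) x)"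
proof -
  have "0 < \<epsilon> + u t x" using eps nonneg[of t x] assms by simp
  then have "((\<lambda>v. (\<epsilon> + v) powr \<alpha>) has_real_derivative \<alpha> * (\<epsilon> + u t x) powr (\<alpha> - 1)) (at (u t x))"
    by (auto intro!: derivative_eq_intros)
  from has_partial_chain[OF has_partial_u[OF assms] this] show ?thesis
    using assms by (simp add: mobility_eq)
qed

lemma evolution:
  assumes "0 < t"
  shows "u_t t x = (\<Sum>i\<in>Basis. \<alpha> * (\<epsilon> + u t x) powr (\<alpha> - 1) * partial i (u t) x * (grad_newton (u t) x \<bullet> i))
    - mobility t x * u t x + \<epsilon> * laplacian (u t) x"
  using equation(2)[OF assms] divergence_flux[OF assms has_partial_mobility[OF assms]] by simp

text \<open>The exponent \<alpha> - 1 is negative, so \<epsilon> > 0 is what keeps the slope of the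
  mobility bounded where u vanishes.\<close>

lemma powr_le_eps: "0 \<le> v \<Longrightarrow> (\<epsilon> + v) powr (\<alpha> - 1) \<le> \<epsilon> powr (\<alpha> - 1)"
  using alpha eps by (intro powr_mono2') auto

lemma mobility_ge: "0 \<le> t \<Longrightarrow> \<epsilon> powr \<alpha> \<le> mobility t x"
  using alpha eps nonneg[of t x] by (simp add: mobility_eq powr_mono2)

text \<open>At a penalised maximum above \<open>M\<close> the zeroth order term is at most
  -\<epsilon>^\<alpha> \<eta>. Unlike below zero, the drift is present here; it is a bounded vector
  field times grad u, and grad u equals the gradient of the penalty, which must be shown to be small
  although the maximum point may lie far out.\<close>

lemma upper_bound:
  assumes "0 \<le> t1"
  shows "u t1 x1 \<le> M"
proof (rule ccontr)
  assume big: "\<not> u t1 x1 \<le> M"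
  define \<eta> where "\<eta> = (u t1 x1 - M) / 2"
  have \<eta>: "0 < \<eta>" using big by (simp add: \<eta>_def)
  have M: "0 \<le> M" using u0(1,2) by (rule order_trans)
  obtain A where A: "0 \<le> A" "\<And>t x. t \<in> {0..t1} \<Longrightarrow> \<bar>u t x\<bar> \<le> A" using sup_bound[of t1] by blast
  obtain G where G: "0 \<le> G" "\<And>t x. t \<in> {0..t1} \<Longrightarrow> norm (grad_newton (u t) x) \<le> G"
    using gradient_bound[of t1] by blast
  define c where "c = \<alpha> * \<epsilon> powr (\<alpha> - 1)"
  \<comment> \<open>The coefficient of \<tau> in the final estimate: d drift terms, each bounded by
    c times 2 \<tau> (2 A + 1) times G, and \<epsilon> times the Laplacian.\<close>
  define K where "K = real DIM('a) * (c * (2 * (2 * A + 1) * G)) + 2 * real DIM('a) * \<epsilon>"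
  have c: "0 < c" using alpha eps by (simp add: c_def)
  have "0 < \<epsilon> powr \<alpha> * \<eta>" "0 \<le> K" using eps \<eta> c A G by (auto simp: K_def)
  with \<eta> obtain \<tau> where \<tau>: "0 < \<tau>" "\<tau> \<le> 1" "\<tau> * K < \<epsilon> powr \<alpha> * \<eta>" "\<tau> * (x1 \<bullet> x1) \<le> \<eta>"
    using ex_small_scale[of K "x1 \<bullet> x1" "\<epsilon> powr \<alpha> * \<eta>" \<eta>] by auto
  \<comment> \<open>Squaring the scale controls the distant maximum point: \<delta> |x0|^2 \<le> 2 A
    says that \<tau> |x0| is bounded, so the penalty gradient 2 \<delta> x0 = 2 \<tau> (\<tau> x0)
    is of order \<tau>.\<close>
  define \<delta> where "\<delta> = \<tau> * \<tau>"
  have \<delta>: "0 < \<delta>" "\<delta> \<le> \<tau>" using \<tau> by (auto simp: \<delta>_def mult_left_le)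
  obtain t0 x0 where t0: "t0 \<in> {0..t1}"
    and max: "\<And>t x. t \<in> {0..t1} \<Longrightarrow> 1 * u t x - \<delta> * (x \<bullet> x) \<le> 1 * u t0 x0 - \<delta> * (x0 \<bullet> x0)"
    and x0: "\<delta> * (x0 \<bullet> x0) \<le> 2 * A"
  proof (rule penalised_maximum[of t1 "\<lambda>t x. 1 * u t x" A \<delta>])
    show "continuous_on ({0..t1} \<times> UNIV) (\<lambda>(t, x). 1 * u t x)"
      by (simp, rule continuous_on_subset[OF cont_u]) auto
  qed (use A assms \<delta> in auto)
  have "\<delta> * (x1 \<bullet> x1) \<le> \<eta>"
    using \<delta>(2) \<tau>(4) mult_right_mono[of \<delta> \<tau> "x1 \<bullet> x1"] by simp
  then have "u t0 x0 \<ge> M + \<eta> + \<delta> * (x0 \<bullet> x0)"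
    using max[of t1 x1] assms by (simp add: \<eta>_def field_simps)
  moreover have "0 \<le> \<delta> * (x0 \<bullet> x0)" using \<delta> by simp
  ultimately have u_big: "M + \<eta> \<le> u t0 x0" by linarith
  have "t0 \<noteq> 0" using u_big \<eta> init[of x0] u0(2)[of x0] by auto
  then have t0': "0 < t0" "t0 \<le> t1" using t0 by auto
  have mc: "0 \<le> u_t t0 x0" "\<And>i. i \<in> Basis \<Longrightarrow> partial i (u t0) x0 = 2 * \<delta> * (x0 \<bullet> i)"
      "laplacian (u t0) x0 \<le> 2 * real DIM('a) * \<delta>"
    using maximum_conditions[of 1, OF _ t0' max] by auto
  have "(\<tau> * norm x0)\<^sup>2 \<le> 2 * A"
    using x0 by (simp add: \<delta>_def power2_eq_square power2_norm_eq_inner[symmetric] mult_ac)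
  \<comment> \<open>A crude bound that avoids a square root.\<close>
  also have "\<dots> \<le> (2 * A + 1)\<^sup>2" using A by (simp add: power2_eq_square algebra_simps)
  finally have tx: "\<tau> * norm x0 \<le> 2 * A + 1" by (rule power2_le_imp_le) (use A in simp)
  have drift: "\<alpha> * (\<epsilon> + u t0 x0) powr (\<alpha> - 1) * partial i (u t0) x0 * (grad_newton (u t0) x0 \<bullet> i)
      \<le> c * (2 * (\<tau> * (2 * A + 1)) * G)" if i: "i \<in> Basis" for i
  proof -
    have "\<bar>partial i (u t0) x0\<bar> \<le> 2 * (\<tau> * (2 * A + 1))"
    proof -
      have "partial i (u t0) x0 = 2 * (\<tau> * (\<tau> * (x0 \<bullet> i)))"
        using mc(2)[OF i] by (simp add: \<delta>_def)
      then have "\<bar>partial i (u t0) x0\<bar> = 2 * (\<tau> * (\<tau> * \<bar>x0 \<bullet> i\<bar>))"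
        using \<tau>(1) by (simp add: abs_mult)
      also have "\<dots> \<le> 2 * (\<tau> * (\<tau> * norm x0))"
        using \<tau> Basis_le_norm[OF i] by (intro mult_left_mono) auto
      also have "\<dots> \<le> 2 * (\<tau> * (2 * A + 1))" using tx \<tau> by (intro mult_left_mono) auto
      finally show ?thesis .
    qed
    moreover have "\<bar>grad_newton (u t0) x0 \<bullet> i\<bar> \<le> G"
      using Basis_le_norm[OF i] G(2)[OF t0] by (rule order_trans)
    moreover have "\<bar>\<alpha> * (\<epsilon> + u t0 x0) powr (\<alpha> - 1)\<bar> \<le> c"
      using powr_le_eps[of "u t0 x0"] nonneg[of t0 x0] t0' alpha
      by (auto simp: c_def abs_mult intro!: mult_left_mono)
    ultimately have "\<bar>\<alpha> * (\<epsilon> + u t0 x0) powr (\<alpha> - 1)\<bar> * (\<bar>partial i (u t0) x0\<bar> * \<bar>grad_newton (u t0) x0 \<bullet> i\<bar>)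
       \<le> c * (2 * (\<tau> * (2 * A + 1)) * G)"
      using c \<tau> A by (intro mult_mono) auto
    then show ?thesis by (simp add: abs_mult[symmetric] mult.assoc)
  qed
  have "(\<Sum>i\<in>Basis. \<alpha> * (\<epsilon> + u t0 x0) powr (\<alpha> - 1) * partial i (u t0) x0 * (grad_newton (u t0) x0 \<bullet> i))
     \<le> (\<Sum>i\<in>(Basis::'a set). c * (2 * (\<tau> * (2 * A + 1)) * G))"
    using drift by (intro sum_mono) auto
  moreover have "\<epsilon> powr \<alpha> * \<eta> \<le> mobility t0 x0 * u t0 x0"
    using mobility_ge[of t0 x0] t0' u_big M \<eta> eps by (intro mult_mono) (auto simp: mobility_def)
  moreover have "\<epsilon> * laplacian (u t0) x0 \<le> \<epsilon> * (2 * real DIM('a) * \<tau>)"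
  proof (rule mult_left_mono)
    have "2 * real DIM('a) * \<delta> \<le> 2 * real DIM('a) * \<tau>" using \<delta>(2) by (intro mult_left_mono) auto
    then show "laplacian (u t0) x0 \<le> 2 * real DIM('a) * \<tau>" using mc(3) by (rule order_trans[rotated])
  qed (use eps in simp)
  moreover have "0 \<le> u_t t0 x0" using mc(1) by simp
  ultimately have "\<epsilon> powr \<alpha> * \<eta> \<le> real DIM('a) * (c * (2 * (\<tau> * (2 * A + 1)) * G)) + \<epsilon> * (2 * real DIM('a) * \<tau>)"
    using evolution[OF t0'(1), of x0] by simp
  also have "\<dots> = \<tau> * K" by (simp add: K_def algebra_simps)
  finally show False using \<tau>(3) by simp
qed

end

subsection \<open>Mass bound\<close>

lemma DERIV_pos_part_power:
  "((\<lambda>s::real. (max 0 s) ^ Suc (Suc n)) has_real_derivative real (Suc (Suc n)) * (max 0 s) ^ Suc n) (at s)"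
proof (cases s "0::real" rule: linorder_cases)
  case less
  show ?thesis
    by (rule has_field_derivative_transform_within_open[of "\<lambda>_. 0" _ _ "{..<0}"]) (use less in auto)
next
  case greater
  have "((\<lambda>s. s ^ Suc (Suc n)) has_real_derivative real (Suc (Suc n)) * (max 0 s) ^ Suc n) (at s)"
    using DERIV_pow[of "Suc (Suc n)" s UNIV] greater by simp
  then show ?thesis
    by (rule has_field_derivative_transform_within_open[of _ _ _ "{0<..}"]) (use greater in auto)
next
  case equal
  have "((\<lambda>h. (max 0 h) ^ Suc (Suc n) / h) \<longlongrightarrow> 0) (at (0::real))"
  proof (rule Lim_null_comparison)
    have "\<bar>(max 0 h) ^ Suc (Suc n) / h\<bar> \<le> \<bar>h\<bar> ^ Suc n" for h :: real
      by (cases "0 < h") (auto simp: not_less mult_nonpos_nonneg)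
    then show "\<forall>\<^sub>F h in at (0::real). norm ((max 0 h) ^ Suc (Suc n) / h) \<le> \<bar>h\<bar> ^ Suc n"
      by (intro always_eventually) auto
    have "((\<lambda>h::real. \<bar>h\<bar> ^ Suc n) \<longlongrightarrow> \<bar>0\<bar> ^ Suc n) (at 0)" by (intro tendsto_intros)
    then show "((\<lambda>h::real. \<bar>h\<bar> ^ Suc n) \<longlongrightarrow> 0) (at 0)" by simp
  qed
  then show ?thesis by (simp add: has_field_derivative_iff equal)
qed

text \<open>The cube makes the truncated paraboloid C^2 across the sphere |x| = r. Its first and
  second partials \<open>cutoff1\<close> and \<open>cutoff2\<close> are explicit, continuous and of
  order 1/r and 1/r^2, the decay that removes the boundary terms.\<close>

definition cutoff :: "real \<Rightarrow> 'a::euclidean_space \<Rightarrow> real" where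
  "cutoff r x = (max 0 (1 - (x \<bullet> x) / r\<^sup>2)) ^ 3"

definition cutoff1 :: "real \<Rightarrow> 'a \<Rightarrow> 'a::euclidean_space \<Rightarrow> real" where
  "cutoff1 r i x = (- 6 / r\<^sup>2) * (x \<bullet> i) * (max 0 (1 - (x \<bullet> x) / r\<^sup>2)) ^ 2"

definition cutoff2 :: "real \<Rightarrow> 'a \<Rightarrow> 'a \<Rightarrow> 'a::euclidean_space \<Rightarrow> real" where
  "cutoff2 r i j x = (- 6 / r\<^sup>2) * (j \<bullet> i) * (max 0 (1 - (x \<bullet> x) / r\<^sup>2)) ^ 2
     + (24 / (r\<^sup>2 * r\<^sup>2)) * (x \<bullet> i) * (x \<bullet> j) * max 0 (1 - (x \<bullet> x) / r\<^sup>2)"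

lemma has_partial_parabola: "has_partial i (\<lambda>x. 1 - (x \<bullet> x) / r\<^sup>2) x (- 2 * (x \<bullet> i) / r\<^sup>2)"
proof -
  have eq: "(x + s *\<^sub>R i) \<bullet> (x + s *\<^sub>R i) = x \<bullet> x + 2 * s * (x \<bullet> i) + s * s * (i \<bullet> i)" for s
    by (simp add: inner_add_left inner_add_right inner_commute)
  then show ?thesis
    unfolding has_partial_def eq divide_inverse by (auto intro!: derivative_eq_intros)
qed

lemma has_partial_cutoff: "has_partial i (cutoff r) x (cutoff1 r i x)"
  using has_partial_chain[OF has_partial_parabola[of i r x] DERIV_pos_part_power[of 1 "1 - (x \<bullet> x) / r\<^sup>2"]]
  by (simp add: cutoff_def[abs_def] cutoff1_def numeral_eq_Suc mult_ac)

lemma has_partial_cutoff1: "has_partial j (cutoff1 r i) x (cutoff2 r i j x)"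
proof -
  have "has_partial j (\<lambda>x. (- 6 / r\<^sup>2) * (x \<bullet> i)) x ((- 6 / r\<^sup>2) * (j \<bullet> i))"
  proof -
    have "((\<lambda>s. c * ((x + s *\<^sub>R j) \<bullet> i)) has_real_derivative c * (j \<bullet> i)) (at 0)" for c
      unfolding inner_add_left inner_scaleR_left by (auto intro!: derivative_eq_intros)
    then show ?thesis unfolding has_partial_def .
  qed
  from has_partial_mult[OF this has_partial_chain[OF has_partial_parabola[of j r x] DERIV_pos_part_power[of 0 "1 - (x \<bullet> x) / r\<^sup>2"]]]
  show ?thesis
    by (simp add: cutoff1_def[abs_def] cutoff2_def numeral_2_eq_2[symmetric] algebra_simps)
qed

lemma continuous_cutoffs:
  "continuous_on UNIV (cutoff r)" "continuous_on UNIV (cutoff1 r i)" "continuous_on UNIV (cutoff2 r i j)"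
  unfolding cutoff_def[abs_def] cutoff1_def[abs_def] cutoff2_def[abs_def] divide_inverse
  by (intro continuous_intros)+

lemma cutoff_base_zero:
  fixes x :: "'a::euclidean_space"
  assumes "0 < r" "r \<le> norm x"
  shows "max 0 (1 - (x \<bullet> x) / r\<^sup>2) = 0"
proof -
  have "r\<^sup>2 \<le> (norm x)\<^sup>2" using assms by (intro power_mono) auto
  then have "1 \<le> (x \<bullet> x) / r\<^sup>2" using assms by (simp add: power2_norm_eq_inner)
  then show ?thesis by simp
qed

lemma cutoff_zero: "0 < r \<Longrightarrow> r \<le> norm x \<Longrightarrow> cutoff r x = 0"
  and cutoff1_zero: "0 < r \<Longrightarrow> r \<le> norm x \<Longrightarrow> cutoff1 r i x = 0"
  and cutoff2_zero: "0 < r \<Longrightarrow> r \<le> norm x \<Longrightarrow> cutoff2 r i j x = 0"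
  by (simp_all add: cutoff_def cutoff1_def cutoff2_def cutoff_base_zero)

lemma cutoff_base_bounds:
  fixes x :: "'a::euclidean_space"
  shows "0 \<le> max 0 (1 - (x \<bullet> x) / r\<^sup>2)" "max 0 (1 - (x \<bullet> x) / r\<^sup>2) \<le> 1"
  by auto

lemma cutoff_bounds: "0 \<le> cutoff r x" "cutoff r x \<le> 1"
  unfolding cutoff_def by (auto intro!: power_le_one)

lemma abs_cutoff_le_1: "\<bar>cutoff r x\<bar> \<le> 1"
  using cutoff_bounds[of r x] by simp

lemma cutoff1_bound:
  assumes "0 < r" "i \<in> Basis"
  shows "\<bar>cutoff1 r i x\<bar> \<le> 6 / r"
proof (cases "r \<le> norm x")
  case False
  have "\<bar>x \<bullet> i\<bar> \<le> r" using Basis_le_norm[OF assms(2), of x] False by simp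
  then have "\<bar>x \<bullet> i\<bar> * (max 0 (1 - (x \<bullet> x) / r\<^sup>2))\<^sup>2 \<le> r * 1"
    using assms cutoff_base_bounds[of x r] by (intro mult_mono power_le_one) auto
  then have "6 / r\<^sup>2 * (\<bar>x \<bullet> i\<bar> * (max 0 (1 - (x \<bullet> x) / r\<^sup>2))\<^sup>2) \<le> 6 / r\<^sup>2 * (r * 1)"
    by (intro mult_left_mono) auto
  also have "\<dots> = 6 / r" using assms by (simp add: power2_eq_square)
  finally show ?thesis by (simp add: cutoff1_def abs_mult mult.assoc)
qed (use assms in \<open>auto simp: cutoff1_zero\<close>)

text \<open>An upper bound suffices because the factor u that it multiplies is nonnegative. For
  equal indices the first summand of \<open>cutoff2\<close> is nonpositive and is dropped; in the
  second, |x . i| \<le> r on the support turns 1/r^4 into 1/r^2.\<close>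

lemma cutoff2_bound:
  assumes "0 < r" "i \<in> Basis"
  shows "cutoff2 r i i x \<le> 24 / r\<^sup>2"
proof (cases "r \<le> norm x")
  case False
  have "\<bar>x \<bullet> i\<bar> \<le> r" using Basis_le_norm[OF assms(2), of x] False by simp
  then have "(\<bar>x \<bullet> i\<bar> * \<bar>x \<bullet> i\<bar>) * max 0 (1 - (x \<bullet> x) / r\<^sup>2) \<le> (r * r) * 1"
    using assms cutoff_base_bounds[of x r] by (intro mult_mono) auto
  then have "24 / (r\<^sup>2 * r\<^sup>2) * ((\<bar>x \<bullet> i\<bar> * \<bar>x \<bullet> i\<bar>) * max 0 (1 - (x \<bullet> x) / r\<^sup>2)) \<le> 24 / (r\<^sup>2 * r\<^sup>2) * (r * r * 1)"
    by (intro mult_left_mono) auto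
  also have "\<dots> = 24 / r\<^sup>2" using assms by (simp add: power2_eq_square)
  finally have "24 / (r\<^sup>2 * r\<^sup>2) * (x \<bullet> i) * (x \<bullet> i) * max 0 (1 - (x \<bullet> x) / r\<^sup>2) \<le> 24 / r\<^sup>2"
    by (simp add: mult.assoc)
  moreover have "(- 6 / r\<^sup>2) * (i \<bullet> i) * (max 0 (1 - (x \<bullet> x) / r\<^sup>2))\<^sup>2 \<le> 0"
    using assms by (simp add: mult_nonpos_nonneg)
  ultimately show ?thesis unfolding cutoff2_def by linarith
qed (use assms in \<open>auto simp: cutoff2_zero\<close>)

lemma cutoff_tendsto_1: "(\<lambda>n. cutoff (real (Suc n)) x) \<longlonglongrightarrow> 1"
proof -
  have "(\<lambda>n. (max 0 (1 - (x \<bullet> x) * (inverse (real (Suc n)))\<^sup>2)) ^ 3) \<longlonglongrightarrow> (max 0 (1 - (x \<bullet> x) * 0\<^sup>2)) ^ 3"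
    by (intro tendsto_intros LIMSEQ_inverse_real_of_nat)
  then show ?thesis by (simp add: cutoff_def divide_inverse power_inverse)
qed

text \<open>Differentiation under the integral sign is carried out with the gauge integral over a
  box; this passes from the Lebesgue integral to it.\<close>

lemma integral_lborel_eq_cbox:
  fixes f :: "'a::euclidean_space \<Rightarrow> real"
  assumes "continuous_on UNIV f" "\<And>x. r \<le> norm x \<Longrightarrow> f x = 0"
  shows "(\<integral>x. f x \<partial>lborel) = integral (cbox (- (r *\<^sub>R One)) (r *\<^sub>R One)) f"
proof -
  have out: "f x = 0" if "x \<notin> cbox (- (r *\<^sub>R One)) (r *\<^sub>R One)" for x
  proof -
    obtain i where i: "i \<in> Basis" "\<not> (- r \<le> x \<bullet> i \<and> x \<bullet> i \<le> r)"
      using \<open>x \<notin> _\<close> by (auto simp: mem_box)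
    then show ?thesis using Basis_le_norm[OF i(1), of x] by (intro assms(2)) auto
  qed
  have "integral (cbox (- (r *\<^sub>R One)) (r *\<^sub>R One)) f
      = integral UNIV (\<lambda>x. if x \<in> cbox (- (r *\<^sub>R One)) (r *\<^sub>R One) then f x else 0)"
    by (simp add: integral_restrict_UNIV)
  also have "(\<lambda>x. if x \<in> cbox (- (r *\<^sub>R One)) (r *\<^sub>R One) then f x else 0) = f"
    using out by (auto simp: fun_eq_iff)
  also have "integral UNIV f = (\<integral>x. f x \<partial>lborel)"
    using assms by (intro integral_lborel integrable_continuous_compact_support[of f r]) auto
  finally show ?thesis ..
qed

lemma integral_diff_add_cmult:
  fixes a b c :: "'b \<Rightarrow> real"
  assumes "integrable N a" "integrable N b" "integrable N c"
  shows "(\<integral>x. a x - b x + k * c x \<partial>N) = (\<integral>x. a x \<partial>N) - (\<integral>x. b x \<partial>N) + k * (\<integral>x. c x \<partial>N)"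
  using assms by simp

section \<open>Evolution of the mass weighted by the cutoff\<close>

context regularised_solution
begin

definition cut_mass :: "real \<Rightarrow> real \<Rightarrow> real" where
  "cut_mass r t = (\<integral>x. cutoff r x * u t x \<partial>lborel)"

lemma measurable_cutoff[measurable]: "cutoff r \<in> borel_measurable (borel :: 'a measure)"
  using continuous_cutoffs(1) by (rule borel_measurable_continuous_onI)

lemma continuous_cut_mass: "continuous_on {0..} (cut_mass r)"
  unfolding cut_mass_def
  by (rule continuous_on_weighted_mass[of "cutoff r" "\<lambda>v. v"]) (use abs_cutoff_le_1 in auto)

text \<open>The cutoff confines the integral to a fixed compact box on which u_t is continuous, so
  differentiating under the integral requires no control of u_t at infinity. It takes place over the
  open set of positive times, where u_t is given.\<close>

lemma DERIV_cut_mass: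
  assumes "0 < r" "0 < t"
  shows "(cut_mass r has_real_derivative (\<integral>x. cutoff r x * u_t t x \<partial>lborel)) (at t)"
proof -
  let ?C = "cbox (- (r *\<^sub>R One)) (r *\<^sub>R One :: 'a)"
  have cc: "continuous_on S (\<lambda>p. cutoff r (snd p))" for S :: "(real \<times> 'a) set"
    by (rule continuous_on_compose2[OF continuous_cutoffs(1)]) (auto intro!: continuous_intros)
  have *: "((\<lambda>s. integral ?C (\<lambda>x. cutoff r x * u s x)) has_field_derivative
      integral ?C (\<lambda>x. cutoff r x * u_t t x)) (at t within {0<..})"
  proof (rule leibniz_rule_field_derivative)
    show "((\<lambda>s. cutoff r x * u s x) has_field_derivative cutoff r x * u_t s x) (at s within {0<..})"
      if "s \<in> {0<..}" for s x
      using that by (intro DERIV_cmult has_field_derivative_at_within[OF time_derivative]) auto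
    show "(\<lambda>x. cutoff r x * u s x) integrable_on ?C" if "s \<in> {0<..}" for s
      using that
      by (intro integrable_continuous continuous_on_mult continuous_on_subset[OF continuous_cutoffs(1)]
          continuous_on_subset[OF cont_slice]) auto
    have "continuous_on ({0<..} \<times> ?C) (\<lambda>p. cutoff r (snd p) * (case p of (s, x) \<Rightarrow> u_t s x))"
      by (intro continuous_on_mult cc continuous_on_subset[OF cont_u_t]) auto
    then show "continuous_on ({0<..} \<times> ?C) (\<lambda>(s, x). cutoff r x * u_t s x)"
      by (simp add: split_beta')
  qed (use assms in auto)
  have eq: "(\<integral>x. cutoff r x * f x \<partial>lborel) = integral ?C (\<lambda>x. cutoff r x * f x)"
    if "continuous_on UNIV f" for f
    using that assms(1)
    by (intro integral_lborel_eq_cbox continuous_on_mult continuous_cutoffs(1)) (auto simp: cutoff_zero)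
  have "((\<lambda>s. integral ?C (\<lambda>x. cutoff r x * u s x)) has_field_derivative
      (\<integral>x. cutoff r x * u_t t x \<partial>lborel)) (at t)"
    using * assms(2) eq[OF cont_u_t_slice] by (simp add: at_within_open[of t "{0<..}"])
  then show ?thesis
    by (rule has_field_derivative_transform_within_open[of _ _ _ "{0<..}"])
       (use assms(2) eq[OF cont_slice] in \<open>auto simp: cut_mass_def\<close>)
qed

text \<open>The test function \<open>\<zeta> ((\<epsilon> + u)\<^sup>\<alpha> - \<epsilon>\<^sup>\<alpha>)\<close> is used rather than \<open>\<zeta> (\<epsilon> + u)\<^sup>\<alpha>\<close>: its second factor is
  at most a multiple of \<open>u\<close>, hence integrable, so that the boundary terms are \<open>O(1/r)\<close>.\<close>

lemma cut_mass_derivative_bound: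
  obtains K where "0 \<le> K"
    "\<And>r t. 1 \<le> r \<Longrightarrow> 0 < t \<Longrightarrow> t \<le> T \<Longrightarrow> (\<integral>x. cutoff r x * u_t t x \<partial>lborel) \<le> K / r"
proof -
  obtain G where G: "0 \<le> G" "\<And>t x. t \<in> {0..T} \<Longrightarrow> norm (grad_newton (u t) x) \<le> G"
    using gradient_bound[of T] by blast
  obtain B where B: "0 \<le> B" "\<And>t. t \<in> {0..T} \<Longrightarrow> (\<integral>x. \<bar>u t x\<bar> \<partial>lborel) \<le> B"
    using mass_bound[of T] by blast
  obtain A where A: "\<And>t x. t \<in> {0..T} \<Longrightarrow> \<bar>u t x\<bar> \<le> A" using sup_bound[of T] by blast
  define c where "c = \<alpha> * \<epsilon> powr (\<alpha> - 1)"
  \<comment> \<open>The first summand pays for the d flux terms: 6/r from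
    \<open>cutoff1_bound\<close>, \<open>c\<close> from \<open>g_le\<close>, \<open>G\<close> for
    the gradient, \<open>B\<close> for the mass. The second pays for the Laplacian: 24/r^2 from
    \<open>cutoff2_bound\<close>, weakened to 24/r by r \<ge> 1.\<close>
  define K where "K = real DIM('a) * (6 * c * G * B) + \<epsilon> * (real DIM('a) * (24 * B))"
  have c: "0 < c" using alpha eps by (simp add: c_def)
  show thesis
  proof (rule that[of K])
    show "0 \<le> K" using c G B eps by (auto simp: K_def)
    fix r t :: real assume r: "1 \<le> r" and t: "0 < t" "t \<le> T"
    have r0: "0 < r" using r by simp
    have tT: "t \<in> {0..T}" using t by auto
    interpret bounded_density "u t" A
      by unfold_locales (use t A integrable_u in auto)
    have U0: "0 \<le> u t x" for x using nonneg t by simp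
    have mass: "(\<integral>x. u t x \<partial>lborel) \<le> B" using B(2)[OF tT] U0 by simp
    let ?g = "\<lambda>x. mobility t x - \<epsilon> powr \<alpha>"
    let ?E = "\<lambda>i x. \<alpha> * (\<epsilon> + u t x) powr (\<alpha> - 1) * partial i (u t) x"
    let ?D = "\<lambda>i x. cutoff1 r i x * ?g x + cutoff r x * ?E i x"
    have pos: "0 < \<epsilon> + u t x" for x using U0[of x] eps by simp
    have cont_g: "continuous_on UNIV ?g"
      using t pos by (auto simp: mobility_eq intro!: continuous_intros cont_slice) (metis less_irrefl pos)
    have cont_E: "continuous_on UNIV (?E i)" if "i \<in> Basis" for i
      using t pos that by (auto intro!: continuous_intros cont_slice cont_partial) (metis less_irrefl pos)
    have part_g: "has_partial i ?g x (?E i x)" if "i \<in> Basis" for i x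
      using has_partial_diff[OF has_partial_mobility[OF t(1) that], where g="\<lambda>_. \<epsilon> powr \<alpha>" and E=0]
      by (simp add: has_partial_def)
    have tf: "test_function (\<lambda>x. cutoff r x * ?g x) ?D r"
    proof
      show "has_partial i (\<lambda>x. cutoff r x * ?g x) x (?D i x)" if "i \<in> Basis" for i x
        by (rule has_partial_mult[OF has_partial_cutoff part_g[OF that]])
      show "continuous_on UNIV (?D i)" if "i \<in> Basis" for i
        by (intro continuous_on_add continuous_on_mult continuous_cutoffs cont_g cont_E that)
    qed (use r0 in \<open>auto simp: cutoff_zero\<close>)
    \<comment> \<open>Since \<alpha> < 1, the slope of v -> (\<epsilon> + v)^\<alpha> is largest at
      v = 0, where it equals c; the mean value theorem does the rest.\<close>
    have g_le: "0 \<le> ?g x \<and> ?g x \<le> c * u t x" for x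
    proof
      show "0 \<le> ?g x" using mobility_ge[of t x] t by simp
      show "?g x \<le> c * u t x"
      proof (cases "u t x = 0")
        case False
        have "\<exists>z>0. z < u t x \<and> (\<epsilon> + u t x) powr \<alpha> - (\<epsilon> + 0) powr \<alpha> = (u t x - 0) * (\<alpha> * (\<epsilon> + z) powr (\<alpha> - 1))"
        proof (rule MVT2)
          show "0 < u t x" using False U0[of x] by simp
          show "((\<lambda>v. (\<epsilon> + v) powr \<alpha>) has_real_derivative \<alpha> * (\<epsilon> + v) powr (\<alpha> - 1)) (at v)"
            if "0 \<le> v" for v using that eps by (auto intro!: derivative_eq_intros)
        qed
        then obtain z where z: "0 < z" "?g x = u t x * (\<alpha> * (\<epsilon> + z) powr (\<alpha> - 1))"
          using t by (auto simp: mobility_eq)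
        have "\<alpha> * (\<epsilon> + z) powr (\<alpha> - 1) \<le> c"
          unfolding c_def using z(1) alpha by (intro mult_left_mono powr_le_eps) auto
        then show ?thesis unfolding z(2) using mult_right_mono[OF _ U0[of x]] by (subst mult.commute)
      qed (use t in \<open>simp add: mobility_eq\<close>)
    qed
    have cs: "integrable lborel f" if "continuous_on UNIV f" "\<And>x. r \<le> norm x \<Longrightarrow> f x = 0" for f :: "'a \<Rightarrow> real"
      by (rule integrable_continuous_compact_support[OF that(1), of r]) (use that in auto)
    have i1: "integrable lborel (\<lambda>x. (cutoff r x * ?E i x) * (grad_newton (u t) x \<bullet> i))" if i: "i \<in> Basis" for i
      by (rule integrable_mult_grad_newton[OF cs i])
         (use r0 i in \<open>auto simp: cutoff_zero intro!: continuous_on_mult[OF continuous_cutoffs(1) cont_E]\<close>)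
    have i2: "integrable lborel (\<lambda>x. (cutoff1 r i x * ?g x) * (grad_newton (u t) x \<bullet> i))" if i: "i \<in> Basis" for i
      by (rule integrable_mult_grad_newton[OF cs i])
         (use r0 in \<open>auto simp: cutoff1_zero intro!: continuous_on_mult[OF continuous_cutoffs(2) cont_g]\<close>)
    have i3: "integrable lborel (\<lambda>x. cutoff r x * ?g x * u t x)"
      using t by (intro cs continuous_on_mult continuous_cutoffs cont_g cont_slice) (use r0 in \<open>auto simp: cutoff_zero\<close>)
    have i4: "integrable lborel (\<lambda>x. cutoff r x * u t x)"
      using t by (intro cs continuous_on_mult continuous_cutoffs cont_slice) (use r0 in \<open>auto simp: cutoff_zero\<close>)
    have i5: "integrable lborel (\<lambda>x. cutoff r x * partial i (partial i (u t)) x)" if "i \<in> Basis" for i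
      using t that by (intro cs continuous_on_mult continuous_cutoffs cont_partial2) (use r0 in \<open>auto simp: cutoff_zero\<close>)
    have i6: "integrable lborel (\<lambda>x. u t x * cutoff2 r i i x)" for i
      using t by (intro cs continuous_on_mult continuous_cutoffs cont_slice) (use r0 in \<open>auto simp: cutoff2_zero\<close>)

    \<comment> \<open>Green's second identity in one direction: with \<zeta> the cutoff, \<zeta> d_i
      u - u d_i \<zeta> is C^1 with compact support, and in its i-th partial the mixed products
      cancel, leaving \<zeta> d_ii u - u d_ii \<zeta>, whose integral is therefore 0.\<close>
    have lap: "(\<integral>x. cutoff r x * partial i (partial i (u t)) x \<partial>lborel) \<le> 24 * B / r" if i: "i \<in> Basis" for i
    proof -
      let ?\<psi> = "\<lambda>x. cutoff r x * partial i (u t) x - u t x * cutoff1 r i x"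
      let ?P = "\<lambda>j x. (cutoff1 r j x * partial i (u t) x + cutoff r x * partial j (partial i (u t)) x)
         - (partial j (u t) x * cutoff1 r i x + u t x * cutoff2 r i j x)"
      interpret \<psi>: test_function ?\<psi> ?P r
      proof
        fix j x assume j: "j \<in> (Basis :: 'a set)"
        show "has_partial j ?\<psi> x (?P j x)"
          by (intro has_partial_diff has_partial_mult has_partial_cutoff has_partial_cutoff1
              has_partial_u has_partial2_u t(1) i j)
      next
        fix j assume j: "j \<in> (Basis :: 'a set)"
        show "continuous_on UNIV (?P j)"
          using t i j by (intro continuous_on_diff continuous_on_add continuous_on_mult continuous_cutoffs
            cont_slice cont_partial cont_partial2) auto
      qed (use r0 in \<open>auto simp: cutoff_zero cutoff1_zero\<close>)
      have eq: "?P i x = cutoff r x * partial i (partial i (u t)) x - u t x * cutoff2 r i i x" for x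
        by simp
      have "(\<integral>x. cutoff r x * partial i (partial i (u t)) x - u t x * cutoff2 r i i x \<partial>lborel) = 0"
        using \<psi>.integral_D[OF i] unfolding eq .
      then have "(\<integral>x. cutoff r x * partial i (partial i (u t)) x \<partial>lborel) = (\<integral>x. u t x * cutoff2 r i i x \<partial>lborel)"
        using i5[OF i] i6[of i] by simp
      also have "\<dots> \<le> (\<integral>x. u t x * (24 / r\<^sup>2) \<partial>lborel)"
        using i6[of i] integrable_w U0 cutoff2_bound[OF r0 i] by (intro integral_mono mult_left_mono) auto
      also have "\<dots> = (\<integral>x. u t x \<partial>lborel) * (24 / r\<^sup>2)" by simp
      also have "\<dots> \<le> B * (24 / r)"
        using mass B r by (intro mult_mono divide_left_mono) (auto simp: power2_eq_square intro!: integral_nonneg_AE U0)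
      finally show ?thesis by (simp add: mult.commute)
    qed
    have flux: "- (\<integral>x. (cutoff1 r i x * ?g x) * (grad_newton (u t) x \<bullet> i) \<partial>lborel) \<le> 6 * c * G * B / r" if i: "i \<in> Basis" for i
    proof -
      have "- (\<integral>x. (cutoff1 r i x * ?g x) * (grad_newton (u t) x \<bullet> i) \<partial>lborel)
         \<le> (\<integral>x. \<bar>(cutoff1 r i x * ?g x) * (grad_newton (u t) x \<bullet> i)\<bar> \<partial>lborel)"
        using integral_abs_bound[of lborel "\<lambda>x. (cutoff1 r i x * ?g x) * (grad_newton (u t) x \<bullet> i)"] by linarith
      also have "\<dots> \<le> (\<integral>x. (6 / r * c * G) * u t x \<partial>lborel)"
      proof (rule integral_mono)
        fix x
        have "\<bar>grad_newton (u t) x \<bullet> i\<bar> \<le> G" using Basis_le_norm[OF i] G(2)[OF tT] by (rule order_trans)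
        then have "(\<bar>cutoff1 r i x\<bar> * ?g x) * \<bar>grad_newton (u t) x \<bullet> i\<bar> \<le> ((6 / r) * (c * u t x)) * G"
          using cutoff1_bound[OF r0 i, of x] g_le[of x] r0 c U0[of x] by (intro mult_mono) auto
        then show "\<bar>(cutoff1 r i x * ?g x) * (grad_newton (u t) x \<bullet> i)\<bar> \<le> (6 / r * c * G) * u t x"
          using g_le[of x] by (simp add: abs_mult mult_ac)
      qed (use i2[OF i] integrable_w in auto)
      also have "\<dots> = (6 / r * c * G) * (\<integral>x. u t x \<partial>lborel)" by simp
      also have "\<dots> \<le> (6 / r * c * G) * B" using mass r0 c G by (intro mult_left_mono) auto
      finally show ?thesis by (simp add: mult_ac)
    qed
    \<comment> \<open>Testing the Poisson equation with \<zeta> g trades the drift term, which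
      contains grad u, for the integral of \<zeta> g u and a flux that sees only grad
      \<zeta>.\<close>
    have poisson_g: "(\<Sum>i\<in>Basis. \<integral>x. (cutoff r x * ?E i x) * (grad_newton (u t) x \<bullet> i) \<partial>lborel)
       = (\<integral>x. cutoff r x * ?g x * u t x \<partial>lborel)
        - (\<Sum>i\<in>Basis. \<integral>x. (cutoff1 r i x * ?g x) * (grad_newton (u t) x \<bullet> i) \<partial>lborel)"
    proof -
      have "(\<integral>x. cutoff r x * ?g x * u t x \<partial>lborel) = (\<integral>x. (\<Sum>i\<in>Basis. ?D i x * (grad_newton (u t) x \<bullet> i)) \<partial>lborel)"
        using weak_poisson[OF tf] by simp
      also have "\<dots> = (\<Sum>i\<in>Basis. \<integral>x. (cutoff1 r i x * ?g x) * (grad_newton (u t) x \<bullet> i)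
          + (cutoff r x * ?E i x) * (grad_newton (u t) x \<bullet> i) \<partial>lborel)"
        unfolding distrib_right using i1 i2 by (intro Bochner_Integration.integral_sum Bochner_Integration.integrable_add)
      also have "\<dots> = (\<Sum>i\<in>Basis. (\<integral>x. (cutoff1 r i x * ?g x) * (grad_newton (u t) x \<bullet> i) \<partial>lborel)
          + (\<integral>x. (cutoff r x * ?E i x) * (grad_newton (u t) x \<bullet> i) \<partial>lborel))"
        using i1 i2 by (intro sum.cong refl Bochner_Integration.integral_add)
      finally show ?thesis by (simp add: sum.distrib)
    qed
    \<comment> \<open>The mobility in the zeroth order term is split as g + \<epsilon>^\<alpha>. The
      g part cancels exactly against the integral of \<zeta> g u coming from
      \<open>poisson_g\<close>, and the other part is nonpositive; this cancellation is why the mass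
      does not grow.\<close>
    have "(\<integral>x. cutoff r x * u_t t x \<partial>lborel) =
      (\<integral>x. (\<Sum>i\<in>Basis. (cutoff r x * ?E i x) * (grad_newton (u t) x \<bullet> i))
        - (cutoff r x * ?g x * u t x + \<epsilon> powr \<alpha> * (cutoff r x * u t x))
        + \<epsilon> * (\<Sum>i\<in>Basis. cutoff r x * partial i (partial i (u t)) x) \<partial>lborel)"
      unfolding evolution[OF t(1)] laplacian_def
      by (intro Bochner_Integration.integral_cong refl)
         (simp add: algebra_simps sum_distrib_left)
    also have "\<dots> = (\<Sum>i\<in>Basis. \<integral>x. (cutoff r x * ?E i x) * (grad_newton (u t) x \<bullet> i) \<partial>lborel)
        - ((\<integral>x. cutoff r x * ?g x * u t x \<partial>lborel) + \<epsilon> powr \<alpha> * (\<integral>x. cutoff r x * u t x \<partial>lborel))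
        + \<epsilon> * (\<Sum>i\<in>Basis. \<integral>x. cutoff r x * partial i (partial i (u t)) x \<partial>lborel)"
    proof -
      have s1: "integrable lborel (\<lambda>x. \<Sum>i\<in>Basis. (cutoff r x * ?E i x) * (grad_newton (u t) x \<bullet> i))"
        by (intro Bochner_Integration.integrable_sum i1)
      have s2: "integrable lborel (\<lambda>x. \<Sum>i\<in>Basis. cutoff r x * partial i (partial i (u t)) x)"
        by (intro Bochner_Integration.integrable_sum i5)
      have e1: "(\<integral>x. (\<Sum>i\<in>Basis. (cutoff r x * ?E i x) * (grad_newton (u t) x \<bullet> i)) \<partial>lborel)
          = (\<Sum>i\<in>Basis. \<integral>x. (cutoff r x * ?E i x) * (grad_newton (u t) x \<bullet> i) \<partial>lborel)"
        by (intro Bochner_Integration.integral_sum i1)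
      have e2: "(\<integral>x. (\<Sum>i\<in>Basis. cutoff r x * partial i (partial i (u t)) x) \<partial>lborel)
          = (\<Sum>i\<in>Basis. \<integral>x. cutoff r x * partial i (partial i (u t)) x \<partial>lborel)"
        by (intro Bochner_Integration.integral_sum i5)
      have s3: "integrable lborel (\<lambda>x. cutoff r x * ?g x * u t x + \<epsilon> powr \<alpha> * (cutoff r x * u t x))"
        by (intro Bochner_Integration.integrable_add i3 integrable_mult_right i4)
      have e3: "(\<integral>x. cutoff r x * ?g x * u t x + \<epsilon> powr \<alpha> * (cutoff r x * u t x) \<partial>lborel)
         = (\<integral>x. cutoff r x * ?g x * u t x \<partial>lborel) + \<epsilon> powr \<alpha> * (\<integral>x. cutoff r x * u t x \<partial>lborel)"
        by (subst Bochner_Integration.integral_add[OF i3 integrable_mult_right[OF i4]]) (rule arg_cong2[where f="(+)", OF refl integral_mult_right_zero])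
      show ?thesis
        by (simp only: integral_diff_add_cmult[OF s1 s3 s2] e1 e2 e3)
    qed
    also have "\<dots> \<le> (\<Sum>i\<in>(Basis::'a set). 6 * c * G * B / r) + \<epsilon> * (\<Sum>i\<in>(Basis::'a set). 24 * B / r)"
    proof -
      have "0 \<le> \<epsilon> powr \<alpha> * (\<integral>x. cutoff r x * u t x \<partial>lborel)"
        by (intro mult_nonneg_nonneg integral_nonneg_AE AE_I2 cutoff_bounds U0) auto
      moreover have "\<epsilon> * (\<Sum>i\<in>Basis. \<integral>x. cutoff r x * partial i (partial i (u t)) x \<partial>lborel) \<le> \<epsilon> * (\<Sum>i\<in>(Basis::'a set). 24 * B / r)"
        using lap eps by (intro mult_left_mono sum_mono) auto
      moreover have "(\<Sum>i\<in>Basis. - (\<integral>x. (cutoff1 r i x * ?g x) * (grad_newton (u t) x \<bullet> i) \<partial>lborel)) \<le> (\<Sum>i\<in>(Basis::'a set). 6 * c * G * B / r)"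
        using flux by (intro sum_mono) auto
      ultimately show ?thesis unfolding poisson_g sum_negf by linarith
    qed
    also have "\<dots> = K / r" by (simp add: K_def add_divide_distrib mult_ac)
    finally show "(\<integral>x. cutoff r x * u_t t x \<partial>lborel) \<le> K / r" .
  qed
qed

text \<open>Up to time \<open>t\<close> the cut mass gains at most t K / r. Here \<open>K\<close>
  does not depend on r, so letting r tend to infinity removes it, and with it every dependence on
  \<epsilon>.\<close>

theorem mass_le:
  assumes "0 \<le> t"
  shows "(\<integral>x. u t x \<partial>lborel) \<le> (\<integral>x. u0 x \<partial>lborel)"
proof (cases "t = 0")
  case False
  then have t: "0 < t" using assms by simp
  obtain K where K: "0 \<le> K"
    "\<And>r s. 1 \<le> r \<Longrightarrow> 0 < s \<Longrightarrow> s \<le> t \<Longrightarrow> (\<integral>x. cutoff r x * u_t s x \<partial>lborel) \<le> K / r"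
    using cut_mass_derivative_bound[of t] by blast
  have le: "cut_mass r t \<le> (\<integral>x. u0 x \<partial>lborel) + t * (K / r)" if r: "1 \<le> r" for r
  proof -
    \<comment> \<open>The mean value theorem asks for a derivative only at interior times; at time 0
      continuity of \<open>cut_mass\<close> is enough, and it comes from the L^1 continuity of
      u.\<close>
    obtain l z where z: "0 < z" "z < t" and l: "DERIV (cut_mass r) z :> l" and eq: "cut_mass r t - cut_mass r 0 = (t - 0) * l"
    proof (rule exE[OF MVT[OF t, of "cut_mass r"]])
      show "continuous_on {0..t} (cut_mass r)" by (rule continuous_on_subset[OF continuous_cut_mass]) auto
      show "cut_mass r differentiable (at x)" if "0 < x" for x
        using DERIV_cut_mass[of r x] r that by (auto simp: real_differentiable_def)
    qed blast
    have "l = (\<integral>x. cutoff r x * u_t z x \<partial>lborel)"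
      using DERIV_unique[OF l DERIV_cut_mass] r z by auto
    then have "l \<le> K / r" using K(2)[of r z] r z by simp
    then have "t * l \<le> t * (K / r)" using t by (intro mult_left_mono) auto
    moreover have "cut_mass r 0 \<le> (\<integral>x. u0 x \<partial>lborel)"
      unfolding cut_mass_def
    proof (rule integral_mono)
      show "integrable lborel (\<lambda>x. cutoff r x * u 0 x)"
        using r by (intro integrable_continuous_compact_support[of _ r] continuous_on_mult continuous_cutoffs cont_slice)
          (auto simp: cutoff_zero)
      show "cutoff r x * u 0 x \<le> u0 x" for x
        using cutoff_bounds[of r x] u0(1)[of x] by (simp add: init mult_left_le_one_le)
    qed (rule u0(3))
    ultimately show ?thesis using eq by simp
  qed
  have "(\<lambda>n. cut_mass (real (Suc n)) t) \<longlonglongrightarrow> (\<integral>x. u t x \<partial>lborel)"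
    unfolding cut_mass_def
  proof (rule integral_dominated_convergence[where w="\<lambda>x. \<bar>u t x\<bar>"])
    have [measurable]: "u t \<in> borel_measurable borel" using integrable_u[OF assms] by auto
    show "u t \<in> borel_measurable lborel" by simp
    show "(\<lambda>x. cutoff (real (Suc n)) x * u t x) \<in> borel_measurable lborel" for n by measurable
    show "integrable lborel (\<lambda>x. \<bar>u t x\<bar>)" using integrable_u[OF assms] by simp
    show "AE x in lborel. (\<lambda>n. cutoff (real (Suc n)) x * u t x) \<longlonglongrightarrow> u t x"
      using tendsto_mult[OF cutoff_tendsto_1 tendsto_const] by (intro AE_I2) fastforce
    show "AE x in lborel. norm (cutoff (real (Suc n)) x * u t x) \<le> \<bar>u t x\<bar>" for n
    proof (rule AE_I2)
      fix x
      have "\<bar>cutoff (real (Suc n)) x\<bar> * \<bar>u t x\<bar> \<le> 1 * \<bar>u t x\<bar>"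
        by (intro mult_right_mono abs_cutoff_le_1) auto
      then show "norm (cutoff (real (Suc n)) x * u t x) \<le> \<bar>u t x\<bar>" by (simp add: abs_mult)
    qed
  qed
  moreover have "(\<lambda>n. (\<integral>x. u0 x \<partial>lborel) + t * (K * inverse (real (Suc n)))) \<longlonglongrightarrow> (\<integral>x. u0 x \<partial>lborel) + t * (K * 0)"
    by (intro tendsto_intros LIMSEQ_inverse_real_of_nat)
  ultimately show ?thesis
    using le by (intro LIMSEQ_le[of _ _ _ "(\<integral>x. u0 x \<partial>lborel)"]) (auto simp: divide_inverse)
qed (simp add: init)

end

subsection \<open>Passage to the limit\<close>

text \<open>Convergence is claimed for Lebesgue measurable sets and test functions, while the
  compactness result lives on Borel functions. A Borel representative \<psi> of \<phi> extended by
  zero bridges the gap; it does not depend on \<open>h\<close>, so it serves the whole sequence and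
  its limit.\<close>

lemma lebesgue_on_integral_transfer:
  fixes \<phi> :: "'b::euclidean_space \<Rightarrow> real"
  assumes S: "S \<in> sets lebesgue" and \<phi>: "integrable (lebesgue_on S) \<phi>"
  obtains \<psi> where "integrable lborel \<psi>"
    "\<And>h. h \<in> borel_measurable borel \<Longrightarrow> (\<integral>z. h z * \<phi> z \<partial>lebesgue_on S) = (\<integral>z. h z * \<psi> z \<partial>lborel)"
proof -
  have int: "integrable lebesgue (\<lambda>z. indicator S z *\<^sub>R \<phi> z)"
    using \<phi> S by (subst (asm) integrable_restrict_space) auto
  then obtain \<psi> where \<psi>[measurable]: "\<psi> \<in> borel_measurable lborel"
    and eq: "AE z in lborel. indicator S z *\<^sub>R \<phi> z = \<psi> z"
    using completion_ex_borel_measurable_real[of "\<lambda>z. indicator S z *\<^sub>R \<phi> z" lborel] by auto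
  have eq': "AE z in lebesgue. indicator S z *\<^sub>R \<phi> z = \<psi> z" using eq by (rule AE_completion)
  show thesis
  proof (rule that[of \<psi>])
    have "integrable lebesgue \<psi>"
      using int by (rule integrable_cong_AE_imp) (use eq' \<psi> in \<open>auto intro: measurable_completion elim: eventually_mono\<close>)
    then show "integrable lborel \<psi>" by (simp add: integrable_completion)
    fix h :: "'b \<Rightarrow> real" assume h[measurable]: "h \<in> borel_measurable borel"
    have h_leb: "h \<in> borel_measurable lebesgue" by (rule measurable_completion) simp
    have "(\<integral>z. h z * \<phi> z \<partial>lebesgue_on S) = (\<integral>z. indicator S z *\<^sub>R (h z * \<phi> z) \<partial>lebesgue)"
      using S by (subst integral_restrict_space) auto
    also have "\<dots> = (\<integral>z. h z * (indicator S z *\<^sub>R \<phi> z) \<partial>lebesgue)"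
      by (simp add: mult.left_commute)
    also have "\<dots> = (\<integral>z. h z * \<psi> z \<partial>lebesgue)"
    proof (rule integral_cong_AE)
      show "(\<lambda>z. h z * (indicator S z *\<^sub>R \<phi> z)) \<in> borel_measurable lebesgue"
        using h_leb int by (intro borel_measurable_times) auto
      show "(\<lambda>z. h z * \<psi> z) \<in> borel_measurable lebesgue"
        by (rule measurable_completion) measurable
    qed (use eq' in \<open>auto elim: eventually_mono\<close>)
    also have "\<dots> = (\<integral>z. h z * \<psi> z \<partial>lborel)"
      by (rule integral_completion) measurable
    finally show "(\<integral>z. h z * \<phi> z \<partial>lebesgue_on S) = (\<integral>z. h z * \<psi> z \<partial>lborel)" .
  qed
qed

lemma borel_imp_lebesgue_on_measurable:
  fixes h :: "'b::euclidean_space \<Rightarrow> real"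
  assumes "h \<in> borel_measurable borel"
  shows "h \<in> borel_measurable (lebesgue_on S)"
  by (rule measurable_restrict_space1, rule measurable_completion) (use assms in simp)

text \<open>A bounded set has finite measure. Essentially bounded test functions are thus admissible
  for weak-\<star> convergence, which makes weak L^1 convergence on \<open>K\<close> a special case
  of it.\<close>

lemma ess_bounded_imp_integrable:
  fixes \<phi> :: "'b::euclidean_space \<Rightarrow> real"
  assumes "K \<in> sets lebesgue" "bounded K" "ess_bounded (lebesgue_on K) \<phi>"
  shows "integrable (lebesgue_on K) \<phi>"
proof -
  interpret finite_measure "lebesgue_on K"
    using bounded_set_imp_lmeasurable[OF assms(2,1)] by (rule finite_measure_lebesgue_on)
  obtain C where \<phi>: "\<phi> \<in> borel_measurable (lebesgue_on K)" and C: "AE z in lebesgue_on K. \<bar>\<phi> z\<bar> \<le> C"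
    using assms(3) unfolding ess_bounded_def by blast
  show ?thesis by (rule integrable_const_bound[OF _ \<phi>, of C]) (use C in \<open>simp only: real_norm_def\<close>)
qed

text \<open>After extension by zero, a single weak-\<star> subsequence on the whole space-time
  yields both convergences. Integrability of the limit is inherited from the mass bound by testing
  with indicators of balls.\<close>

proposition cylinder_compactness:
  fixes v :: "nat \<Rightarrow> real \<Rightarrow> 'a::euclidean_space \<Rightarrow> real"
  assumes T: "0 < T"
    and cont: "\<And>k. continuous_on ({0..} \<times> UNIV) (\<lambda>(t, x). v k t x)"
    and bdd: "\<And>k t x. 0 \<le> t \<Longrightarrow> 0 \<le> v k t x \<and> v k t x \<le> M"
    and int: "\<And>k t. 0 \<le> t \<Longrightarrow> integrable lborel (v k t)"
    and mass: "\<And>k t. 0 \<le> t \<Longrightarrow> (\<integral>x. v k t x \<partial>lborel) \<le> m"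
  obtains r :: "nat \<Rightarrow> nat" and U :: "real \<times> 'a \<Rightarrow> real"
  where "strict_mono r" "weakly_converges_L1_loc (cylinder T) (\<lambda>k (t, x). v (r k) t x) U"
    "weakstar_converges_Linf (lebesgue_on (cylinder T)) (\<lambda>k (t, x). v (r k) t x) U"
    "\<And>z. 0 \<le> U z" "integrable (lebesgue_on (cylinder T)) U" "ess_bounded (lebesgue_on (cylinder T)) U"
proof -
  let ?Q = "cylinder T :: (real \<times> 'a) set"
  have Q: "?Q \<in> sets borel" unfolding cylinder_def by (intro borel_open open_Times) auto
  have Q': "?Q \<in> sets lebesgue" using Q by auto
  \<comment> \<open>Nothing is assumed about \<open>v\<close> at negative times; cutting off to zero
    makes \<open>f\<close> Borel and bounded by \<open>M\<close> everywhere.\<close>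
  define f where "f k z = indicator ?Q z *\<^sub>R (case z of (t, x) \<Rightarrow> v k t x)" for k z
  have f[measurable]: "f k \<in> borel_measurable borel" for k
    unfolding f_def
    by (rule borel_measurable_continuous_on_indicator[OF Q continuous_on_subset[OF cont]])
       (auto simp: cylinder_def)
  have f_eq: "f k z = (case z of (t, x) \<Rightarrow> v k t x)" if "z \<in> ?Q" for k z
    using that by (simp add: f_def)
  have M: "0 \<le> M" using bdd[of 0 undefined undefined] by linarith
  have f_bdd: "0 \<le> f k z \<and> f k z \<le> M" for k z
    using bdd M by (auto simp: f_def indicator_def cylinder_def)
  have m: "0 \<le> m" using mass[of 0 undefined] bdd[of 0] by (smt (verit) integral_nonneg_AE AE_I2)
  obtain r U0 where r: "strict_mono r" and U0[measurable]: "U0 \<in> borel_measurable lborel"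
    and U0_bdd: "\<And>z. 0 \<le> U0 z \<and> U0 z \<le> M"
    and lim: "\<And>\<phi>. integrable lborel \<phi> \<Longrightarrow> (\<lambda>k. \<integral>z. f (r k) z * \<phi> z \<partial>lborel) \<longlonglongrightarrow> (\<integral>z. U0 z * \<phi> z \<partial>lborel)"
    by (rule weakstar_sequentially_compact[of "lborel :: (real \<times> 'a) measure" f M])
       (use f_bdd lborel.sigma_finite_measure_axioms in auto)
  have U0'[measurable]: "U0 \<in> borel_measurable borel" using U0 by simp
  \<comment> \<open>Stated for every measurable \<open>S\<close> in the cylinder so as to serve
    twice: bounded \<open>S\<close> for the local weak convergence, the full cylinder for the
    weak-\<star> one.\<close>
  have lim_on: "(\<lambda>k. \<integral>z. (case z of (t, x) \<Rightarrow> v (r k) t x) * \<phi> z \<partial>lebesgue_on S)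
      \<longlonglongrightarrow> (\<integral>z. U0 z * \<phi> z \<partial>lebesgue_on S)"
    if S: "S \<in> sets lebesgue" "S \<subseteq> ?Q" and \<phi>: "integrable (lebesgue_on S) \<phi>" for S \<phi>
  proof -
    obtain \<psi> where \<psi>: "integrable lborel \<psi>" and tr: "\<And>h. h \<in> borel_measurable borel \<Longrightarrow>
        (\<integral>z. h z * \<phi> z \<partial>lebesgue_on S) = (\<integral>z. h z * \<psi> z \<partial>lborel)"
      using lebesgue_on_integral_transfer[OF S(1) \<phi>] by blast
    have "(\<integral>z. (case z of (t, x) \<Rightarrow> v (r k) t x) * \<phi> z \<partial>lebesgue_on S) = (\<integral>z. f (r k) z * \<psi> z \<partial>lborel)" for k
      unfolding tr[OF f, symmetric] using S(2) f_eq
      by (intro Bochner_Integration.integral_cong refl) (auto simp: space_restrict_space)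
    then show ?thesis using lim[OF \<psi>] by (simp only: tr[OF U0'])
  qed
  have v_meas: "(\<lambda>(t, x). v k t x) \<in> borel_measurable (lebesgue_on S)" if "S \<subseteq> ?Q" for k S
  proof -
    have "f k \<in> borel_measurable (lebesgue_on S)" by (rule borel_imp_lebesgue_on_measurable[OF f])
    also have "?this \<longleftrightarrow> (\<lambda>(t, x). v k t x) \<in> borel_measurable (lebesgue_on S)"
      using that f_eq by (intro measurable_cong) (auto simp: space_restrict_space)
    finally show ?thesis .
  qed
  have v_bdd: "ess_bounded (lebesgue_on S) (\<lambda>(t, x). v k t x)" if S: "S \<subseteq> ?Q" for k S
    unfolding ess_bounded_def
  proof (intro conjI exI AE_I2)
    fix z assume "z \<in> space (lebesgue_on S)"
    then have z: "z \<in> ?Q" using S by (auto simp: space_restrict_space)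
    show "\<bar>case z of (t, x) \<Rightarrow> v k t x\<bar> \<le> M"
      using f_bdd[of k z] unfolding f_eq[OF z] by linarith
  qed (rule v_meas[OF S])
  have U0_ess: "ess_bounded (lebesgue_on S) U0" for S
    unfolding ess_bounded_def using U0_bdd borel_imp_lebesgue_on_measurable[OF U0']
    by (auto intro!: exI[of _ M] AE_I2)
  have weak: "weakly_converges_L1_loc ?Q (\<lambda>k (t, x). v (r k) t x) U0"
    unfolding weakly_converges_L1_loc_def weakly_converges_L1_def
  proof (intro allI impI conjI)
    fix K assume "K \<in> sets lebesgue \<and> bounded K \<and> K \<subseteq> ?Q"
    then have K: "K \<in> sets lebesgue" "bounded K" "K \<subseteq> ?Q" by auto
    note int_K = ess_bounded_imp_integrable[OF K(1,2)]
    show "integrable (lebesgue_on K) (\<lambda>(t, x). v (r k) t x)" for k by (rule int_K[OF v_bdd[OF K(3)]])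
    show "integrable (lebesgue_on K) U0" by (rule int_K[OF U0_ess])
    show "(\<lambda>k. \<integral>z. (case z of (t, x) \<Rightarrow> v (r k) t x) * \<phi> z \<partial>lebesgue_on K)
        \<longlonglongrightarrow> (\<integral>z. U0 z * \<phi> z \<partial>lebesgue_on K)" if "ess_bounded (lebesgue_on K) \<phi>" for \<phi>
      by (rule lim_on[OF K(1,3) int_K[OF that]])
  qed
  have weakstar: "weakstar_converges_Linf (lebesgue_on ?Q) (\<lambda>k (t, x). v (r k) t x) U0"
    unfolding weakstar_converges_Linf_def
  proof (intro allI impI conjI)
    show "ess_bounded (lebesgue_on ?Q) (\<lambda>(t, x). v (r k) t x)" for k by (rule v_bdd) simp
    show "(\<lambda>k. \<integral>z. (case z of (t, x) \<Rightarrow> v (r k) t x) * \<phi> z \<partial>lebesgue_on ?Q)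
        \<longlonglongrightarrow> (\<integral>z. U0 z * \<phi> z \<partial>lebesgue_on ?Q)" if "integrable (lebesgue_on ?Q) \<phi>" for \<phi>
      by (rule lim_on[OF Q' _ that]) simp
  qed (rule U0_ess)
  \<comment> \<open>Tonelli: each time slice has mass at most \<open>m\<close>, and the slices fill
    an interval of length \<open>T\<close>.\<close>
  have f_mass: "(\<integral>\<^sup>+z. ennreal (f k z) \<partial>lborel) \<le> ennreal (T * m)" for k
  proof -
    have "(\<integral>\<^sup>+z. ennreal (f k z) \<partial>lborel) = (\<integral>\<^sup>+z. ennreal (f k z) \<partial>(lborel \<Otimes>\<^sub>M lborel))"
      by (simp add: lborel_prod)
    also have "\<dots> = (\<integral>\<^sup>+t. \<integral>\<^sup>+x. ennreal (f k (t, x)) \<partial>lborel \<partial>lborel)"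
    proof (rule lborel.nn_integral_fst[symmetric])
      show "(\<lambda>z. ennreal (f k z)) \<in> borel_measurable (lborel \<Otimes>\<^sub>M lborel)"
        unfolding lborel_prod by measurable
    qed
    also have "\<dots> \<le> (\<integral>\<^sup>+t. ennreal m * indicator {0<..<T} t \<partial>lborel)"
    proof (rule nn_integral_mono)
      fix t :: real
      show "(\<integral>\<^sup>+x. ennreal (f k (t, x)) \<partial>lborel) \<le> ennreal m * indicator {0<..<T} t"
      proof (cases "t \<in> {0<..<T}")
        case True
        then have "f k (t, x) = v k t x" for x
          using f_eq[of "(t, x)"] by (auto simp: cylinder_def)
        then have "(\<integral>\<^sup>+x. ennreal (f k (t, x)) \<partial>lborel) = (\<integral>\<^sup>+x. ennreal (v k t x) \<partial>lborel)"
          by simp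
        also have "\<dots> = ennreal (\<integral>x. v k t x \<partial>lborel)"
          using True int[of t k] bdd[of t k] by (intro nn_integral_eq_integral) auto
        also have "\<dots> \<le> ennreal m" using True mass[of t k] by (intro ennreal_leI) auto
        finally show ?thesis using True by simp
      qed (simp add: f_def cylinder_def)
    qed
    also have "\<dots> = ennreal m * ennreal T" using T by (subst nn_integral_cmult_indicator) auto
    finally show ?thesis using T m by (simp add: ennreal_mult mult.commute)
  qed
  \<comment> \<open>The constant 1 is not integrable, hence not an admissible test function.
    Indicators of balls are, and monotone convergence over them recovers the integral of
    \<open>U0\<close>.\<close>
  define B where "B n = cball (0 :: real \<times> 'a) (real n)" for n :: nat
  have iB: "integrable lborel (indicator (B n) :: _ \<Rightarrow> real)" for n
    unfolding B_def using emeasure_compact_finite[of "cball (0 :: real \<times> 'a) (real n)"] by simp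
  have iUB: "integrable lborel (\<lambda>z. U0 z * indicator (B n) z)" for n
  proof (rule Bochner_Integration.integrable_bound[OF integrable_mult_right[OF iB, of M]])
    show "(\<lambda>z. U0 z * indicator (B n) z) \<in> borel_measurable lborel"
      using iB[of n] by (intro borel_measurable_times) auto
    show "AE z in lborel. norm (U0 z * indicator (B n) z) \<le> norm (M * indicator (B n) z)"
      using U0_bdd M by (intro AE_I2) (auto simp: indicator_def)
  qed
  have UB_le: "(\<integral>z. U0 z * indicator (B n) z \<partial>lborel) \<le> T * m" for n
  proof (rule LIMSEQ_le_const2[OF lim[OF iB]], intro exI allI impI)
    fix k
    have "ennreal (\<integral>z. f (r k) z * indicator (B n) z \<partial>lborel) = (\<integral>\<^sup>+z. ennreal (f (r k) z * indicator (B n) z) \<partial>lborel)"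
    proof (rule nn_integral_eq_integral[symmetric])
      show "integrable lborel (\<lambda>z. f (r k) z * indicator (B n) z)"
      proof (rule Bochner_Integration.integrable_bound[OF integrable_mult_right[OF iB, of M]])
        show "(\<lambda>z. f (r k) z * indicator (B n) z) \<in> borel_measurable lborel"
          using iB[of n] by (intro borel_measurable_times) auto
        show "AE z in lborel. norm (f (r k) z * indicator (B n) z) \<le> norm (M * indicator (B n) z)"
          using f_bdd M by (intro AE_I2) (auto simp: indicator_def)
      qed
    qed (use f_bdd in \<open>auto simp: indicator_def\<close>)
    also have "\<dots> \<le> (\<integral>\<^sup>+z. ennreal (f (r k) z) \<partial>lborel)"
      using f_bdd by (intro nn_integral_mono ennreal_leI) (auto simp: indicator_def)
    also have "\<dots> \<le> ennreal (T * m)" by (rule f_mass)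
    finally show "(\<integral>z. f (r k) z * indicator (B n) z \<partial>lborel) \<le> T * m"
      using T m by (simp add: ennreal_le_iff)
  qed
  have mono: "mono (\<lambda>n. U0 z * indicator (B n) z)" for z
    by (rule monoI) (use U0_bdd[of z] in \<open>auto simp: indicator_def B_def\<close>)
  have "integrable lborel U0"
  proof -
    have "incseq (\<lambda>n. \<integral>z. U0 z * indicator (B n) z \<partial>lborel)"
      using monoD[OF mono] iUB by (intro incseq_SucI integral_mono) auto
    then obtain L where L: "(\<lambda>n. \<integral>z. U0 z * indicator (B n) z \<partial>lborel) \<longlonglongrightarrow> L"
      using incseq_convergent UB_le by blast
    show ?thesis
    proof (rule integrable_monotone_convergence[OF iUB _ _ L])
      show "AE z in lborel. (\<lambda>n. U0 z * indicator (B n) z) \<longlonglongrightarrow> U0 z"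
      proof (rule AE_I2)
        fix z :: "real \<times> 'a"
        obtain N :: nat where N: "norm z \<le> real N" using real_arch_simple by blast
        have "eventually (\<lambda>n. U0 z * indicator (B n) z = U0 z) sequentially"
          using eventually_ge_at_top[of N] by eventually_elim (use N in \<open>auto simp: B_def\<close>)
        then show "(\<lambda>n. U0 z * indicator (B n) z) \<longlonglongrightarrow> U0 z" by (rule tendsto_eventually)
      qed
    qed (use mono U0 in auto)
  qed
  then have "integrable lebesgue U0" by (simp add: integrable_completion)
  then have "integrable lebesgue (\<lambda>z. indicator ?Q z *\<^sub>R U0 z)"
    by (rule integrable_mult_indicator[OF Q'])
  then have "integrable (lebesgue_on ?Q) U0"
    using integrable_restrict_space[of ?Q lebesgue U0] Q' by simp
  from that[OF r weak weakstar _ this U0_ess] show thesis using U0_bdd by blast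
qed

theorem theorem6p3:
  fixes \<alpha> :: real
    and u0 :: "'a::euclidean_space \<Rightarrow> real"
    and u :: "nat \<Rightarrow> real \<Rightarrow> 'a \<Rightarrow> real"
  assumes "0 < \<alpha>" and "\<alpha> < 1"
    and "integrable lborel u0"
    and "continuous_on UNIV u0" and "bounded (range u0)"
    and "\<And>x. 0 \<le> u0 x"
    and "\<And>n. 1 \<le> n \<Longrightarrow> classical_solution \<alpha> (1 / real n) u0 (u n)"
  shows "\<forall>T>0. \<exists>(r :: nat \<Rightarrow> nat) (U :: real \<times> 'a \<Rightarrow> real).
    strict_mono r \<and> (\<forall>k. 1 \<le> r k) \<and>
    weakly_converges_L1_loc (cylinder T) (\<lambda>k (t, x). u (r k) t x) U \<and>
    weakstar_converges_Linf (lebesgue_on (cylinder T)) (\<lambda>k (t, x). u (r k) t x) U \<and>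
    (AE z in lebesgue_on (cylinder T). 0 \<le> U z) \<and>
    integrable (lebesgue_on (cylinder T)) U \<and>
    ess_bounded (lebesgue_on (cylinder T)) U"
proof (intro allI impI)
  fix T :: real assume T: "0 < T"
  obtain M where M: "\<And>x. u0 x \<le> M"
    using assms(5) unfolding bounded_iff by (auto simp: abs_le_iff)
  \<comment> \<open>The shift by one avoids n = 0, about which nothing is assumed, and later gives 1
    \<le> r k. The bound \<open>M\<close> is the same for all indices, so the estimates are
    uniform.\<close>
  have sol: "regularised_solution \<alpha> (1 / real (Suc k)) M u0 (u (Suc k))" for k
    by unfold_locales (use assms(1-6) M assms(7)[of "Suc k"] in \<open>auto simp del: of_nat_Suc\<close>)
  obtain r :: "nat \<Rightarrow> nat" and U :: "real \<times> 'a \<Rightarrow> real"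
    where r: "strict_mono r"
      and conv: "weakly_converges_L1_loc (cylinder T) (\<lambda>k (t, x). u (Suc (r k)) t x) U"
        "weakstar_converges_Linf (lebesgue_on (cylinder T)) (\<lambda>k (t, x). u (Suc (r k)) t x) U"
      and U: "\<And>z. 0 \<le> U z" "integrable (lebesgue_on (cylinder T)) U" "ess_bounded (lebesgue_on (cylinder T)) U"
    using cylinder_compactness[of T "\<lambda>k. u (Suc k)" M "\<integral>x. u0 x \<partial>lborel"] T
      regularised_solution.cont_u[OF sol] regularised_solution.nonneg[OF sol]
      regularised_solution.upper_bound[OF sol] regularised_solution.integrable_u[OF sol]
      regularised_solution.mass_le[OF sol]
    by blast
  have "strict_mono (\<lambda>k. Suc (r k))" using r by (simp add: strict_mono_def)
  with conv U show "\<exists>(r :: nat \<Rightarrow> nat) (U :: real \<times> 'a \<Rightarrow> real).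
    strict_mono r \<and> (\<forall>k. 1 \<le> r k) \<and>
    weakly_converges_L1_loc (cylinder T) (\<lambda>k (t, x). u (r k) t x) U \<and>
    weakstar_converges_Linf (lebesgue_on (cylinder T)) (\<lambda>k (t, x). u (r k) t x) U \<and>
    (AE z in lebesgue_on (cylinder T). 0 \<le> U z) \<and>
    integrable (lebesgue_on (cylinder T)) U \<and>
    ess_bounded (lebesgue_on (cylinder T)) U"
    by (intro exI[of _ "\<lambda>k. Suc (r k)"] exI[of _ U]) auto
qed

end
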